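(* Let $K$ be a field and let $E$ be a row-finite (directed) graph with $E^0\neq\emptyset$. Then the Leavitt path algebra $L(E)=L_K(E)$ is purely infinite simple (that is, it is both a simple ring and a purely infinite ring) if and only if $E$ has the following three properties: (i) the only hereditary and saturated subsets of $E^0$ are $\emptyset$ and $E^0$; (ii) every cycle in $E$ has an exit; (iii) every vertex of $E$ connects to a cycle.
   Context: Graphs. A (directed) graph $E=(E^0,E^1,r,s)$ consists of two countable sets $E^0$ (vertices), $E^1$ (edges) and functions $r,s:E^1\to E^0$ (range and source). $E$ is row-finite if $s^{-1}(v)$ is finite for every $v\in E^0$. A path is a sequence of edges $\mu=\mu_1\cdots\mu_n$ ($n\ge 1$) with $r(\mu_i)=s(\mu_{i+1})$ for $1\le i\le n-1$; put $s(\mu)=s(\mu_1)$, $r(\mu)=r(\mu_n)$. For vertices $v,w$ write $v\le w$ if $v=w$ or there is a path $\mu$ with $s(\mu)=v$ and $r(\mu)=w$. A cycle is a path $\mu=\mu_1\cdots\mu_n$ with $s(\mu)=r(\mu)$ and $s(\mu_i)\ne s(\mu_j)$ for all $i\neq j$. An edge $e$ is an exit to the path $\mu=\mu_1\cdots\mu_n$ if there is $i$ with $s(e)=s(\mu_i)$ and $e\ne\mu_i$. A vertex $w$ connects to a vertex $v$ if $w\le v$; $w$ connects to a cycle if $w\le v$ for some vertex $v$ lying on a cycle. A subset $H\subseteq E^0$ is hereditary if $w\in H$ and $w\le v$ imply $v\in H$; it is saturated if whenever $s^{-1}(v)\ne\emptyset$ and $\{r(e):s(e)=v\}\subseteq H$,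 then $v\in H$. Leavitt path algebra. For $E$ row-finite and $K$ a field, $L(E)=L_K(E)$ is the associative (not necessarily unital) $K$-algebra generated by the set $E^0\cup E^1\cup (E^1)^*$, where $(E^1)^*=\{e^*:e\in E^1\}$ is a set of formal symbols, subject to the relations: $vw=\delta_{v,w}v$ for $v,w\in E^0$; $e=e\,r(e)=s(e)\,e$ and $e^*=e^*s(e)=r(e)e^*$ for $e\in E^1$; (CK1) $e^*f=\delta_{e,f}\,r(f)$ for $e,f\in E^1$; (CK2) $v=\sum_{e\in E^1:\,s(e)=v}ee^*$ for every $v\in E^0$ with $s^{-1}(v)\neq\emptyset$. Purely infinite rings. Rings are associative but not necessarily unital. An idempotent $e$ of a ring $R$ is infinite if $eR$ is isomorphic as a right $R$-module to a proper direct summand of itself. $R$ is purely infinite if every nonzero right ideal of $R$ contains an infinite idempotent. *)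

theory Defs
  imports
    "HOL-Library.Poly_Mapping"
    "HOL-Library.Countable_Set"
    "HOL-Algebra.QuotRing"
    "Graph_Theory.Arc_Walk"
begin

section \<open>Directed graphs\<close>

text \<open>
  Graphs are well-formed \<^typ>\<open>('v, 'e) pre_digraph\<close>s, with \<^const>\<open>tail\<close> as source map and
  \<^const>\<open>head\<close> as range map. A path is a nonempty arc walk.
\<close>

definition row_finite :: "('v, 'e) pre_digraph \<Rightarrow> bool" where
  "row_finite E \<longleftrightarrow> (\<forall>v \<in> verts E. finite (out_arcs E v))"

definition path_le :: "('v, 'e) pre_digraph \<Rightarrow> 'v \<Rightarrow> 'v \<Rightarrow> bool" where
  "path_le E v w \<longleftrightarrow> v = w \<or> (\<exists>\<mu>. \<mu> \<noteq> [] \<and> pre_digraph.awalk E v \<mu> w)"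

text \<open>
  The library's \<^const>\<open>pre_digraph.cycle\<close> asks for distinct ranges; here the sources of the
  edges are required to be distinct.
\<close>

definition graph_cycle :: "('v, 'e) pre_digraph \<Rightarrow> 'e list \<Rightarrow> bool" where
  "graph_cycle E \<mu> \<longleftrightarrow>
     \<mu> \<noteq> [] \<and> (\<exists>u. pre_digraph.awalk E u \<mu> u) \<and> distinct (map (tail E) \<mu>)"

definition is_exit :: "('v, 'e) pre_digraph \<Rightarrow> 'e list \<Rightarrow> 'e \<Rightarrow> bool" where
  "is_exit E \<mu> e \<longleftrightarrow>
     e \<in> arcs E \<and> (\<exists>i < length \<mu>. tail E e = tail E (\<mu> ! i) \<and> e \<noteq> \<mu> ! i)"

definition connects_to_cycle :: "('v, 'e) pre_digraph \<Rightarrow> 'v \<Rightarrow> bool" where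
  "connects_to_cycle E w \<longleftrightarrow>
     (\<exists>\<mu> v. graph_cycle E \<mu> \<and> v \<in> tail E ` set \<mu> \<and> path_le E w v)"

definition hereditary :: "('v, 'e) pre_digraph \<Rightarrow> 'v set \<Rightarrow> bool" where
  "hereditary E H \<longleftrightarrow>
     H \<subseteq> verts E \<and> (\<forall>w \<in> H. \<forall>v \<in> verts E. path_le E w v \<longrightarrow> v \<in> H)"

definition saturated :: "('v, 'e) pre_digraph \<Rightarrow> 'v set \<Rightarrow> bool" where
  "saturated E H \<longleftrightarrow>
     H \<subseteq> verts E \<and>
     (\<forall>v \<in> verts E. out_arcs E v \<noteq> {} \<and> head E ` out_arcs E v \<subseteq> H \<longrightarrow> v \<in> H)"


section \<open>Rings without unit\<close>

text \<open>
  Rings are carried by the library's ring record; its unit component is never used.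
\<close>

locale nonunital_ring = abelian_group R for R (structure) +
  assumes m_closed: "\<lbrakk>x \<in> carrier R; y \<in> carrier R\<rbrakk> \<Longrightarrow> x \<otimes> y \<in> carrier R"
    and m_assoc: "\<lbrakk>x \<in> carrier R; y \<in> carrier R; z \<in> carrier R\<rbrakk>
          \<Longrightarrow> (x \<otimes> y) \<otimes> z = x \<otimes> (y \<otimes> z)"
    and l_distr: "\<lbrakk>x \<in> carrier R; y \<in> carrier R; z \<in> carrier R\<rbrakk>
          \<Longrightarrow> (x \<oplus> y) \<otimes> z = x \<otimes> z \<oplus> y \<otimes> z"
    and r_distr: "\<lbrakk>x \<in> carrier R; y \<in> carrier R; z \<in> carrier R\<rbrakk>
          \<Longrightarrow> z \<otimes> (x \<oplus> y) = z \<otimes> x \<oplus> z \<otimes> y"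

definition right_ideal :: "'a set \<Rightarrow> ('a, 'm) ring_scheme \<Rightarrow> bool" where
  "right_ideal J R \<longleftrightarrow>
     additive_subgroup J R \<and> (\<forall>x \<in> J. \<forall>r \<in> carrier R. x \<otimes>\<^bsub>R\<^esub> r \<in> J)"

definition two_sided_ideal :: "'a set \<Rightarrow> ('a, 'm) ring_scheme \<Rightarrow> bool" where
  "two_sided_ideal I R \<longleftrightarrow>
     additive_subgroup I R \<and>
     (\<forall>x \<in> I. \<forall>r \<in> carrier R. r \<otimes>\<^bsub>R\<^esub> x \<in> I \<and> x \<otimes>\<^bsub>R\<^esub> r \<in> I)"

text \<open>As usual for rings without unit, a simple ring must have a nonzero product.\<close>

definition simple_ring :: "('a, 'm) ring_scheme \<Rightarrow> bool" where
  "simple_ring R \<longleftrightarrow>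
     nonunital_ring R \<and>
     (\<exists>x \<in> carrier R. \<exists>y \<in> carrier R. x \<otimes>\<^bsub>R\<^esub> y \<noteq> \<zero>\<^bsub>R\<^esub>) \<and>
     (\<forall>I. two_sided_ideal I R \<longrightarrow> I = {\<zero>\<^bsub>R\<^esub>} \<or> I = carrier R)"

text \<open>
  All right modules below are submodules of \<^term>\<open>R\<close> as a right module over itself, that is,
  right ideals.
\<close>

definition right_module_iso ::
    "('a, 'm) ring_scheme \<Rightarrow> 'a set \<Rightarrow> 'a set \<Rightarrow> ('a \<Rightarrow> 'a) \<Rightarrow> bool" where
  "right_module_iso R A B f \<longleftrightarrow>
     bij_betw f A B \<and>
     (\<forall>x \<in> A. \<forall>y \<in> A. f (x \<oplus>\<^bsub>R\<^esub> y) = f x \<oplus>\<^bsub>R\<^esub> f y) \<and>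
     (\<forall>x \<in> A. \<forall>r \<in> carrier R. f (x \<otimes>\<^bsub>R\<^esub> r) = f x \<otimes>\<^bsub>R\<^esub> r)"

definition direct_summand :: "('a, 'm) ring_scheme \<Rightarrow> 'a set \<Rightarrow> 'a set \<Rightarrow> bool" where
  "direct_summand R M A \<longleftrightarrow>
     right_ideal M R \<and>
     (\<exists>N. right_ideal N R \<and> M \<inter> N = {\<zero>\<^bsub>R\<^esub>} \<and> M <+>\<^bsub>R\<^esub> N = A)"

definition infinite_idempotent :: "('a, 'm) ring_scheme \<Rightarrow> 'a \<Rightarrow> bool" where
  "infinite_idempotent R e \<longleftrightarrow>
     e \<in> carrier R \<and> e \<otimes>\<^bsub>R\<^esub> e = e \<and>
     (let eR = (\<lambda>r. e \<otimes>\<^bsub>R\<^esub> r) ` carrier R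
      in \<exists>M f. direct_summand R M eR \<and> M \<noteq> eR \<and> right_module_iso R eR M f)"

definition purely_infinite :: "('a, 'm) ring_scheme \<Rightarrow> bool" where
  "purely_infinite R \<longleftrightarrow>
     nonunital_ring R \<and>
     (\<forall>J. right_ideal J R \<and> J \<noteq> {\<zero>\<^bsub>R\<^esub>} \<longrightarrow> (\<exists>e \<in> J. infinite_idempotent R e))"


section \<open>Free algebras\<close>

text \<open>
  With concatenation as addition, \<^typ>\<open>'x list \<Rightarrow>\<^sub>0 'k\<close> under its convolution product is the
  free unital algebra on the type \<^typ>\<open>'x\<close>. The free algebra without unit on a set \<^term>\<open>X\<close>
  consists of the elements supported on nonempty words over \<^term>\<open>X\<close>.
\<close>

instantiation list :: (type) monoid_add
begin

definition zero_list :: "'a list" where "0 = []"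

definition plus_list :: "'a list \<Rightarrow> 'a list \<Rightarrow> 'a list" where "xs + ys = xs @ ys"

instance
  by standard (simp_all add: zero_list_def plus_list_def)

end

definition free_algebra :: "'x set \<Rightarrow> ('x list \<Rightarrow>\<^sub>0 'k::field) ring" where
  "free_algebra X =
     \<lparr>carrier = {p. \<forall>w \<in> Poly_Mapping.keys p. w \<noteq> [] \<and> set w \<subseteq> X},
      mult = (*), one = 1, zero = 0, add = (+)\<rparr>"

definition algebra_ideal :: "'x set \<Rightarrow> ('x list \<Rightarrow>\<^sub>0 'k::field) set \<Rightarrow> bool" where
  "algebra_ideal X I \<longleftrightarrow>
     two_sided_ideal I (free_algebra X) \<and>
     (\<forall>c. \<forall>p \<in> I. Poly_Mapping.map (\<lambda>a. c * a) p \<in> I)"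

definition gen_algebra_ideal ::
    "'x set \<Rightarrow> ('x list \<Rightarrow>\<^sub>0 'k::field) set \<Rightarrow> ('x list \<Rightarrow>\<^sub>0 'k) set" where
  "gen_algebra_ideal X S = \<Inter>{I. algebra_ideal X I \<and> S \<subseteq> I}"


section \<open>Leavitt path algebras\<close>

datatype ('v, 'e) lpa_symbol = Vertex 'v | Edge 'e | Ghost 'e

definition lpa_symbols :: "('v, 'e) pre_digraph \<Rightarrow> ('v, 'e) lpa_symbol set" where
  "lpa_symbols E = Vertex ` verts E \<union> Edge ` arcs E \<union> Ghost ` arcs E"

definition gen :: "'x \<Rightarrow> ('x list \<Rightarrow>\<^sub>0 'k::field)" where
  "gen x = Poly_Mapping.single [x] 1"

text \<open>A relation \<open>a = b\<close> is represented by the element \<open>a - b\<close> of the free algebra.\<close>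

inductive_set lpa_relations ::
    "('v, 'e) pre_digraph \<Rightarrow> (('v, 'e) lpa_symbol list \<Rightarrow>\<^sub>0 'k::field) set"
  for E :: "('v, 'e) pre_digraph" where
  vertex_vertex: "\<lbrakk>v \<in> verts E; w \<in> verts E\<rbrakk> \<Longrightarrow>
    gen (Vertex v) * gen (Vertex w) - (if v = w then gen (Vertex v) else 0) \<in> lpa_relations E"
| edge_range: "e \<in> arcs E \<Longrightarrow>
    gen (Edge e) * gen (Vertex (head E e)) - gen (Edge e) \<in> lpa_relations E"
| source_edge: "e \<in> arcs E \<Longrightarrow>
    gen (Vertex (tail E e)) * gen (Edge e) - gen (Edge e) \<in> lpa_relations E"
| ghost_source: "e \<in> arcs E \<Longrightarrow>
    gen (Ghost e) * gen (Vertex (tail E e)) - gen (Ghost e) \<in> lpa_relations E"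
| range_ghost: "e \<in> arcs E \<Longrightarrow>
    gen (Vertex (head E e)) * gen (Ghost e) - gen (Ghost e) \<in> lpa_relations E"
| CK1: "\<lbrakk>e \<in> arcs E; f \<in> arcs E\<rbrakk> \<Longrightarrow>
    gen (Ghost e) * gen (Edge f) - (if e = f then gen (Vertex (head E f)) else 0)
      \<in> lpa_relations E"
| CK2: "\<lbrakk>v \<in> verts E; out_arcs E v \<noteq> {}\<rbrakk> \<Longrightarrow>
    gen (Vertex v) - (\<Sum>e \<in> out_arcs E v. gen (Edge e) * gen (Ghost e)) \<in> lpa_relations E"

text \<open>The first argument only fixes the field of coefficients.\<close>

definition leavitt_path_algebra ::
    "'k::field itself \<Rightarrow> ('v, 'e) pre_digraph
      \<Rightarrow> (('v, 'e) lpa_symbol list \<Rightarrow>\<^sub>0 'k) set ring" where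
  "leavitt_path_algebra _ E =
     free_algebra (lpa_symbols E) Quot
       gen_algebra_ideal (lpa_symbols E) (lpa_relations E)"

end

(*
  Work with words in the generators modulo the defining relations; every word is congruent to 0 or to
  some alpha beta^*.

  If every cycle has an exit, then for each x outside the relation ideal there are a, b with a x b
  congruent to a vertex: right multiplication by edges removes ghost edges (CK2 keeps the product
  nonzero), left division by a shortest path leaves w + sum c_i gamma_i with gamma_i closed paths at
  w, and compression by a path delta that is not a prefix of any gamma_i delta kills the gamma_i. So
  a nonzero ideal contains a vertex, and the vertices in an ideal form a hereditary saturated set.
  If moreover w connects to a cycle c based at v, we may take the vertex to be v; it is infinite, as
  c^* c = v and c c^* <> v, and then so is an idempotent in x L(E).

  Conversely, L(E) and its quotients by hereditary saturated sets act on functions on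
  (vertices) x nat x int, where edges partition nat into residue classes and int records degrees.
  If L(E) is simple then the annihilators are trivial, which gives (i), and (ii) by comparing a
  degree-blind action with a degree-preserving one. If v connects to no cycle, finitely many
  elements of v L(E) v lie in a finite-dimensional algebra, so v L(E) contains no infinite idempotent.
*)

theory Submission
  imports Defs "HOL-Library.Sublist"
begin

text \<open>Normal words serve as a spanning set only. That the relations do not collapse the
  algebra is read off from the representations, where every vertex outside the removed set acts as a
  nonzero projection.

  Residue classes enter because CK2 asks the space at \<open>v\<close> to be the direct sum of the
  spaces at the ranges of its \<open>n\<close> edges. With \<open>nat\<close> at every vertex,
  writing \<open>k = n * q + i\<close> identifies \<open>nat\<close> with \<open>n\<close> copies of
  itself, so one construction serves every row-finite graph, with or without sinks.

  The missing unit is replaced by corners: an idempotent \<open>e\<close> is infinite exactly when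
  \<open>e R e\<close> contains \<open>x\<close>, \<open>y\<close> with \<open>y x = e\<close> and
  \<open>x y\<close> different from \<open>e\<close>. In this form the notion moves from one corner
  to another and can be tested on representatives in the free algebra.

  The corner at a vertex that connects to no cycle may still be infinite-dimensional, as infinitely
  many vertices may be reachable. The argument there therefore uses only the powers of one element,
  and these involve finitely many edges.\<close>

section \<open>Infinite idempotents in rings without unit\<close>

context nonunital_ring
begin

lemma l_null [simp]: "x \<in> carrier R \<Longrightarrow> \<zero> \<otimes> x = \<zero>"
  using l_distr[of \<zero> \<zero> x] m_closed[of \<zero> x] add.r_cancel_one'[of "\<zero> \<otimes> x" "\<zero> \<otimes> x"] by simp

lemma r_null [simp]: "x \<in> carrier R \<Longrightarrow> x \<otimes> \<zero> = \<zero>"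
  using r_distr[of \<zero> \<zero> x] m_closed[of x \<zero>] add.r_cancel_one'[of "x \<otimes> \<zero>" "x \<otimes> \<zero>"] by simp

lemma r_minus: "\<lbrakk>x \<in> carrier R; y \<in> carrier R\<rbrakk> \<Longrightarrow> x \<otimes> (\<ominus> y) = \<ominus> (x \<otimes> y)"
  by (rule minus_equality[symmetric]) (simp_all add: r_distr[symmetric] m_closed l_neg)

lemma right_ideal_carrier: "right_ideal J R \<Longrightarrow> x \<in> J \<Longrightarrow> x \<in> carrier R"
  using additive_subgroup.a_Hcarr right_ideal_def by metis

lemma right_ideal_zero: "right_ideal J R \<Longrightarrow> \<zero> \<in> J"
  using additive_subgroup.zero_closed right_ideal_def by metis

lemma right_ideal_m_closed: "right_ideal J R \<Longrightarrow> x \<in> J \<Longrightarrow> r \<in> carrier R \<Longrightarrow> x \<otimes> r \<in> J"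
  by (simp add: right_ideal_def)

lemma additive_subgroupI:
  assumes "J \<subseteq> carrier R" "\<zero> \<in> J"
    and "\<And>x y. x \<in> J \<Longrightarrow> y \<in> J \<Longrightarrow> x \<oplus> y \<in> J"
    and "\<And>x. x \<in> J \<Longrightarrow> \<ominus> x \<in> J"
  shows "additive_subgroup J R"
  using assms by (intro additive_subgroup.intro subgroup.intro) (auto simp: a_inv_def[symmetric])

lemma additive_subgroup_a_inv_closed: "additive_subgroup J R \<Longrightarrow> x \<in> J \<Longrightarrow> \<ominus> x \<in> J"
  by (metis additive_subgroup.a_subgroup subgroup.m_inv_closed a_inv_def)

lemma principal_right_ideal:
  assumes g: "g \<in> carrier R"
  shows "right_ideal ((\<lambda>r. g \<otimes> r) ` carrier R) R"
  unfolding right_ideal_def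
proof (intro conjI ballI additive_subgroupI)
  show "(\<lambda>r. g \<otimes> r) ` carrier R \<subseteq> carrier R"
    using g by (auto simp: m_closed)
  show "\<zero> \<in> (\<lambda>r. g \<otimes> r) ` carrier R"
    using g by (intro image_eqI[where x = \<zero>]) auto
next
  fix x y
  assume "x \<in> (\<lambda>r. g \<otimes> r) ` carrier R" "y \<in> (\<lambda>r. g \<otimes> r) ` carrier R"
  then obtain a b where "a \<in> carrier R" "b \<in> carrier R" "x = g \<otimes> a" "y = g \<otimes> b" by auto
  then show "x \<oplus> y \<in> (\<lambda>r. g \<otimes> r) ` carrier R"
    using g by (intro image_eqI[where x = "a \<oplus> b"]) (auto simp: r_distr)
next
  fix x
  assume "x \<in> (\<lambda>r. g \<otimes> r) ` carrier R"
  then obtain a where "a \<in> carrier R" "x = g \<otimes> a" by auto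
  then show "\<ominus> x \<in> (\<lambda>r. g \<otimes> r) ` carrier R"
    using g by (intro image_eqI[where x = "\<ominus> a"]) (auto simp: r_minus)
next
  fix x r
  assume "x \<in> (\<lambda>r. g \<otimes> r) ` carrier R" and r: "r \<in> carrier R"
  then obtain a where "a \<in> carrier R" "x = g \<otimes> a" by auto
  then show "x \<otimes> r \<in> (\<lambda>r. g \<otimes> r) ` carrier R"
    using g r by (intro image_eqI[where x = "a \<otimes> r"]) (auto simp: m_assoc m_closed)
qed

text \<open>Left multiplication by \<open>x\<close> maps \<open>eR\<close> isomorphically onto
  \<open>(x y) R\<close>, with left multiplication by \<open>y\<close> as inverse. Since
  \<open>x y\<close> is an idempotent of the corner of \<open>e\<close>, the element
  \<open>e - x y\<close> generates a complement.\<close>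

lemma infinite_idempotentI:
  assumes e: "e \<in> carrier R" "e \<otimes> e = e"
    and x: "x \<in> carrier R" "e \<otimes> x = x" "x \<otimes> e = x"
    and y: "y \<in> carrier R" "e \<otimes> y = y" "y \<otimes> e = y"
    and yx: "y \<otimes> x = e" and xy: "x \<otimes> y \<noteq> e"
  shows "infinite_idempotent R e"
proof -
  define g where "g = x \<otimes> y"
  define h where "h = e \<oplus> \<ominus> g"
  define eR where "eR = (\<lambda>r. e \<otimes> r) ` carrier R"
  define M where "M = (\<lambda>r. g \<otimes> r) ` carrier R"
  define N where "N = (\<lambda>r. h \<otimes> r) ` carrier R"
  have g: "g \<in> carrier R" using x y by (simp add: g_def m_closed)
  have h: "h \<in> carrier R" using e g by (simp add: h_def)
  have ge: "g \<otimes> e = g" using x y e by (simp add: g_def m_assoc)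
  have eg: "e \<otimes> g = g" using x y e by (simp add: g_def m_assoc[symmetric])
  have gg: "g \<otimes> g = g"
  proof -
    have "g \<otimes> g = x \<otimes> ((y \<otimes> x) \<otimes> y)" using x y by (simp add: g_def m_assoc m_closed)
    then show ?thesis using yx y by (simp add: g_def)
  qed
  have gh: "g \<otimes> h = \<zero>" using e g ge gg by (simp add: h_def r_distr r_minus r_neg)
  have eh: "e \<otimes> h = h" using e g eg by (simp add: h_def r_distr r_minus)
  have M: "right_ideal M R" and N: "right_ideal N R"
    using principal_right_ideal g h by (simp_all add: M_def N_def)
  have "M \<inter> N \<subseteq> {\<zero>}"
  proof
    fix z assume "z \<in> M \<inter> N"
    then obtain a b where ab: "a \<in> carrier R" "b \<in> carrier R" "z = g \<otimes> a" "z = h \<otimes> b"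
      by (auto simp: M_def N_def)
    have "g \<otimes> z = z" using ab g gg by (simp add: m_assoc[symmetric])
    moreover have "g \<otimes> z = \<zero>" using ab(2,4) g h gh by (simp add: m_assoc[symmetric])
    ultimately show "z \<in> {\<zero>}" by simp
  qed
  then have MN: "M \<inter> N = {\<zero>}" using right_ideal_zero M N by auto
  have "M <+>\<^bsub>R\<^esub> N = eR"
  proof
    show "M <+>\<^bsub>R\<^esub> N \<subseteq> eR"
    proof
      fix z assume "z \<in> M <+>\<^bsub>R\<^esub> N"
      then obtain a b where ab: "a \<in> carrier R" "b \<in> carrier R" "z = g \<otimes> a \<oplus> h \<otimes> b"
        by (auto simp: M_def N_def set_add_def')
      then have "e \<otimes> z = z"
        using e g h eg eh by (simp add: r_distr m_closed m_assoc[symmetric])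
      moreover have "z \<in> carrier R" using ab g h by (simp add: m_closed)
      ultimately show "z \<in> eR" unfolding eR_def by (metis image_eqI)
    qed
    show "eR \<subseteq> M <+>\<^bsub>R\<^esub> N"
    proof
      fix z assume "z \<in> eR"
      then obtain r where r: "r \<in> carrier R" "z = e \<otimes> r" by (auto simp: eR_def)
      have "e = g \<oplus> h" using e g by (simp add: h_def a_lcomm r_neg)
      then have "z = g \<otimes> r \<oplus> h \<otimes> r" using r g h by (simp add: l_distr)
      then show "z \<in> M <+>\<^bsub>R\<^esub> N"
        using r by (auto simp: set_add_def' M_def N_def)
    qed
  qed
  then have sum: "direct_summand R M eR"
    unfolding direct_summand_def using M N MN by blast
  have "e \<in> eR" using e by (auto simp: eR_def intro: image_eqI[where x = e])
  moreover have "e \<notin> M"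
  proof
    assume "e \<in> M"
    then obtain r where r: "r \<in> carrier R" "e = g \<otimes> r" by (auto simp: M_def)
    then have "g \<otimes> e = e" using g gg by (simp add: m_assoc[symmetric])
    then show False using ge xy by (simp add: g_def)
  qed
  ultimately have ne: "M \<noteq> eR" by blast
  have eRD: "z \<in> carrier R \<and> e \<otimes> z = z" if "z \<in> eR" for z
    using that e by (auto simp: eR_def m_closed m_assoc[symmetric])
  have "bij_betw (\<lambda>r. x \<otimes> r) eR M"
  proof (rule bij_betw_imageI)
    show "inj_on (\<lambda>r. x \<otimes> r) eR"
    proof
      fix a b assume ab: "a \<in> eR" "b \<in> eR" "x \<otimes> a = x \<otimes> b"
      then have "y \<otimes> x \<otimes> a = y \<otimes> x \<otimes> b" using eRD x y by (simp add: m_assoc)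
      then show "a = b" using eRD ab yx by simp
    qed
    show "(\<lambda>r. x \<otimes> r) ` eR = M"
    proof
      show "(\<lambda>r. x \<otimes> r) ` eR \<subseteq> M"
      proof
        fix z assume "z \<in> (\<lambda>r. x \<otimes> r) ` eR"
        then obtain a where a: "a \<in> eR" "z = x \<otimes> a" by auto
        then have "z = x \<otimes> (y \<otimes> x \<otimes> a)" using eRD yx by simp
        then have "z = g \<otimes> (x \<otimes> a)" using eRD[OF a(1)] x y by (simp add: g_def m_assoc m_closed)
        then show "z \<in> M" using eRD[OF a(1)] x by (auto simp: M_def m_closed)
      qed
      show "M \<subseteq> (\<lambda>r. x \<otimes> r) ` eR"
      proof
        fix z assume "z \<in> M"
        then obtain r where r: "r \<in> carrier R" "z = g \<otimes> r" by (auto simp: M_def)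
        then have "z = x \<otimes> (e \<otimes> (y \<otimes> r))" using x y e
          by (simp add: g_def m_assoc m_closed) (metis m_assoc y)
        then show "z \<in> (\<lambda>r. x \<otimes> r) ` eR" using r y by (auto simp: eR_def m_closed)
      qed
    qed
  qed
  then have "right_module_iso R eR M (\<lambda>r. x \<otimes> r)"
    unfolding right_module_iso_def using eRD x by (auto simp: r_distr m_assoc)
  then show ?thesis
    unfolding infinite_idempotent_def Let_def eR_def[symmetric] using e sum ne by blast
qed

text \<open>Since \<open>e\<close> lies in \<open>eR\<close>, the isomorphism \<open>f\<close> is
  left multiplication by \<open>x = f e\<close>. Splitting \<open>e = m + n\<close> along the direct
  sum gives an idempotent \<open>m\<close> that generates the summand \<open>M\<close>, and
  \<open>y\<close> is the preimage of \<open>m\<close> under \<open>f\<close>.\<close>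

lemma infinite_idempotentE:
  assumes "infinite_idempotent R e"
  obtains x y where "e \<in> carrier R" "e \<otimes> e = e"
    "x \<in> carrier R" "e \<otimes> x = x" "x \<otimes> e = x"
    "y \<in> carrier R" "e \<otimes> y = y" "y \<otimes> e = y" "y \<otimes> x = e" "x \<otimes> y \<noteq> e"
proof -
  define eR where "eR = (\<lambda>r. e \<otimes> r) ` carrier R"
  obtain M f where e: "e \<in> carrier R" "e \<otimes> e = e" and sum: "direct_summand R M eR"
    and ne: "M \<noteq> eR" and f: "right_module_iso R eR M f"
    using assms unfolding infinite_idempotent_def Let_def eR_def by blast
  obtain N where M: "right_ideal M R" and N: "right_ideal N R" and MN: "M \<inter> N = {\<zero>}"
    and eR: "M <+>\<^bsub>R\<^esub> N = eR"
    using sum unfolding direct_summand_def by blast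
  have eRD: "z \<in> carrier R \<and> e \<otimes> z = z" if "z \<in> eR" for z
    using that e by (auto simp: eR_def m_closed m_assoc[symmetric])
  have eRI: "z \<in> eR" if "z \<in> carrier R" "e \<otimes> z = z" for z
    using that unfolding eR_def by (metis image_eqI)
  have eeR: "e \<in> eR" using e by (simp add: eRI)
  have car: "z \<in> carrier R" if "z \<in> M \<or> z \<in> N" for z
    using that M N right_ideal_carrier by blast
  obtain m n where mn: "m \<in> M" "n \<in> N" "e = m \<oplus> n"
    using eeR unfolding eR[symmetric] set_add_def' by auto
  have MeR: "M \<subseteq> eR"
  proof
    fix z assume z: "z \<in> M"
    then have "z = z \<oplus> \<zero>" using car by simp
    then show "z \<in> eR" unfolding eR[symmetric] set_add_def' using z right_ideal_zero[OF N] by auto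
  qed
  have uniq: "b = \<zero>" if "a \<in> M" "c \<in> M" "b \<in> N" "c = a \<oplus> b" for a b c
  proof -
    have "b = \<ominus> a \<oplus> c" using that car by (simp add: r_neg1)
    moreover have "\<ominus> a \<oplus> c \<in> M"
      using that M by (simp add: right_ideal_def additive_subgroup.a_closed
          additive_subgroup_a_inv_closed)
    ultimately show ?thesis using that MN by auto
  qed
  \<comment> \<open>Here \<open>z = e z = m z + n z\<close>, and directness of the sum forces
    \<open>n z\<close> to vanish.\<close>
  have mz: "m \<otimes> z = z" if z: "z \<in> M" for z
  proof -
    have zc: "z \<in> carrier R" "e \<otimes> z = z" using z MeR eRD by auto
    have eq: "z = m \<otimes> z \<oplus> n \<otimes> z"
      using l_distr[of m n z] zc mn car by simp
    have "n \<otimes> z = \<zero>"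
      using uniq[of "m \<otimes> z" z "n \<otimes> z"] eq z zc mn M N right_ideal_m_closed by blast
    then show ?thesis using eq zc mn car by (simp add: m_closed)
  qed
  have fM: "f z \<in> M" if "z \<in> eR" for z
    using f that unfolding right_module_iso_def bij_betw_def by auto
  have fmul: "f (z \<otimes> r) = f z \<otimes> r" if "z \<in> eR" "r \<in> carrier R" for z r
    using f that unfolding right_module_iso_def by auto
  have finj: "a = b" if "a \<in> eR" "b \<in> eR" "f a = f b" for a b
    using f that unfolding right_module_iso_def bij_betw_def inj_on_def by auto
  have eRm: "z \<otimes> r \<in> eR" if "z \<in> eR" "r \<in> carrier R" for z r
    using eRD[OF that(1)] that e by (intro eRI) (auto simp: m_closed m_assoc[symmetric])
  define x where "x = f e"
  have xM: "x \<in> M" using fM eeR by (simp add: x_def)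
  have x: "x \<in> carrier R" "e \<otimes> x = x" using xM MeR eRD by auto
  have xe: "x \<otimes> e = x" using fmul[OF eeR e(1)] e by (simp add: x_def)
  have fx: "f z = x \<otimes> z" if "z \<in> eR" for z
    using fmul[OF eeR, of z] eRD[OF that] by (simp add: x_def)
  \<comment> \<open>Expand \<open>m e = m m + m n\<close>. The product \<open>m n\<close> lies in
    \<open>M\<close> and equals \<open>n - n n\<close>, which lies in \<open>N\<close>, so it is
    zero.\<close>
  have me: "m \<otimes> e = m"
  proof -
    have "m \<otimes> e \<oplus> n \<otimes> e = m \<oplus> n"
      using l_distr[of m n e] e mn car by simp
    moreover have "m \<otimes> e = m"
    proof -
      have "m \<otimes> m = m" using mz mn by simp
      moreover have "m \<otimes> n = \<zero>"
      proof -
        have nc: "n \<in> carrier R" "m \<in> carrier R" using mn car by auto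
        have "n \<in> eR"
        proof -
          have "n = \<zero> \<oplus> n" using nc by simp
          then show ?thesis unfolding eR[symmetric] set_add_def'
            using mn(2) right_ideal_zero[OF M] by auto
        qed
        then have "n = m \<otimes> n \<oplus> n \<otimes> n" using l_distr[of m n n] eRD mn(3) nc by simp
        then have "n \<oplus> \<ominus> (n \<otimes> n) = m \<otimes> n \<oplus> n \<otimes> n \<oplus> \<ominus> (n \<otimes> n)" by simp
        then have eq: "m \<otimes> n = n \<oplus> \<ominus> (n \<otimes> n)"
          using nc by (simp add: a_assoc m_closed r_neg)
        have "n \<oplus> \<ominus> (n \<otimes> n) \<in> N"
          using nc N mn(2) by (simp add: right_ideal_def additive_subgroup.a_closed
              additive_subgroup_a_inv_closed)
        moreover have "m \<otimes> n \<in> M" using right_ideal_m_closed M mn nc by blast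
        ultimately show ?thesis using eq MN by auto
      qed
      ultimately show ?thesis using mn car by (simp add: r_distr)
    qed
    ultimately show ?thesis by simp
  qed
  obtain y where y: "y \<in> eR" "f y = m"
    using mn f unfolding right_module_iso_def bij_betw_def by auto
  have ye: "y \<otimes> e = y"
    using finj[of "y \<otimes> e" y] eRm y e fmul me by simp
  have xy: "x \<otimes> y = m" using fx y by simp
  have "f (y \<otimes> x) = f e"
  proof -
    have "f (y \<otimes> x) = m \<otimes> x" using fmul y x by simp
    then show ?thesis using mz xM by (simp add: x_def)
  qed
  then have yx: "y \<otimes> x = e" using finj eRm y x eeR by blast
  have "m \<noteq> e"
  proof
    assume "m = e"
    then have "eR \<subseteq> M" using mn M right_ideal_m_closed unfolding eR_def by blast
    then show False using MeR ne by blast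
  qed
  then show ?thesis using that[of x y] e x xe eRD[OF y(1)] ye yx xy by simp
qed

text \<open>
  Here \<open>v\<close> is an infinite idempotent, and \<open>x z\<close> inherits this because \<open>x z R\<close> and \<open>v R\<close> are
  isomorphic.
\<close>

lemma infinite_idempotent_multiple:
  assumes x: "x \<in> carrier R" and a: "a \<in> carrier R" and b: "b \<in> carrier R"
    and v: "v \<in> carrier R" "v \<otimes> v = v" and axb: "a \<otimes> x \<otimes> b = v"
    and c: "c \<in> carrier R" "v \<otimes> c = c" "c \<otimes> v = c"
    and d: "d \<in> carrier R" "v \<otimes> d = d" "d \<otimes> v = d"
    and dc: "d \<otimes> c = v" and cd: "c \<otimes> d \<noteq> v"
  shows "\<exists>z \<in> carrier R. infinite_idempotent R (x \<otimes> z)"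
proof -
  \<comment> \<open>As \<open>w u = v\<close>, the map sending \<open>t\<close> to
    \<open>u t w\<close> is multiplicative on the corner \<open>v R v\<close>. It takes
    \<open>v\<close> to an idempotent in \<open>x R\<close>, and \<open>c\<close>, \<open>d\<close>
    to the pair showing that this idempotent is infinite.\<close>
  define u where "u = x \<otimes> b \<otimes> v"
  define w where "w = v \<otimes> a"
  have u: "u \<in> carrier R" and w: "w \<in> carrier R" using x a b v by (simp_all add: u_def w_def m_closed)
  have wu: "w \<otimes> u = v"
  proof -
    have "w \<otimes> u = v \<otimes> (a \<otimes> x \<otimes> b) \<otimes> v" using x a b v by (simp add: u_def w_def m_closed m_assoc)
    then show ?thesis using axb v by simp
  qed
  have uv: "u \<otimes> v = u" using x b v by (simp add: u_def m_closed m_assoc)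
  have vw: "v \<otimes> w = w" using a v by (simp add: w_def m_assoc[symmetric])
  have wut: "w \<otimes> (u \<otimes> t) = v \<otimes> t" if "t \<in> carrier R" for t
    using that u w wu by (metis m_assoc)
  have dct: "d \<otimes> (c \<otimes> t) = v \<otimes> t" if "t \<in> carrier R" for t
    using that c d dc by (metis m_assoc)
  have vct: "v \<otimes> (c \<otimes> t) = c \<otimes> t" if "t \<in> carrier R" for t
    using that c v by (metis m_assoc)
  have vdt: "v \<otimes> (d \<otimes> t) = d \<otimes> t" if "t \<in> carrier R" for t
    using that d v by (metis m_assoc)
  have uvt: "u \<otimes> (v \<otimes> t) = u \<otimes> t" if "t \<in> carrier R" for t
    using that u v uv by (metis m_assoc)
  note eqs = wut dct vct vdt uvt vw uv
  have "infinite_idempotent R (u \<otimes> w)"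
  proof (rule infinite_idempotentI[where x = "u \<otimes> (c \<otimes> w)" and y = "u \<otimes> (d \<otimes> w)"])
    show "u \<otimes> (c \<otimes> w) \<otimes> (u \<otimes> (d \<otimes> w)) \<noteq> u \<otimes> w"
    proof
      assume "u \<otimes> (c \<otimes> w) \<otimes> (u \<otimes> (d \<otimes> w)) = u \<otimes> w"
      then have "w \<otimes> (u \<otimes> (c \<otimes> (d \<otimes> w))) \<otimes> u = w \<otimes> (u \<otimes> w) \<otimes> u"
        using u w c d v by (simp add: m_assoc m_closed eqs)
      then have "c \<otimes> d = v"
        using u w c d v by (simp add: m_assoc m_closed eqs wu)
      then show False using cd by contradiction
    qed
  qed (use u w c d v in \<open>simp_all add: m_assoc m_closed eqs\<close>)
  moreover have "u \<otimes> w = x \<otimes> (b \<otimes> v \<otimes> w)" using x a b v w by (simp add: u_def m_assoc m_closed)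
  moreover have "b \<otimes> v \<otimes> w \<in> carrier R" using b v w by (simp add: m_closed)
  ultimately show ?thesis by auto
qed

text \<open>The idempotent \<open>e\<close> lies in \<open>v R\<close> but \<open>e v = e\<close>
  may fail. Right multiplication of \<open>e\<close>, \<open>x\<close> and \<open>y\<close> by
  \<open>v\<close> moves all three into \<open>v R v\<close>, and \<open>v e = e\<close> keeps their
  relations intact.\<close>

lemma infinite_idempotent_corner:
  assumes "infinite_idempotent R e" and v: "v \<in> carrier R" "v \<otimes> v = v" and ve: "v \<otimes> e = e"
  obtains e' x y where "e' \<in> carrier R" "x \<in> carrier R" "y \<in> carrier R"
    "v \<otimes> e' = e'" "e' \<otimes> v = e'" "y \<otimes> v = y" "e' \<otimes> e' = e'" "e' \<otimes> x = x"
    "y \<otimes> e' = y" "y \<otimes> x = e'" "x \<otimes> y \<noteq> e'"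
proof -
  obtain x y where e: "e \<in> carrier R" "e \<otimes> e = e"
    and x: "x \<in> carrier R" "e \<otimes> x = x" "x \<otimes> e = x"
    and y: "y \<in> carrier R" "e \<otimes> y = y" "y \<otimes> e = y" and yx: "y \<otimes> x = e" and xy: "x \<otimes> y \<noteq> e"
    using infinite_idempotentE[OF assms(1)] by blast
  have vx: "v \<otimes> x = x" using v e x ve by (metis m_assoc)
  have vy: "v \<otimes> y = y" using v e y ve by (metis m_assoc)
  have vet: "v \<otimes> (e \<otimes> t) = e \<otimes> t" if "t \<in> carrier R" for t using that v e ve by (metis m_assoc)
  have vxt: "v \<otimes> (x \<otimes> t) = x \<otimes> t" if "t \<in> carrier R" for t using that v x vx by (metis m_assoc)
  have vyt: "v \<otimes> (y \<otimes> t) = y \<otimes> t" if "t \<in> carrier R" for t using that v y vy by (metis m_assoc)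
  have eet: "e \<otimes> (e \<otimes> t) = e \<otimes> t" if "t \<in> carrier R" for t using that e by (metis m_assoc)
  have ext: "e \<otimes> (x \<otimes> t) = x \<otimes> t" if "t \<in> carrier R" for t using that e x by (metis m_assoc)
  have yet: "y \<otimes> (e \<otimes> t) = y \<otimes> t" if "t \<in> carrier R" for t using that e y by (metis m_assoc)
  have yxt: "y \<otimes> (x \<otimes> t) = e \<otimes> t" if "t \<in> carrier R" for t using that x y yx by (metis m_assoc)
  have ne: "(x \<otimes> v) \<otimes> (y \<otimes> v) \<noteq> e \<otimes> v"
  proof
    assume "(x \<otimes> v) \<otimes> (y \<otimes> v) = e \<otimes> v"
    then have "x \<otimes> (y \<otimes> v) = e \<otimes> v" using x y v by (simp add: m_assoc m_closed vyt)
    \<comment> \<open>Multiplying by \<open>e\<close> on the right undoes the truncation by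
      \<open>v\<close>.\<close>
    then have "x \<otimes> (y \<otimes> v) \<otimes> e = e \<otimes> v \<otimes> e" by simp
    then show False using x y v e xy by (simp add: m_assoc m_closed ve)
  qed
  show thesis
    by (rule that[OF _ _ _ _ _ _ _ _ _ _ ne])
      (use x y v e in \<open>simp_all add: m_assoc m_closed vet vxt vyt eet ext yet yxt\<close>)
qed

end

section \<open>Quotients of free algebras\<close>

abbreviation word :: "'x list \<Rightarrow> ('x list \<Rightarrow>\<^sub>0 'k::field)" where
  "word w \<equiv> Poly_Mapping.single w 1"

text \<open>Scalars are multiples of the empty word. A nonzero scalar lies in the ambient unital
  algebra but outside \<open>free_algebra X\<close>; this makes scaling an ordinary product.\<close>

abbreviation scalar :: "'k \<Rightarrow> ('x list \<Rightarrow>\<^sub>0 'k::field)" where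
  "scalar c \<equiv> Poly_Mapping.single [] c"

lemma word_mult: "word u * word w = (word (u @ w) :: 'x list \<Rightarrow>\<^sub>0 'k::field)"
  by (simp add: mult_single plus_list_def)

lemma single_conv: "Poly_Mapping.single w c = scalar c * (word w :: 'x list \<Rightarrow>\<^sub>0 'k::field)"
  by (simp add: mult_single plus_list_def)

lemma word_Nil [simp]: "word [] = (1 :: 'x list \<Rightarrow>\<^sub>0 'k::field)"
  using single_one by (metis zero_list_def)

lemma map_scale: "Poly_Mapping.map (\<lambda>a. c * a) p = scalar c * (p :: 'x list \<Rightarrow>\<^sub>0 'k::field)"
  using mult_map_scale_conv_mult[of c p] by (simp add: zero_list_def)

lemma poly_mapping_expand:
  "p = (\<Sum>w \<in> Poly_Mapping.keys p. scalar (Poly_Mapping.lookup p w) * (word w :: 'x list \<Rightarrow>\<^sub>0 'k::field))"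
  unfolding single_conv[symmetric]
  by (rule poly_mapping_eqI)
    (auto simp: lookup_sum lookup_single when_def sum.delta' in_keys_iff)

lemma scalar_commute: "scalar c * p = p * scalar c" for p :: "'x list \<Rightarrow>\<^sub>0 'k::field"
proof -
  have eq: "scalar c * (scalar d * word w) = scalar d * word w * scalar c" for w :: "'x list" and d
    by (simp add: mult_single plus_list_def mult.commute)
  have "scalar c * (\<Sum>w \<in> Poly_Mapping.keys p. scalar (Poly_Mapping.lookup p w) * word w) =
        (\<Sum>w \<in> Poly_Mapping.keys p. scalar (Poly_Mapping.lookup p w) * word w) * scalar c"
    by (simp only: sum_distrib_left sum_distrib_right eq)
  then show ?thesis by (simp only: poly_mapping_expand[of p, symmetric])
qed

lemma scalar_left_commute: "p * (scalar c * q) = scalar c * (p * q)"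
  for p q :: "'x list \<Rightarrow>\<^sub>0 'k::field"
  by (simp only: mult.assoc[symmetric] scalar_commute[of c p])

text \<open>The linearity arguments below pass through this expansion: a property of
  \<open>a * q * b\<close> that survives scalars and sums need only be checked when \<open>q\<close>
  is a word. One-sided products are the cases in which \<open>a\<close> or \<open>b\<close> is
  1.\<close>

lemma expand_between:
  "a * q * b = (\<Sum>w \<in> Poly_Mapping.keys q. scalar (Poly_Mapping.lookup q w) * (a * word w * b))"
  for q :: "'x list \<Rightarrow>\<^sub>0 'k::field"
proof -
  have eq: "a * (scalar c * word w) * b = scalar c * (a * word w * b)" for c w
    by (simp only: scalar_left_commute mult.assoc)
  have "a * q * b = a * (\<Sum>w \<in> Poly_Mapping.keys q. scalar (Poly_Mapping.lookup q w) * word w) * b"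
    by (simp only: poly_mapping_expand[of q, symmetric])
  also have "\<dots> = (\<Sum>w \<in> Poly_Mapping.keys q. scalar (Poly_Mapping.lookup q w) * (a * word w * b))"
    by (simp only: sum_distrib_left sum_distrib_right eq)
  finally show ?thesis .
qed

lemma scalar_mult: "scalar c * (scalar d * p) = scalar (c * d) * (p :: 'x list \<Rightarrow>\<^sub>0 'k::field)"
  by (simp add: mult.assoc[symmetric] mult_single plus_list_def)

lemma lookup_scalar_mult:
  "Poly_Mapping.lookup (scalar c * p) w = c * Poly_Mapping.lookup (p :: 'x list \<Rightarrow>\<^sub>0 'k::field) w"
  by (simp add: map_scale[symmetric] map.rep_eq when_def)

lemma keys_scalar_mult:
  "Poly_Mapping.keys (scalar c * p) \<subseteq> Poly_Mapping.keys (p :: 'x list \<Rightarrow>\<^sub>0 'k::field)"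
  by (auto simp: in_keys_iff lookup_scalar_mult)

definition nonempty_words :: "'x set \<Rightarrow> 'x list set" where
  "nonempty_words X = {w. w \<noteq> [] \<and> set w \<subseteq> X}"

lemma free_algebra_carrier:
  "p \<in> carrier (free_algebra X) \<longleftrightarrow> Poly_Mapping.keys p \<subseteq> nonempty_words X"
  by (auto simp: free_algebra_def nonempty_words_def)

lemma free_algebra_ops [simp]:
  "p \<otimes>\<^bsub>free_algebra X\<^esub> q = p * q" "p \<oplus>\<^bsub>free_algebra X\<^esub> q = p + q" "\<zero>\<^bsub>free_algebra X\<^esub> = 0"
  by (simp_all add: free_algebra_def)

lemma free_algebra_closed [intro, simp]:
  fixes p q :: "'x list \<Rightarrow>\<^sub>0 'k::field"
  shows "0 \<in> carrier (free_algebra X :: ('x list \<Rightarrow>\<^sub>0 'k) ring)"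
    and "p \<in> carrier (free_algebra X) \<Longrightarrow> q \<in> carrier (free_algebra X) \<Longrightarrow>
      p + q \<in> carrier (free_algebra X)"
    and "p \<in> carrier (free_algebra X) \<Longrightarrow> - p \<in> carrier (free_algebra X)"
    and "p \<in> carrier (free_algebra X) \<Longrightarrow> q \<in> carrier (free_algebra X) \<Longrightarrow>
      p - q \<in> carrier (free_algebra X)"
    and "p \<in> carrier (free_algebra X) \<Longrightarrow> q \<in> carrier (free_algebra X) \<Longrightarrow>
      p * q \<in> carrier (free_algebra X)"
    and "p \<in> carrier (free_algebra X) \<Longrightarrow> scalar c * p \<in> carrier (free_algebra X)"
proof -
  show "0 \<in> carrier (free_algebra X :: ('x list \<Rightarrow>\<^sub>0 'k) ring)"
    by (simp add: free_algebra_carrier)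
  show "- p \<in> carrier (free_algebra X)" if "p \<in> carrier (free_algebra X)"
    using that by (auto simp: free_algebra_carrier in_keys_iff)
  show "p + q \<in> carrier (free_algebra X)" "p - q \<in> carrier (free_algebra X)"
    if "p \<in> carrier (free_algebra X)" "q \<in> carrier (free_algebra X)"
    using that Poly_Mapping.keys_add[of p q] keys_diff[of p q] by (auto simp: free_algebra_carrier)
  show "scalar c * p \<in> carrier (free_algebra X)" if "p \<in> carrier (free_algebra X)"
    using that keys_scalar_mult[of c p] by (auto simp: free_algebra_carrier)
  show "p * q \<in> carrier (free_algebra X)"
    if pq: "p \<in> carrier (free_algebra X)" "q \<in> carrier (free_algebra X)"
    unfolding free_algebra_carrier
  proof
    fix w assume "w \<in> Poly_Mapping.keys (p * q)"
    then obtain u v where "u \<in> Poly_Mapping.keys p" "v \<in> Poly_Mapping.keys q" "w = u @ v"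
      using keys_mult[of p q] by (auto simp: plus_list_def)
    then show "w \<in> nonempty_words X"
      using pq unfolding free_algebra_carrier nonempty_words_def by auto
  qed
qed

lemma free_algebra_sum [intro]:
  fixes f :: "'i \<Rightarrow> 'x list \<Rightarrow>\<^sub>0 'k::field"
  assumes "\<And>i. i \<in> A \<Longrightarrow> f i \<in> carrier (free_algebra X)"
  shows "(\<Sum>i \<in> A. f i) \<in> carrier (free_algebra X)"
  using assms by (induction A rule: infinite_finite_induct) auto

lemma word_in_free_algebra [simp]:
  "(word w :: 'x list \<Rightarrow>\<^sub>0 'k::field) \<in> carrier (free_algebra X) \<longleftrightarrow> w \<in> nonempty_words X"
  by (simp add: free_algebra_carrier)

lemma nonunital_ringI_ops:
  assumes "abelian_group R"
    and "\<And>x y. \<lbrakk>x \<in> carrier R; y \<in> carrier R\<rbrakk> \<Longrightarrow> x \<otimes>\<^bsub>R\<^esub> y \<in> carrier R"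
    and "\<And>x y z. \<lbrakk>x \<in> carrier R; y \<in> carrier R; z \<in> carrier R\<rbrakk>
          \<Longrightarrow> (x \<otimes>\<^bsub>R\<^esub> y) \<otimes>\<^bsub>R\<^esub> z = x \<otimes>\<^bsub>R\<^esub> (y \<otimes>\<^bsub>R\<^esub> z)"
    and "\<And>x y z. \<lbrakk>x \<in> carrier R; y \<in> carrier R; z \<in> carrier R\<rbrakk>
          \<Longrightarrow> (x \<oplus>\<^bsub>R\<^esub> y) \<otimes>\<^bsub>R\<^esub> z = x \<otimes>\<^bsub>R\<^esub> z \<oplus>\<^bsub>R\<^esub> y \<otimes>\<^bsub>R\<^esub> z"
    and "\<And>x y z. \<lbrakk>x \<in> carrier R; y \<in> carrier R; z \<in> carrier R\<rbrakk>
          \<Longrightarrow> z \<otimes>\<^bsub>R\<^esub> (x \<oplus>\<^bsub>R\<^esub> y) = z \<otimes>\<^bsub>R\<^esub> x \<oplus>\<^bsub>R\<^esub> z \<otimes>\<^bsub>R\<^esub> y"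
  shows "nonunital_ring R"
  using assms by (intro nonunital_ring.intro nonunital_ring_axioms.intro)

lemma free_algebra_nonunital_ring: "nonunital_ring (free_algebra X :: ('x list \<Rightarrow>\<^sub>0 'k::field) ring)"
proof (rule nonunital_ringI_ops)
  show "abelian_group (free_algebra X :: ('x list \<Rightarrow>\<^sub>0 'k::field) ring)"
  proof (rule abelian_groupI)
    fix p :: "'x list \<Rightarrow>\<^sub>0 'k"
    assume "p \<in> carrier (free_algebra X)"
    then show "\<exists>y \<in> carrier (free_algebra X). y \<oplus>\<^bsub>free_algebra X\<^esub> p = \<zero>\<^bsub>free_algebra X\<^esub>"
      by (intro bexI[of _ "- p"]) auto
  qed (auto simp: algebra_simps)
qed (auto simp: algebra_simps)

lemma free_algebra_a_inv:
  assumes "p \<in> carrier (free_algebra X :: ('x list \<Rightarrow>\<^sub>0 'k::field) ring)"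
  shows "\<ominus>\<^bsub>free_algebra X\<^esub> p = - p"
proof -
  interpret nonunital_ring "free_algebra X :: ('x list \<Rightarrow>\<^sub>0 'k) ring"
    by (rule free_algebra_nonunital_ring)
  show ?thesis using assms minus_equality[of "- p" p] by auto
qed

lemma two_sided_ideal_free_algebra:
  fixes J :: "('x list \<Rightarrow>\<^sub>0 'k::field) set"
  shows "two_sided_ideal J (free_algebra X) \<longleftrightarrow>
    J \<subseteq> carrier (free_algebra X) \<and> 0 \<in> J \<and>
    (\<forall>p \<in> J. \<forall>q \<in> J. p + q \<in> J) \<and> (\<forall>p \<in> J. - p \<in> J) \<and>
    (\<forall>p \<in> J. \<forall>q \<in> carrier (free_algebra X). q * p \<in> J \<and> p * q \<in> J)"
    (is "?L \<longleftrightarrow> ?R")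
proof -
  interpret nonunital_ring "free_algebra X :: ('x list \<Rightarrow>\<^sub>0 'k) ring"
    by (rule free_algebra_nonunital_ring)
  show ?thesis
  proof
    assume ?L
    then have sub: "additive_subgroup J (free_algebra X)"
      and mult: "\<forall>p \<in> J. \<forall>q \<in> carrier (free_algebra X). q * p \<in> J \<and> p * q \<in> J"
      by (simp_all add: two_sided_ideal_def)
    have car: "J \<subseteq> carrier (free_algebra X)" using additive_subgroup.a_subset[OF sub] .
    have "- p \<in> J" if "p \<in> J" for p
      using additive_subgroup_a_inv_closed[OF sub that] free_algebra_a_inv[of p X] car that by auto
    then show ?R
      using mult car additive_subgroup.zero_closed[OF sub] additive_subgroup.a_closed[OF sub] by auto
  next
    assume R: ?R
    then have "additive_subgroup J (free_algebra X)"
      by (intro additive_subgroupI) (auto simp: free_algebra_a_inv subsetD)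
    then show ?L using R by (simp add: two_sided_ideal_def)
  qed
qed

section \<open>Congruences modulo an algebra ideal and the quotient ring\<close>

locale presented_algebra =
  fixes X :: "'x set" and I :: "('x list \<Rightarrow>\<^sub>0 'k::field) set"
  assumes algebra_ideal: "algebra_ideal X I"
begin

abbreviation C :: "('x list \<Rightarrow>\<^sub>0 'k) set" where
  "C \<equiv> carrier (free_algebra X)"

abbreviation L :: "('x list \<Rightarrow>\<^sub>0 'k) set ring" where
  "L \<equiv> free_algebra X Quot I"

lemma I_facts:
  shows I_C: "p \<in> I \<Longrightarrow> p \<in> C"
    and I_zero [simp]: "0 \<in> I"
    and I_add: "p \<in> I \<Longrightarrow> q \<in> I \<Longrightarrow> p + q \<in> I"
    and I_minus: "p \<in> I \<Longrightarrow> - p \<in> I"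
    and I_lmult: "p \<in> I \<Longrightarrow> q \<in> C \<Longrightarrow> q * p \<in> I"
    and I_rmult: "p \<in> I \<Longrightarrow> q \<in> C \<Longrightarrow> p * q \<in> I"
    and I_scalar: "p \<in> I \<Longrightarrow> scalar c * p \<in> I"
  using algebra_ideal unfolding algebra_ideal_def two_sided_ideal_free_algebra map_scale
  by blast+

lemma I_diff: "p \<in> I \<Longrightarrow> q \<in> I \<Longrightarrow> p - q \<in> I"
  using I_add[of p "- q"] I_minus by simp

lemma I_sum: "(\<And>i. i \<in> A \<Longrightarrow> f i \<in> I) \<Longrightarrow> (\<Sum>i \<in> A. f i) \<in> I"
  by (induction A rule: infinite_finite_induct) (auto intro: I_add)

text \<open>Both sides are required to lie in \<open>C\<close>, so that a congruence carries the
  membership facts needed for multiplying and for passing to cosets.\<close>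

definition cong :: "('x list \<Rightarrow>\<^sub>0 'k) \<Rightarrow> ('x list \<Rightarrow>\<^sub>0 'k) \<Rightarrow> bool" (infix \<open>\<doteq>\<close> 50) where
  "p \<doteq> q \<longleftrightarrow> p \<in> C \<and> q \<in> C \<and> p - q \<in> I"

lemma cong_C: "p \<doteq> q \<Longrightarrow> p \<in> C" "p \<doteq> q \<Longrightarrow> q \<in> C"
  by (simp_all add: cong_def)

lemma cong_refl [intro]: "p \<in> C \<Longrightarrow> p \<doteq> p"
  by (simp add: cong_def)

lemma cong_sym: "p \<doteq> q \<Longrightarrow> q \<doteq> p"
  using I_minus[of "p - q"] by (simp add: cong_def)

lemma cong_trans [trans]: "p \<doteq> q \<Longrightarrow> q \<doteq> r \<Longrightarrow> p \<doteq> r"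
  using I_add[of "p - q" "q - r"] by (simp add: cong_def)

lemma cong_add: "p \<doteq> q \<Longrightarrow> p' \<doteq> q' \<Longrightarrow> p + p' \<doteq> q + q'"
  using I_add[of "p - q" "p' - q'"] by (auto simp: cong_def algebra_simps)

lemma cong_scalar: "p \<doteq> q \<Longrightarrow> scalar c * p \<doteq> scalar c * q"
  using I_scalar[of "p - q" c] by (auto simp: cong_def right_diff_distrib)

lemma cong_mult: "p \<doteq> q \<Longrightarrow> p' \<doteq> q' \<Longrightarrow> p * p' \<doteq> q * q'"
proof -
  assume *: "p \<doteq> q" "p' \<doteq> q'"
  have "p * p' - q * q' = (p - q) * p' + q * (p' - q')" by (simp add: algebra_simps)
  then show ?thesis using * by (auto simp: cong_def intro!: I_add intro: I_lmult I_rmult)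
qed

lemma cong_sum: "(\<And>i. i \<in> A \<Longrightarrow> f i \<doteq> g i) \<Longrightarrow> (\<Sum>i \<in> A. f i) \<doteq> (\<Sum>i \<in> A. g i)"
  by (induction A rule: infinite_finite_induct) (auto intro: cong_add)

lemma cong_zero_iff: "p \<doteq> 0 \<longleftrightarrow> p \<in> I"
  using I_C by (auto simp: cong_def)

lemma cong_in_I: "p \<doteq> q \<Longrightarrow> p \<in> I \<longleftrightarrow> q \<in> I"
  by (metis cong_sym cong_trans cong_zero_iff)

text \<open>The contexts may be empty, and the empty word is not in \<open>C\<close>. Hence the
  ideal property covers nonempty contexts only, and empty ones are split off.\<close>

lemma cong_word_context:
  assumes "word u \<doteq> word w" "set a \<subseteq> X" "set b \<subseteq> X"
  shows "word (a @ u @ b) \<doteq> word (a @ w @ b)"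
proof -
  have 1: "word (a @ u) \<doteq> word (a @ w)"
  proof (cases "a = []")
    case False
    then have "word a \<doteq> word a" using assms by (auto simp: nonempty_words_def)
    then show ?thesis using cong_mult assms(1) by (metis word_mult)
  qed (use assms in simp)
  show ?thesis
  proof (cases "b = []")
    case False
    then have "word b \<doteq> word b" using assms by (auto simp: nonempty_words_def)
    then show ?thesis using cong_mult 1 by (metis word_mult append.assoc)
  qed (use 1 in simp)
qed

lemma zero_word_context:
  assumes "word u \<in> I" "set a \<subseteq> X" "set b \<subseteq> X"
  shows "word (a @ u @ b) \<in> I"
proof -
  have 1: "word (a @ u) \<in> I"
    using assms I_lmult[of "word u" "word a"]
    by (cases "a = []") (auto simp: word_mult nonempty_words_def)
  show ?thesis
    using assms 1 I_rmult[of "word (a @ u)" "word b"]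
    by (cases "b = []") (auto simp: word_mult nonempty_words_def)
qed

definition proj :: "('x list \<Rightarrow>\<^sub>0 'k) \<Rightarrow> ('x list \<Rightarrow>\<^sub>0 'k) set" where
  "proj p = I +>\<^bsub>free_algebra X\<^esub> p"

lemma proj_alt: "proj p = (\<lambda>i. i + p) ` I"
  by (auto simp: proj_def a_r_coset_def')

lemma proj_eq_iff: "proj p = proj q \<longleftrightarrow> p - q \<in> I"
proof
  assume "proj p = proj q"
  moreover have "p \<in> proj p" unfolding proj_alt by (rule image_eqI[where x = 0]) auto
  ultimately obtain i where "i \<in> I" "p = i + q" unfolding proj_alt by blast
  then show "p - q \<in> I" by simp
next
  assume pq: "p - q \<in> I"
  have "proj p \<subseteq> proj q" if "p - q \<in> I" for p q
  proof
    fix x assume "x \<in> proj p"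
    then obtain i where "i \<in> I" "x = i + p" unfolding proj_alt by blast
    then show "x \<in> proj q"
      unfolding proj_alt using that by (intro image_eqI[where x = "i + (p - q)"]) (auto intro: I_add)
  qed
  from this[OF pq] this[of q p] show "proj p = proj q" using I_minus[OF pq] by auto
qed

lemma proj_cong: "p \<doteq> q \<Longrightarrow> proj p = proj q"
  by (simp add: proj_eq_iff cong_def)

lemma proj_eq_cong: "p \<in> C \<Longrightarrow> q \<in> C \<Longrightarrow> proj p = proj q \<longleftrightarrow> p \<doteq> q"
  by (simp add: proj_eq_iff cong_def)

lemma carrier_L: "carrier L = proj ` C"
  by (auto simp: FactRing_def A_RCOSETS_def' proj_def)

lemma zero_L: "\<zero>\<^bsub>L\<^esub> = proj 0"
  by (simp add: FactRing_def proj_alt)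

lemma add_L: "p \<in> C \<Longrightarrow> q \<in> C \<Longrightarrow> proj p \<oplus>\<^bsub>L\<^esub> proj q = proj (p + q)"
proof -
  assume "p \<in> C" "q \<in> C"
  have "proj p \<oplus>\<^bsub>L\<^esub> proj q = {a + b |a b. a \<in> proj p \<and> b \<in> proj q}"
    by (auto simp: FactRing_def set_add_def')
  also have "\<dots> = proj (p + q)"
  proof
    show "{a + b |a b. a \<in> proj p \<and> b \<in> proj q} \<subseteq> proj (p + q)"
    proof safe
      fix a b assume "a \<in> proj p" "b \<in> proj q"
      then obtain i j where "i \<in> I" "j \<in> I" "a = i + p" "b = j + q" unfolding proj_alt by blast
      then show "a + b \<in> proj (p + q)"
        unfolding proj_alt by (intro image_eqI[where x = "i + j"]) (auto intro: I_add)
    qed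
    show "proj (p + q) \<subseteq> {a + b |a b. a \<in> proj p \<and> b \<in> proj q}"
    proof
      fix x assume "x \<in> proj (p + q)"
      then obtain i where "i \<in> I" "x = (i + p) + (0 + q)" unfolding proj_alt by (auto simp: add.assoc)
      then show "x \<in> {a + b |a b. a \<in> proj p \<and> b \<in> proj q}"
        unfolding proj_alt using I_zero by blast
    qed
  qed
  finally show ?thesis .
qed

lemma mult_L: "p \<in> C \<Longrightarrow> q \<in> C \<Longrightarrow> proj p \<otimes>\<^bsub>L\<^esub> proj q = proj (p * q)"
proof -
  assume pq: "p \<in> C" "q \<in> C"
  \<comment> \<open>The product of two cosets is defined as a union over all pairs of
    representatives; it is a single coset because every pair contributes the same one.\<close>
  have "proj (a * b) = proj (p * q)" if ab: "a \<in> proj p" "b \<in> proj q" for a b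
  proof -
    obtain i j where ij: "i \<in> I" "j \<in> I" "a = i + p" "b = j + q" using ab unfolding proj_alt by blast
    have "a \<doteq> p" "b \<doteq> q" using ij pq I_C by (auto simp: cong_def)
    then show ?thesis using cong_mult proj_cong by blast
  qed
  moreover have "p \<in> proj p" "q \<in> proj q" unfolding proj_alt by (auto intro: image_eqI[where x = 0])
  moreover have "proj p \<otimes>\<^bsub>L\<^esub> proj q = (\<Union>a \<in> proj p. \<Union>b \<in> proj q. proj (a * b))"
    by (simp add: FactRing_def rcoset_mult_def proj_def)
  ultimately show ?thesis by blast
qed

lemma L_nonunital_ring: "nonunital_ring L"
proof (rule nonunital_ringI_ops)
  show "abelian_group L"
  proof (rule abelian_groupI)
    fix x assume "x \<in> carrier L"
    then obtain p where "p \<in> C" "x = proj p" by (auto simp: carrier_L)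
    then show "\<exists>y \<in> carrier L. y \<oplus>\<^bsub>L\<^esub> x = \<zero>\<^bsub>L\<^esub>"
      by (intro bexI[of _ "proj (- p)"]) (auto simp: add_L zero_L carrier_L)
  qed (auto simp: carrier_L add_L zero_L algebra_simps)
qed (auto simp: carrier_L add_L mult_L algebra_simps)

sublocale L: nonunital_ring L
  by (rule L_nonunital_ring)

lemma a_inv_L: "p \<in> C \<Longrightarrow> \<ominus>\<^bsub>L\<^esub> (proj p) = proj (- p)"
  by (rule L.minus_equality) (auto simp: carrier_L add_L zero_L)

lemma two_sided_ideal_preimage:
  assumes J: "two_sided_ideal J L"
  shows "two_sided_ideal {p \<in> C. proj p \<in> J} (free_algebra X)"
    and "I \<subseteq> {p \<in> C. proj p \<in> J}"
    and "J = proj ` {p \<in> C. proj p \<in> J}"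
proof -
  have sub: "additive_subgroup J L"
    and mult: "\<And>x r. x \<in> J \<Longrightarrow> r \<in> carrier L \<Longrightarrow> r \<otimes>\<^bsub>L\<^esub> x \<in> J \<and> x \<otimes>\<^bsub>L\<^esub> r \<in> J"
    using J by (auto simp: two_sided_ideal_def)
  have zero: "proj 0 \<in> J" using additive_subgroup.zero_closed[OF sub] by (simp add: zero_L)
  have m: "proj (q * p) \<in> J \<and> proj (p * q) \<in> J" if "p \<in> C" "proj p \<in> J" "q \<in> C" for p q
    using mult[of "proj p" "proj q"] that by (simp add: mult_L carrier_L)
  show "two_sided_ideal {p \<in> C. proj p \<in> J} (free_algebra X)"
    unfolding two_sided_ideal_free_algebra
    using zero m L.additive_subgroup_a_inv_closed[OF sub] additive_subgroup.a_closed[OF sub]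
    by (auto simp: add_L[symmetric] a_inv_L[symmetric])
  show "I \<subseteq> {p \<in> C. proj p \<in> J}"
  proof
    fix p assume "p \<in> I"
    then have "proj p = proj 0" by (simp add: proj_eq_iff)
    then show "p \<in> {p \<in> C. proj p \<in> J}" using zero \<open>p \<in> I\<close> I_C by simp
  qed
  show "J = proj ` {p \<in> C. proj p \<in> J}"
    using additive_subgroup.a_subset[OF sub] by (auto simp: carrier_L)
qed

lemma two_sided_ideal_image:
  assumes J: "two_sided_ideal J (free_algebra X)"
  shows "two_sided_ideal (proj ` J) L"
proof -
  have JC: "p \<in> C" if "p \<in> J" for p using J that unfolding two_sided_ideal_free_algebra by blast
  have "additive_subgroup (proj ` J) L"
    using J JC unfolding two_sided_ideal_free_algebra
    by (intro L.additive_subgroupI) (auto simp: carrier_L zero_L add_L a_inv_L)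
  then show ?thesis
    using J JC unfolding two_sided_ideal_free_algebra two_sided_ideal_def
    by (auto simp: carrier_L mult_L)
qed

text \<open>Ideals of the quotient correspond to ideals of the free algebra above \<open>I\<close>.
  In this form simplicity is applied to annihilators of representations.\<close>

lemma simple_dichotomy:
  assumes "simple_ring L" and J: "two_sided_ideal J (free_algebra X)" and IJ: "I \<subseteq> J"
  shows "J = I \<or> J = C"
proof -
  have JC: "p \<in> C" if "p \<in> J" for p using J that unfolding two_sided_ideal_free_algebra by blast
  have J_cong: "p \<in> J" if "p \<in> C" "q \<in> J" "p - q \<in> I" for p q
  proof -
    have "(p - q) + q \<in> J" using that IJ J unfolding two_sided_ideal_free_algebra by blast
    then show ?thesis by simp
  qed
  consider "proj ` J = {proj 0}" | "proj ` J = proj ` C"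
    using assms(1) two_sided_ideal_image[OF J] unfolding simple_ring_def zero_L carrier_L by blast
  then show ?thesis
  proof cases
    case 1
    then have "p \<in> I" if "p \<in> J" for p using that proj_eq_iff[of p 0] by auto
    then show ?thesis using IJ by blast
  next
    case 2
    have "p \<in> J" if p: "p \<in> C" for p
    proof -
      obtain q where "q \<in> J" "proj p = proj q" using 2 p by blast
      then show ?thesis using J_cong p by (simp add: proj_eq_iff)
    qed
    then show ?thesis using JC by blast
  qed
qed

text \<open>The elements whose class in the quotient lies in the span of the classes of words from
  \<open>S\<close>; the words in \<open>S\<close> may be dependent modulo \<open>I\<close>.\<close>

definition span_mod :: "'x list set \<Rightarrow> ('x list \<Rightarrow>\<^sub>0 'k) set" where
  "span_mod S = {p. \<exists>q. p \<doteq> q \<and> Poly_Mapping.keys q \<subseteq> S}"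

lemma span_mod_C: "p \<in> span_mod S \<Longrightarrow> p \<in> C"
  by (auto simp: span_mod_def cong_C)

lemma span_mod_cong: "p \<doteq> q \<Longrightarrow> q \<in> span_mod S \<Longrightarrow> p \<in> span_mod S"
  unfolding span_mod_def using cong_trans by blast

lemma span_mod_I: "p \<in> I \<Longrightarrow> p \<in> span_mod S"
  unfolding span_mod_def cong_zero_iff[symmetric] by (auto intro!: exI[of _ 0])

lemma span_mod_word: "w \<in> S \<Longrightarrow> w \<in> nonempty_words X \<Longrightarrow> word w \<in> span_mod S"
  unfolding span_mod_def by (auto intro!: exI[of _ "word w"])

lemma span_mod_add: "p \<in> span_mod S \<Longrightarrow> q \<in> span_mod S \<Longrightarrow> p + q \<in> span_mod S"
proof -
  assume "p \<in> span_mod S" "q \<in> span_mod S"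
  then obtain p' q' where "p \<doteq> p'" "q \<doteq> q'" "Poly_Mapping.keys p' \<subseteq> S" "Poly_Mapping.keys q' \<subseteq> S"
    by (auto simp: span_mod_def)
  then have "p + q \<doteq> p' + q'" "Poly_Mapping.keys (p' + q') \<subseteq> S"
    using cong_add Poly_Mapping.keys_add[of p' q'] by auto
  then show ?thesis by (auto simp: span_mod_def)
qed

lemma span_mod_scalar: "p \<in> span_mod S \<Longrightarrow> scalar c * p \<in> span_mod S"
proof -
  assume "p \<in> span_mod S"
  then obtain q where "p \<doteq> q" "Poly_Mapping.keys q \<subseteq> S" by (auto simp: span_mod_def)
  then have "scalar c * p \<doteq> scalar c * q" "Poly_Mapping.keys (scalar c * q) \<subseteq> S"
    using cong_scalar keys_scalar_mult[of c q] by auto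
  then show ?thesis by (auto simp: span_mod_def)
qed

lemma span_mod_sum: "(\<And>i. i \<in> A \<Longrightarrow> f i \<in> span_mod S) \<Longrightarrow> (\<Sum>i \<in> A. f i) \<in> span_mod S"
  by (induction A rule: infinite_finite_induct) (auto intro: span_mod_add span_mod_I)

lemma span_mod_linear:
  assumes "\<And>w. w \<in> Poly_Mapping.keys q \<Longrightarrow> a * word w * b \<in> span_mod S"
  shows "a * q * b \<in> span_mod S"
  unfolding expand_between[of a q b] using assms by (auto intro!: span_mod_sum span_mod_scalar)

lemma in_I_linear:
  assumes "\<And>w. w \<in> Poly_Mapping.keys q \<Longrightarrow> a * word w * b \<in> I"
  shows "a * q * b \<in> I"
  unfolding expand_between[of a q b] using assms by (auto intro!: I_sum I_scalar)

end

section \<open>Dedekind finiteness from a finite spanning set\<close>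

lemma linear_dependence:
  fixes q :: "'i \<Rightarrow> 's \<Rightarrow> 'k::field"
  assumes "finite S" "finite A" "card S < card A"
  shows "\<exists>c. (\<exists>i \<in> A. c i \<noteq> 0) \<and> (\<forall>s \<in> S. (\<Sum>i \<in> A. c i * q i s) = 0)"
  using assms
proof (induction S arbitrary: A q rule: finite_induct)
  case empty
  then have "A \<noteq> {}" by auto
  then show ?case by (intro exI[of _ "\<lambda>_. 1"]) auto
next
  case (insert s S)
  show ?case
  proof (cases "\<forall>i \<in> A. q i s = 0")
    case True
    have "card S < card A" using insert by simp
    then obtain c where "\<exists>i \<in> A. c i \<noteq> 0" "\<forall>s \<in> S. (\<Sum>i \<in> A. c i * q i s) = 0"
      using insert.IH[of A q] insert.prems by blast
    then show ?thesis using True by (intro exI[of _ c]) auto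
  next
    case False
    then obtain j where j: "j \<in> A" "q j s \<noteq> 0" by blast
    define A' where "A' = A - {j}"
    have A': "finite A'" "card S < card A'" "A = insert j A'" "j \<notin> A'"
      using insert j by (auto simp: A'_def card_Diff_singleton)
    \<comment> \<open>Gaussian elimination with pivot \<open>q j s\<close>: subtracting a multiple
      of row \<open>j\<close> clears column \<open>s\<close>.\<close>
    define q' where "q' i t = q i t - q i s / q j s * q j t" for i t
    obtain c where c: "\<exists>i \<in> A'. c i \<noteq> 0" and zero: "\<forall>t \<in> S. (\<Sum>i \<in> A'. c i * q' i t) = 0"
      using insert.IH[OF A'(1,2), of q'] by blast
    \<comment> \<open>The coefficient of row \<open>j\<close> collects everything that the
      elimination subtracted, so that the old rows with \<open>c'\<close> and the reduced rows with
      \<open>c\<close> have the same combination.\<close>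
    define b where "b = (\<Sum>i \<in> A'. c i * (q i s / q j s))"
    define c' where "c' = c(j := - b)"
    have sum: "(\<Sum>i \<in> A. c' i * q i t) = (\<Sum>i \<in> A'. c i * q' i t)" for t
    proof -
      have "(\<Sum>i \<in> A. c' i * q i t) = - b * q j t + (\<Sum>i \<in> A'. c' i * q i t)"
        using A' by (simp add: c'_def)
      also have "(\<Sum>i \<in> A'. c' i * q i t) = (\<Sum>i \<in> A'. c i * q i t)"
        using A'(4) by (intro sum.cong) (auto simp: c'_def)
      also have "- b * q j t + (\<Sum>i \<in> A'. c i * q i t) = (\<Sum>i \<in> A'. c i * q' i t)"
        by (simp add: b_def q'_def right_diff_distrib sum_subtractf sum_distrib_right mult.assoc)
      finally show ?thesis .
    qed
    have "(\<Sum>i \<in> A'. c i * q' i s) = 0" using j(2) by (simp add: q'_def)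
    then have "\<forall>t \<in> insert s S. (\<Sum>i \<in> A. c' i * q i t) = 0" using zero sum by simp
    moreover have "\<exists>i \<in> A. c' i \<noteq> 0" using c A' by (auto simp: c'_def)
    ultimately show ?thesis by blast
  qed
qed

context presented_algebra
begin

text \<open>Powers of \<open>\<eta>\<close> in a corner: the identity \<open>\<epsilon>\<close> of
  the corner takes the place of the missing unit as the power of exponent 0.\<close>

primrec pow_from :: "('x list \<Rightarrow>\<^sub>0 'k) \<Rightarrow> ('x list \<Rightarrow>\<^sub>0 'k) \<Rightarrow> nat \<Rightarrow> ('x list \<Rightarrow>\<^sub>0 'k)" where
  "pow_from \<epsilon> \<eta> 0 = \<epsilon>"
| "pow_from \<epsilon> \<eta> (Suc i) = pow_from \<epsilon> \<eta> i * \<eta>"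

text \<open>
  Powers of \<open>\<eta>\<close> satisfy a polynomial relation; cancelling its lowest power with \<open>\<xi>\<close> yields a left
  inverse of \<open>\<eta>\<close>, which must be \<open>\<xi>\<close>.
\<close>

lemma dedekind_finite:
  assumes S: "finite S"
    and C: "\<epsilon> \<in> C" "\<xi> \<in> C" "\<eta> \<in> C"
    and \<epsilon>: "\<epsilon> * \<epsilon> \<doteq> \<epsilon>" and \<xi>: "\<epsilon> * \<xi> \<doteq> \<xi>" and \<eta>: "\<eta> * \<epsilon> \<doteq> \<eta>"
    and \<eta>\<xi>: "\<eta> * \<xi> \<doteq> \<epsilon>"
    and span: "\<And>i. pow_from \<epsilon> \<eta> i \<in> span_mod S"
  shows "\<xi> * \<eta> \<doteq> \<epsilon>"
proof -
  define y where "y = pow_from \<epsilon> \<eta>"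
  \<comment> \<open>Powers of \<open>\<xi>\<close> grow on the left and powers of
    \<open>\<eta>\<close> on the right, so that in \<open>y (i + j) * x j\<close> the factors
    \<open>\<eta> * \<xi>\<close> meet in the middle and cancel one pair at a time.\<close>
  define x where "x = rec_nat \<epsilon> (\<lambda>_ r. \<xi> * r)"
  have x_simps: "x 0 = \<epsilon>" "x (Suc i) = \<xi> * x i" for i by (simp_all add: x_def)
  have y_simps: "y 0 = \<epsilon>" "y (Suc i) = y i * \<eta>" for i by (simp_all add: y_def)
  have yC: "y i \<in> C" for i by (induction i) (auto simp: y_simps C)
  have xC: "x i \<in> C" for i by (induction i) (auto simp: x_simps C)
  have y\<epsilon>: "y i * \<epsilon> \<doteq> y i" for i
    using \<epsilon> cong_mult[OF cong_refl[OF yC] \<eta>] by (cases i) (auto simp: y_simps mult.assoc)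
  have cancel: "y (i + j) * x j \<doteq> y i" for i j
  proof (induction j)
    case 0
    then show ?case using y\<epsilon> by (simp add: x_simps)
  next
    case (Suc j)
    have "y (i + Suc j) * x (Suc j) = y (i + j) * (\<eta> * \<xi>) * x j"
      by (simp add: y_simps x_simps mult.assoc)
    also have "\<dots> \<doteq> y (i + j) * \<epsilon> * x j"
      using \<eta>\<xi> yC xC by (intro cong_mult cong_refl)
    also have "\<dots> \<doteq> y (i + j) * x j" using y\<epsilon> xC by (intro cong_mult cong_refl)
    also have "\<dots> \<doteq> y i" by (rule Suc.IH)
    finally show ?case .
  qed
  have "\<forall>i. \<exists>q. y i \<doteq> q \<and> Poly_Mapping.keys q \<subseteq> S" using span by (auto simp: span_mod_def y_def)
  then obtain q where q: "\<And>i. y i \<doteq> q i" and qS: "\<And>i. Poly_Mapping.keys (q i) \<subseteq> S" by metis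
  \<comment> \<open>These are \<open>card S + 1\<close> powers, each with coordinates indexed by
    \<open>S\<close>, hence they are dependent.\<close>
  define A where "A = {..card S}"
  obtain c where c: "\<exists>i \<in> A. c i \<noteq> 0"
    and dep: "\<forall>s \<in> S. (\<Sum>i \<in> A. c i * Poly_Mapping.lookup (q i) s) = 0"
    using linear_dependence[of S A "\<lambda>i. Poly_Mapping.lookup (q i)"] S by (auto simp: A_def)
  have "(\<Sum>i \<in> A. scalar (c i) * q i) = 0"
  proof (rule poly_mapping_eqI)
    fix s
    show "Poly_Mapping.lookup (\<Sum>i \<in> A. scalar (c i) * q i) s = Poly_Mapping.lookup 0 s"
    proof (cases "s \<in> S")
      case False
      then have "Poly_Mapping.lookup (q i) s = 0" for i using qS[of i] by (auto simp: in_keys_iff)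
      then show ?thesis by (simp add: lookup_sum lookup_scalar_mult)
    qed (use dep in \<open>simp add: lookup_sum lookup_scalar_mult\<close>)
  qed
  moreover have "(\<Sum>i \<in> A. scalar (c i) * y i) \<doteq> (\<Sum>i \<in> A. scalar (c i) * q i)"
    by (intro cong_sum cong_scalar q)
  ultimately have rel: "(\<Sum>i \<in> A. scalar (c i) * y i) \<in> I" using cong_zero_iff by simp
  define j where "j = (LEAST i. i \<in> A \<and> c i \<noteq> 0)"
  have j: "j \<in> A" "c j \<noteq> 0" using LeastI_ex[of "\<lambda>i. i \<in> A \<and> c i \<noteq> 0"] c by (auto simp: j_def)
  have below: "c i = 0" if "i < j" for i
    using not_less_Least[of i "\<lambda>i. i \<in> A \<and> c i \<noteq> 0", folded j_def] that j(1) by (auto simp: A_def)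
  define B where "B = {i \<in> A. j < i}"
  have A_split: "(\<Sum>i \<in> A. f i) = f j + (\<Sum>i \<in> B. f i)" if "\<And>i. i < j \<Longrightarrow> f i = 0"
    for f :: "nat \<Rightarrow> 'x list \<Rightarrow>\<^sub>0 'k"
  proof -
    have "(\<Sum>i \<in> A. f i) = (\<Sum>i \<in> insert j B. f i)"
    proof (rule sum.mono_neutral_right)
      show "\<forall>i \<in> A - insert j B. f i = 0"
        using that by (auto simp: B_def) (meson linorder_neqE_nat)
    qed (use j in \<open>auto simp: A_def B_def\<close>)
    then show ?thesis by (simp add: B_def A_def)
  qed
  \<comment> \<open>Right multiplication by \<open>x j\<close> lowers every exponent by
    \<open>j\<close>. The terms with \<open>i > j\<close> keep at least one factor
    \<open>\<eta>\<close>, which is split off on the right.\<close>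
  define T where "T = (\<Sum>i \<in> B. scalar (c i) * y (i - j - 1))"
  have TC: "T \<in> C" unfolding T_def using yC by (intro free_algebra_sum free_algebra_closed)
  have "(\<Sum>i \<in> A. scalar (c i) * y i) * x j = (\<Sum>i \<in> A. scalar (c i) * (y i * x j))"
    by (simp add: sum_distrib_right mult.assoc)
  also have "\<dots> = scalar (c j) * (y j * x j) + (\<Sum>i \<in> B. scalar (c i) * (y i * x j))"
    by (rule A_split) (simp add: below)
  also have "\<dots> \<doteq> scalar (c j) * y 0 + (\<Sum>i \<in> B. scalar (c i) * (y (i - j - 1) * \<eta>))"
  proof (intro cong_add cong_scalar cong_sum)
    show "y j * x j \<doteq> y 0" using cancel[of 0 j] by simp
    fix i assume "i \<in> B"
    then have "i = Suc (i - j - 1) + j" by (simp add: B_def)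
    then show "y i * x j \<doteq> y (i - j - 1) * \<eta>"
      using cancel[of "Suc (i - j - 1)" j] by (simp only: y_simps)
  qed
  also have "\<dots> = scalar (c j) * \<epsilon> + T * \<eta>"
    by (simp add: T_def sum_distrib_right mult.assoc y_simps)
  finally have "(\<Sum>i \<in> A. scalar (c i) * y i) * x j \<doteq> scalar (c j) * \<epsilon> + T * \<eta>" .
  moreover have "(\<Sum>i \<in> A. scalar (c i) * y i) * x j \<in> I" using rel xC by (rule I_rmult)
  ultimately have "scalar (c j) * \<epsilon> + T * \<eta> \<in> I" using cong_in_I by blast
  then have "scalar (- 1 / c j) * (scalar (c j) * \<epsilon> + T * \<eta>) \<in> I" by (rule I_scalar)
  moreover define r where "r = scalar (- 1 / c j) * T"
  ultimately have "scalar (- 1) * \<epsilon> + r * \<eta> \<in> I"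
    using j(2) by (simp add: distrib_left scalar_mult mult.assoc)
  moreover have "scalar (- 1) * \<epsilon> = - \<epsilon>"
    by (rule poly_mapping_eqI) (simp add: lookup_scalar_mult)
  ultimately have "r * \<eta> - \<epsilon> \<in> I" by simp
  moreover have rC: "r \<in> C" using TC by (simp add: r_def)
  ultimately have r\<eta>: "r * \<eta> \<doteq> \<epsilon>" using C by (simp add: cong_def)
  have r\<epsilon>: "r * \<epsilon> \<doteq> r"
  proof -
    have "T * \<epsilon> \<doteq> T"
      unfolding T_def sum_distrib_right mult.assoc using y\<epsilon> by (intro cong_sum cong_scalar)
    then show ?thesis unfolding r_def mult.assoc by (rule cong_scalar)
  qed
  have "\<xi> \<doteq> \<epsilon> * \<xi>" using \<xi> by (rule cong_sym)
  also have "\<dots> \<doteq> r * \<eta> * \<xi>" using cong_sym[OF r\<eta>] C by (intro cong_mult cong_refl)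
  also have "r * \<eta> * \<xi> = r * (\<eta> * \<xi>)" by (simp add: mult.assoc)
  also have "\<dots> \<doteq> r * \<epsilon>" using \<eta>\<xi> rC by (intro cong_mult cong_refl)
  also have "\<dots> \<doteq> r" by (rule r\<epsilon>)
  finally have "\<xi> * \<eta> \<doteq> r * \<eta>" using C by (intro cong_mult cong_refl)
  then show ?thesis using r\<eta> by (rule cong_trans)
qed

end

section \<open>Modules defined by partial maps on a set of points\<close>

primrec word_act :: "('x \<Rightarrow> 'p \<Rightarrow> 'p option) \<Rightarrow> 'x list \<Rightarrow> 'p \<Rightarrow> 'p option" where
  "word_act a [] p = Some p"
| "word_act a (x # w) p = Option.bind (a x p) (word_act a w)"

lemma word_act_append: "word_act a (u @ w) p = Option.bind (word_act a u p) (word_act a w)"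
  by (induction u arbitrary: p) (auto split: bind_split)

text \<open>A point at which the word is undefined gets the value 0, so that a word that is defined
  nowhere acts as the zero operator.\<close>

definition word_pullback ::
    "('x \<Rightarrow> 'p \<Rightarrow> 'p option) \<Rightarrow> 'x list \<Rightarrow> ('p \<Rightarrow> 'k::field) \<Rightarrow> 'p \<Rightarrow> 'k" where
  "word_pullback a w g p = (case word_act a w p of None \<Rightarrow> 0 | Some q \<Rightarrow> g q)"

text \<open>Partial maps act on functions by composition, which turns left multiplication into an action.\<close>

definition pullback ::
    "('x \<Rightarrow> 'p \<Rightarrow> 'p option) \<Rightarrow> ('x list \<Rightarrow>\<^sub>0 'k::field) \<Rightarrow> ('p \<Rightarrow> 'k) \<Rightarrow> 'p \<Rightarrow> 'k" where
  "pullback a f g p =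
     (\<Sum>w \<in> Poly_Mapping.keys f. Poly_Mapping.lookup f w * word_pullback a w g p)"

lemma word_pullback_append:
  "word_pullback a (u @ w) g p = word_pullback a u (word_pullback a w g) p"
  by (auto simp: word_pullback_def word_act_append split: option.splits bind_split)

lemma word_pullback_sum:
  "word_pullback a w (\<lambda>q. \<Sum>i \<in> A. c i * g i q) p = (\<Sum>i \<in> A. c i * word_pullback a w (g i) p)"
  by (simp add: word_pullback_def split: option.split)

lemma pullback_superset:
  assumes "finite A" "Poly_Mapping.keys f \<subseteq> A"
  shows "pullback a f g p = (\<Sum>w \<in> A. Poly_Mapping.lookup f w * word_pullback a w g p)"
  unfolding pullback_def using assms by (intro sum.mono_neutral_left) (auto simp: in_keys_iff)

lemma pullback_zero [simp]: "pullback a 0 g p = 0"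
  by (simp add: pullback_def)

lemma pullback_add: "pullback a (f + h) g p = pullback a f g p + pullback a h g p"
proof -
  define A where "A = Poly_Mapping.keys f \<union> Poly_Mapping.keys h"
  have "finite A" "Poly_Mapping.keys f \<subseteq> A" "Poly_Mapping.keys h \<subseteq> A"
    "Poly_Mapping.keys (f + h) \<subseteq> A"
    using Poly_Mapping.keys_add[of f h] by (auto simp: A_def)
  then show ?thesis
    by (simp add: pullback_superset[of A] lookup_add algebra_simps sum.distrib)
qed

lemma pullback_scalar: "pullback a (scalar c * f) g p = c * pullback a f g p"
  using keys_scalar_mult[of c f]
  by (simp add: pullback_superset[of "Poly_Mapping.keys f"] lookup_scalar_mult sum_distrib_left mult.assoc)

lemma pullback_minus: "pullback a (- f) g p = - pullback a f g p"
  using pullback_add[of a f "- f" g p] by (simp add: eq_neg_iff_add_eq_0 add.commute)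

lemma pullback_diff: "pullback a (f - h) g p = pullback a f g p - pullback a h g p"
  using pullback_add[of a f "- h" g p] by (simp add: pullback_minus)

lemma pullback_sum: "pullback a (\<Sum>i \<in> A. f i) g p = (\<Sum>i \<in> A. pullback a (f i) g p)"
  by (induction A rule: infinite_finite_induct) (auto simp: pullback_add)

lemma pullback_word [simp]: "pullback a (word w) g p = word_pullback a w g p"
  by (simp add: pullback_def)

lemma pullback_word_mult: "pullback a (word u * f) g p = word_pullback a u (pullback a f g) p"
proof -
  have "word u * f * 1 =
      (\<Sum>w \<in> Poly_Mapping.keys f. scalar (Poly_Mapping.lookup f w) * word (u @ w))"
    by (subst expand_between) (simp add: word_mult)
  then have "pullback a (word u * f) g p =
      (\<Sum>w \<in> Poly_Mapping.keys f. Poly_Mapping.lookup f w * word_pullback a u (word_pullback a w g) p)"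
    by (simp add: pullback_sum pullback_scalar word_pullback_append)
  also have "\<dots> = word_pullback a u (pullback a f g) p"
    unfolding pullback_def[abs_def] by (rule word_pullback_sum[symmetric])
  finally show ?thesis .
qed

lemma pullback_mult: "pullback a (f * h) g p = pullback a f (pullback a h g) p"
proof -
  have "1 * f * h = (\<Sum>u \<in> Poly_Mapping.keys f. scalar (Poly_Mapping.lookup f u) * (word u * h))"
    by (subst expand_between) simp
  then have "pullback a (f * h) g p =
      (\<Sum>u \<in> Poly_Mapping.keys f. Poly_Mapping.lookup f u * word_pullback a u (pullback a h g) p)"
    by (simp add: pullback_sum pullback_scalar pullback_word_mult)
  then show ?thesis by (simp add: pullback_def[of a f])
qed

definition annihilator :: "'x set \<Rightarrow> ('x \<Rightarrow> 'p \<Rightarrow> 'p option) \<Rightarrow> ('x list \<Rightarrow>\<^sub>0 'k::field) set" where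
  "annihilator X a = {f \<in> carrier (free_algebra X). \<forall>g p. pullback a f g p = 0}"

lemma annihilator_algebra_ideal: "algebra_ideal X (annihilator X a :: ('x list \<Rightarrow>\<^sub>0 'k::field) set)"
proof -
  have "word_pullback a w (\<lambda>q. 0) p = (0 :: 'k)" for w p
    by (simp add: word_pullback_def split: option.split)
  then have zero: "pullback a f (\<lambda>q. 0) p = 0" for f :: "'x list \<Rightarrow>\<^sub>0 'k" and p
    by (simp add: pullback_def)
  have mult: "pullback a (f * h) g p = 0" if "\<forall>g p. pullback a h g p = 0"
    for f h :: "'x list \<Rightarrow>\<^sub>0 'k" and g p
  proof -
    have "pullback a h g = (\<lambda>q. 0)" using that by auto
    then show ?thesis by (simp add: pullback_mult zero)
  qed
  show ?thesis
    unfolding algebra_ideal_def two_sided_ideal_free_algebra map_scale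
  proof (intro conjI ballI allI)
    fix f h :: "'x list \<Rightarrow>\<^sub>0 'k" and c :: 'k
    assume f: "f \<in> annihilator X a"
    show "- f \<in> annihilator X a" "scalar c * f \<in> annihilator X a"
      using f by (simp_all add: annihilator_def pullback_minus pullback_scalar)
    show "f + h \<in> annihilator X a" if "h \<in> annihilator X a"
      using f that by (simp add: annihilator_def pullback_add)
    assume h: "h \<in> carrier (free_algebra X)"
    show "h * f \<in> annihilator X a" using f h mult by (simp add: annihilator_def)
    show "f * h \<in> annihilator X a" using f h by (simp add: annihilator_def pullback_mult)
  qed (auto simp: annihilator_def)
qed

section \<open>Cycles and closed walks\<close>

context wf_digraph
begin

text \<open>Two edges with the same source cut out a closed walk. Either this is a cycle already, or
  it repeats a source itself and is strictly shorter.\<close>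

lemma cycle_in_nondistinct_walk:
  assumes "awalk u \<alpha> w" "\<not> distinct (map (tail G) \<alpha>)"
  shows "\<exists>\<xi> \<mu> \<eta>. \<alpha> = \<xi> @ \<mu> @ \<eta> \<and> graph_cycle G \<mu>"
  using assms
proof (induction "length \<alpha>" arbitrary: \<alpha> u w rule: less_induct)
  case less
  obtain xs ys zs y where "map (tail G) \<alpha> = xs @ [y] @ ys @ [y] @ zs"
    using not_distinct_decomp[OF less.prems(2)] by blast
  then obtain a e b f c where \<alpha>: "\<alpha> = a @ (e # b) @ f # c" and e: "tail G e = y" and f: "tail G f = y"
    by (auto simp: map_eq_append_conv map_eq_Cons_conv append_eq_map_conv Cons_eq_map_conv)
  have walk: "awalk y (e # b) y"
    using less.prems(1) e f unfolding \<alpha> by (auto simp: awalk_Cons_iff)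
  show ?case
  proof (cases "distinct (map (tail G) (e # b))")
    case True
    then have "graph_cycle G (e # b)" using walk by (auto simp: graph_cycle_def)
    then show ?thesis using \<alpha> by blast
  next
    case False
    have "length (e # b) < length \<alpha>" by (simp add: \<alpha>)
    then obtain \<xi> \<mu> \<eta> where "e # b = \<xi> @ \<mu> @ \<eta>" "graph_cycle G \<mu>"
      using less.hyps walk False by blast
    then have "\<alpha> = (a @ \<xi>) @ \<mu> @ (\<eta> @ f # c)" "graph_cycle G \<mu>" by (simp_all add: \<alpha>)
    then show ?thesis by blast
  qed
qed

lemma cycle_in_closed_walk:
  assumes "awalk u \<gamma> u" "\<gamma> \<noteq> []"
  shows "\<exists>\<xi> \<mu> \<eta>. \<gamma> = \<xi> @ \<mu> @ \<eta> \<and> graph_cycle G \<mu>"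
proof (cases "distinct (map (tail G) \<gamma>)")
  case True
  then have "graph_cycle G \<gamma>" using assms by (auto simp: graph_cycle_def)
  then have "\<gamma> = [] @ \<gamma> @ [] \<and> graph_cycle G \<gamma>" by simp
  then show ?thesis by blast
qed (use assms cycle_in_nondistinct_walk in blast)

text \<open>A nonempty closed walk contains a cycle as a contiguous piece, and an exit to that piece
  leaves the whole walk.\<close>

lemma closed_walk_exit:
  assumes exits: "\<And>\<mu>. graph_cycle G \<mu> \<Longrightarrow> \<exists>e. is_exit G \<mu> e"
    and "awalk u \<gamma> u" "\<gamma> \<noteq> []"
  obtains j f where "j < length \<gamma>" "f \<in> arcs G" "tail G f = tail G (\<gamma> ! j)" "f \<noteq> \<gamma> ! j"
proof -
  obtain \<xi> \<mu> \<eta> where \<gamma>: "\<gamma> = \<xi> @ \<mu> @ \<eta>" and \<mu>: "graph_cycle G \<mu>"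
    using cycle_in_closed_walk assms(2,3) by blast
  obtain f where "is_exit G \<mu> f" using exits \<mu> by blast
  then obtain i where f: "f \<in> arcs G" "i < length \<mu>" "tail G f = tail G (\<mu> ! i)" "f \<noteq> \<mu> ! i"
    by (auto simp: is_exit_def)
  have "\<gamma> ! (length \<xi> + i) = \<mu> ! i" using f by (simp add: \<gamma> nth_append)
  then show thesis using that[of "length \<xi> + i" f] f by (simp add: \<gamma>)
qed

lemma awalk_take_nth:
  assumes "awalk u \<gamma> w" "j < length \<gamma>"
  shows "awalk u (take j \<gamma>) (tail G (\<gamma> ! j))"
proof -
  have "awalk u (take j \<gamma> @ \<gamma> ! j # drop (Suc j) \<gamma>) w"
    using assms by (simp add: id_take_nth_drop[symmetric])
  then show ?thesis by (auto simp: awalk_Cons_iff)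
qed

lemma awalk_replicate: "awalk u \<gamma> u \<Longrightarrow> awalk u (concat (replicate m \<gamma>)) u"
  by (induction m) (auto intro: awalk_appendI simp: awalk_Nil_iff)

end

lemma nth_concat_replicate_append:
  assumes "k < m * length \<gamma> + j" "j < length \<gamma>"
  shows "(concat (replicate m \<gamma>) @ take j \<gamma>) ! k = \<gamma> ! (k mod length \<gamma>)"
  using assms
proof (induction m arbitrary: k)
  case (Suc m)
  show ?case
  proof (cases "k < length \<gamma>")
    case False
    then have "k - length \<gamma> < m * length \<gamma> + j" using Suc.prems by simp
    then show ?thesis using Suc.IH[of "k - length \<gamma>"] Suc.prems False
      by (simp add: nth_append le_mod_geq)
  qed (simp add: nth_append)
qed simp

text \<open>
  Follow \<open>\<gamma>\<close> for many turns and then leave it. If the resulting \<open>\<delta>\<close> were a prefix of \<open>\<gamma>' \<delta>\<close>, it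
  would have the period \<open>length \<gamma>'\<close>; all but its last edge also have the period \<open>length \<gamma>\<close>, and
  combining the two periods forces the last edge to agree with \<open>\<gamma>\<close>.
\<close>

lemma (in wf_digraph) aperiodic_walk:
  assumes exits: "\<And>\<mu>. graph_cycle G \<mu> \<Longrightarrow> \<exists>e. is_exit G \<mu> e"
    and w: "w \<in> verts G" and fin: "finite \<Gamma>"
    and closed: "\<And>\<gamma>. \<gamma> \<in> \<Gamma> \<Longrightarrow> awalk w \<gamma> w \<and> \<gamma> \<noteq> []"
  obtains \<delta> u where "awalk w \<delta> u" "\<And>\<gamma>. \<gamma> \<in> \<Gamma> \<Longrightarrow> \<not> prefix \<delta> (\<gamma> @ \<delta>)"
proof (cases "\<Gamma> = {}")
  case True
  then show thesis using that[of "[]" w] w by (simp add: awalk_Nil_iff)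
next
  case False
  then obtain \<gamma> where \<gamma>\<Gamma>: "\<gamma> \<in> \<Gamma>" by blast
  define l where "l = length \<gamma>"
  have \<gamma>: "awalk w \<gamma> w" "\<gamma> \<noteq> []" using closed \<gamma>\<Gamma> by auto
  then have l: "l > 0" by (simp add: l_def)
  obtain j f where j: "j < length \<gamma>" and f: "f \<in> arcs G" "tail G f = tail G (\<gamma> ! j)" "f \<noteq> \<gamma> ! j"
    using closed_walk_exit[OF exits \<gamma>] by blast
  obtain B where B: "\<And>\<gamma>'. \<gamma>' \<in> \<Gamma> \<Longrightarrow> length \<gamma>' \<le> B"
    using finite_nat_set_iff_bounded_le[of "length ` \<Gamma>"] fin by auto
  \<comment> \<open>With \<open>Suc B\<close> turns, the length \<open>N\<close> is at least
    \<open>length \<gamma>' + length \<gamma>\<close> for every \<open>\<gamma>'\<close> in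
    \<open>\<Gamma>\<close>. This is the room needed to combine the two periods.\<close>
  define \<delta>' where "\<delta>' = concat (replicate (Suc B) \<gamma>) @ take j \<gamma>"
  define N where "N = Suc B * l + j"
  have len: "length \<delta>' = N"
    using j by (simp add: \<delta>'_def N_def l_def length_concat sum_list_replicate)
  have nth: "\<delta>' ! k = \<gamma> ! (k mod l)" if "k < N" for k
    using nth_concat_replicate_append[of k "Suc B" \<gamma> j] that j by (simp only: \<delta>'_def N_def l_def)
  have "awalk w \<delta>' (tail G (\<gamma> ! j))"
    unfolding \<delta>'_def using awalk_appendI[OF awalk_replicate[OF \<gamma>(1)] awalk_take_nth[OF \<gamma>(1) j]] .
  then have "awalk w (\<delta>' @ [f]) (head G f)"
    using arc_implies_awalk[OF f(1)] f(2) by (auto intro: awalk_appendI)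
  moreover have "\<not> prefix (\<delta>' @ [f]) (\<gamma>' @ \<delta>' @ [f])" if \<gamma>': "\<gamma>' \<in> \<Gamma>" for \<gamma>'
  proof
    assume pre: "prefix (\<delta>' @ [f]) (\<gamma>' @ \<delta>' @ [f])"
    define n where "n = length \<gamma>'"
    have n: "n > 0" "n \<le> B" using closed[OF \<gamma>'] B[OF \<gamma>'] by (auto simp: n_def)
    have "B \<le> B * l" using l by simp
    then have N: "n + l \<le> N" using n unfolding N_def mult_Suc by linarith
    have period: "(\<delta>' @ [f]) ! i = (\<delta>' @ [f]) ! (i - n)" if "n \<le> i" "i \<le> N" for i
    proof -
      obtain zs where "\<gamma>' @ \<delta>' @ [f] = (\<delta>' @ [f]) @ zs" using pre by (auto simp: prefix_def)
      then have "(\<delta>' @ [f]) ! i = (\<gamma>' @ \<delta>' @ [f]) ! i"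
        using that len nth_append_left[of i "\<delta>' @ [f]" zs] by simp
      then show ?thesis using that by (simp add: nth_append n_def)
    qed
    \<comment> \<open>The positions visited are \<open>N\<close>, \<open>N - n\<close>,
      \<open>N - n - l\<close> and \<open>N - l\<close>: step by \<open>n\<close>, then by
      \<open>l\<close>, then back by \<open>n\<close>. The period \<open>l\<close> is thus never
      applied at position \<open>N\<close>, where \<open>f\<close> breaks it.\<close>
    have "f = (\<delta>' @ [f]) ! N" by (simp add: nth_append len)
    also have "\<dots> = (\<delta>' @ [f]) ! (N - n)" using period[of N] N by simp
    also have "\<dots> = \<delta>' ! (N - n)" using N n l len by (simp add: nth_append)
    also have "\<dots> = \<gamma> ! ((N - n) mod l)" using nth N n l by simp
    also have "(N - n) mod l = (N - l - n) mod l"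
    proof -
      have "N - n = (N - l - n) + l" using N by simp
      then show ?thesis by (metis mod_add_self2)
    qed
    also have "\<gamma> ! ((N - l - n) mod l) = (\<delta>' @ [f]) ! (N - l - n)"
      using nth[of "N - l - n"] N l n len by (simp add: nth_append)
    also have "\<dots> = (\<delta>' @ [f]) ! (N - l)" using period[of "N - l"] N l by simp
    also have "\<dots> = \<gamma> ! ((N - l) mod l)" using nth[of "N - l"] N l n len by (simp add: nth_append)
    also have "N - l = B * l + j" by (simp add: N_def)
    also have "(B * l + j) mod l = j" using j by (simp add: l_def)
    finally show False using f(3) by simp
  qed
  ultimately show thesis using that by blast
qed

section \<open>Normal forms and reduction in Leavitt path algebras\<close>

lemma gen_algebra_ideal_is_algebra_ideal:
  fixes S :: "('x list \<Rightarrow>\<^sub>0 'k::field) set"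
  assumes "S \<subseteq> carrier (free_algebra X)"
  shows "algebra_ideal X (gen_algebra_ideal X S)"
proof -
  \<comment> \<open>The whole algebra belongs to the family being intersected; without a member
    inside the carrier the intersection could leave it.\<close>
  have "algebra_ideal X (carrier (free_algebra X :: ('x list \<Rightarrow>\<^sub>0 'k) ring))"
    unfolding algebra_ideal_def two_sided_ideal_free_algebra map_scale by auto
  then have ne: "carrier (free_algebra X) \<in> {J. algebra_ideal X J \<and> S \<subseteq> J}"
    using assms by simp
  then have sub: "gen_algebra_ideal X S \<subseteq> carrier (free_algebra X)"
    unfolding gen_algebra_ideal_def by blast
  show ?thesis
    unfolding algebra_ideal_def two_sided_ideal_free_algebra map_scale
  proof (intro conjI)
    show "gen_algebra_ideal X S \<subseteq> carrier (free_algebra X)" by (rule sub)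
  qed (unfold gen_algebra_ideal_def algebra_ideal_def two_sided_ideal_free_algebra map_scale, blast+)
qed

lemma gen_algebra_ideal_contains: "S \<subseteq> gen_algebra_ideal X S"
  by (auto simp: gen_algebra_ideal_def)

lemma gen_algebra_ideal_least: "algebra_ideal X J \<Longrightarrow> S \<subseteq> J \<Longrightarrow> gen_algebra_ideal X S \<subseteq> J"
  by (auto simp: gen_algebra_ideal_def)

locale leavitt = wf_digraph E for E :: "('v, 'e) pre_digraph" +
  fixes K :: "'k::field itself"
  assumes row_finite: "row_finite E"
begin

abbreviation X :: "('v, 'e) lpa_symbol set" where
  "X \<equiv> lpa_symbols E"

abbreviation I :: "(('v, 'e) lpa_symbol list \<Rightarrow>\<^sub>0 'k) set" where
  "I \<equiv> gen_algebra_ideal X (lpa_relations E)"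

lemma in_X [simp]:
  "Vertex v \<in> X \<longleftrightarrow> v \<in> verts E" "Edge e \<in> X \<longleftrightarrow> e \<in> arcs E" "Ghost e \<in> X \<longleftrightarrow> e \<in> arcs E"
  by (auto simp: lpa_symbols_def)

lemma edges_in_X [simp]:
  "Edge ` A \<subseteq> X \<longleftrightarrow> A \<subseteq> arcs E" "Ghost ` A \<subseteq> X \<longleftrightarrow> A \<subseteq> arcs E"
  by (auto simp: lpa_symbols_def)

lemma out_arcsD: "e \<in> out_arcs E v \<Longrightarrow> e \<in> arcs E \<and> tail E e = v"
  by (simp add: out_arcs_def)

lemma relations_C: "lpa_relations E \<subseteq> carrier (free_algebra X :: (('v, 'e) lpa_symbol list \<Rightarrow>\<^sub>0 'k) ring)"
proof
  fix p :: "('v, 'e) lpa_symbol list \<Rightarrow>\<^sub>0 'k"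
  assume "p \<in> lpa_relations E"
  then show "p \<in> carrier (free_algebra X)"
    by cases (auto simp: gen_def word_mult nonempty_words_def dest!: out_arcsD intro!: free_algebra_closed free_algebra_sum)
qed

sublocale presented_algebra X I
  by unfold_locales (rule gen_algebra_ideal_is_algebra_ideal[OF relations_C])

notation cong (infix \<open>\<doteq>\<close> 50)

lemma relation_I: "p \<in> lpa_relations E \<Longrightarrow> p \<in> I"
  using gen_algebra_ideal_contains by blast

lemma word_cong_words:
  "word u \<doteq> word w \<longleftrightarrow> u \<in> nonempty_words X \<and> w \<in> nonempty_words X \<and> word u - word w \<in> I"
  by (simp add: cong_def)

lemma vertex_idem: "v \<in> verts E \<Longrightarrow> word [Vertex v, Vertex v] \<doteq> word [Vertex v]"
  using relation_I[OF lpa_relations.vertex_vertex[of v E v]]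
  by (simp add: word_cong_words nonempty_words_def gen_def word_mult)

lemma vertex_orth: "v \<in> verts E \<Longrightarrow> w \<in> verts E \<Longrightarrow> v \<noteq> w \<Longrightarrow> word [Vertex v, Vertex w] \<in> I"
  using relation_I[OF lpa_relations.vertex_vertex[of v E w]] by (simp add: gen_def word_mult)

text \<open>\<open>lsrc\<close> and \<open>ltgt\<close> are the endpoints of a generator in the
  extended graph, where a ghost edge runs backwards and a vertex is a trivial path.\<close>

fun lsrc :: "('v, 'e) lpa_symbol \<Rightarrow> 'v" where
  "lsrc (Vertex v) = v" | "lsrc (Edge e) = tail E e" | "lsrc (Ghost e) = head E e"

fun ltgt :: "('v, 'e) lpa_symbol \<Rightarrow> 'v" where
  "ltgt (Vertex v) = v" | "ltgt (Edge e) = head E e" | "ltgt (Ghost e) = tail E e"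

lemma lsrc_ltgt_verts [simp]: "x \<in> X \<Longrightarrow> lsrc x \<in> verts E" "x \<in> X \<Longrightarrow> ltgt x \<in> verts E"
  by (cases x; auto)+

lemma lsrc_absorb: "x \<in> X \<Longrightarrow> word [Vertex (lsrc x), x] \<doteq> word [x]"
  using vertex_idem relation_I[OF lpa_relations.source_edge] relation_I[OF lpa_relations.range_ghost]
  by (cases x) (auto simp: word_cong_words nonempty_words_def gen_def word_mult)

lemma ltgt_absorb: "x \<in> X \<Longrightarrow> word [x, Vertex (ltgt x)] \<doteq> word [x]"
  using vertex_idem relation_I[OF lpa_relations.edge_range] relation_I[OF lpa_relations.ghost_source]
  by (cases x) (auto simp: word_cong_words nonempty_words_def gen_def word_mult)

text \<open>Insert the endpoint vertices between the two letters; they are distinct and hence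
  orthogonal.\<close>

lemma mismatch:
  assumes "x \<in> X" "y \<in> X" "ltgt x \<noteq> lsrc y"
  shows "word [x, y] \<in> I"
proof -
  have "word [x] * word [y] \<doteq> word [x, Vertex (ltgt x)] * word [Vertex (lsrc y), y]"
    using assms by (intro cong_mult cong_sym[OF ltgt_absorb] cong_sym[OF lsrc_absorb])
  moreover have "word ([x] @ [Vertex (ltgt x), Vertex (lsrc y)] @ [y]) \<in> I"
    using assms by (intro zero_word_context vertex_orth) auto
  ultimately show ?thesis using cong_in_I by (simp add: word_mult)
qed

lemma CK1_same: "e \<in> arcs E \<Longrightarrow> word [Ghost e, Edge e] \<doteq> word [Vertex (head E e)]"
  using relation_I[OF lpa_relations.CK1[of e E e]]
  by (simp add: word_cong_words nonempty_words_def gen_def word_mult)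

lemma CK1_diff: "e \<in> arcs E \<Longrightarrow> f \<in> arcs E \<Longrightarrow> e \<noteq> f \<Longrightarrow> word [Ghost e, Edge f] \<in> I"
  using relation_I[OF lpa_relations.CK1[of e E f]] by (simp add: gen_def word_mult)

lemma CK2_cong:
  assumes "v \<in> verts E" "out_arcs E v \<noteq> {}"
  shows "word [Vertex v] \<doteq> (\<Sum>e \<in> out_arcs E v. word [Edge e, Ghost e])"
  using relation_I[OF lpa_relations.CK2[OF assms]] assms
  by (auto simp: cong_def nonempty_words_def gen_def word_mult dest!: out_arcsD intro!: free_algebra_sum)

lemma Vertex_Cons:
  assumes "set (x # k) \<subseteq> X" "v = lsrc x"
  shows "word (Vertex v # x # k) \<doteq> word (x # k)"
  using cong_word_context[OF lsrc_absorb[of x], of "[]" k] assms by simp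

lemma snoc_Vertex:
  assumes "set (k @ [x]) \<subseteq> X" "v = ltgt x"
  shows "word (k @ [x, Vertex v]) \<doteq> word (k @ [x])"
  using cong_word_context[OF ltgt_absorb[of x], of k "[]"] assms by simp

text \<open>The word \<open>nw \<alpha> w \<beta>\<close> is the spanning element \<open>\<alpha>\<beta>\<^sup>*\<close>, with its middle vertex \<open>w\<close> made explicit.\<close>

definition nw :: "'e list \<Rightarrow> 'v \<Rightarrow> 'e list \<Rightarrow> ('v, 'e) lpa_symbol list" where
  "nw \<alpha> w \<beta> = map Edge \<alpha> @ Vertex w # map Ghost (rev \<beta>)"

text \<open>The set \<open>F\<close> keeps track of the edges that occur. For finite
  \<open>F\<close>, and a vertex \<open>v\<close> that connects to no cycle,
  \<open>normal_words F v v\<close> is finite.\<close>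

definition normal_words :: "'e set \<Rightarrow> 'v \<Rightarrow> 'v \<Rightarrow> ('v, 'e) lpa_symbol list set" where
  "normal_words F u v =
     {nw \<alpha> w \<beta> |\<alpha> w \<beta>. awalk u \<alpha> w \<and> awalk v \<beta> w \<and> set \<alpha> \<subseteq> F \<and> set \<beta> \<subseteq> F}"

lemma normal_wordsI:
  "awalk u \<alpha> w \<Longrightarrow> awalk v \<beta> w \<Longrightarrow> set \<alpha> \<subseteq> F \<Longrightarrow> set \<beta> \<subseteq> F \<Longrightarrow> nw \<alpha> w \<beta> \<in> normal_words F u v"
  unfolding normal_words_def by blast

definition word_arcs :: "('v, 'e) lpa_symbol list \<Rightarrow> 'e set" where
  "word_arcs k = {e. Edge e \<in> set k \<or> Ghost e \<in> set k}"

lemma awalk_arcs: "awalk u \<alpha> w \<Longrightarrow> set \<alpha> \<subseteq> arcs E"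
  by (simp add: awalk_def)

lemma nw_X: "awalk u \<alpha> w \<Longrightarrow> awalk v \<beta> w \<Longrightarrow> nw \<alpha> w \<beta> \<in> nonempty_words X"
  using awalk_arcs awalk_last_in_verts[of u \<alpha> w] by (auto simp: nw_def nonempty_words_def)

text \<open>The explicit \<open>Vertex w\<close> lets the trivial path be included: there the
  absorption is idempotence of \<open>w\<close>, and otherwise it is the source relation of the
  first edge.\<close>

lemma Vertex_walk_absorb:
  assumes "awalk u \<alpha> w" "set k \<subseteq> X"
  shows "word (Vertex u # map Edge \<alpha> @ Vertex w # k) \<doteq> word (map Edge \<alpha> @ Vertex w # k)"
proof (cases \<alpha>)
  case Nil
  then show ?thesis using assms Vertex_Cons[of "Vertex w" k u] by (auto simp: awalk_Nil_iff)
next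
  case (Cons e \<alpha>')
  have "set (Edge e # map Edge \<alpha>' @ Vertex w # k) \<subseteq> X"
    using assms awalk_arcs[OF assms(1)] awalk_last_in_verts[OF assms(1)] by (auto simp: Cons)
  then show ?thesis
    using assms Vertex_Cons[of "Edge e" "map Edge \<alpha>' @ Vertex w # k" u] by (auto simp: Cons awalk_Cons_iff)
qed

lemma walk_Vertex_absorb:
  assumes "awalk v \<beta> w" "set k \<subseteq> X"
  shows "word (k @ Vertex w # map Ghost (rev \<beta>) @ [Vertex v]) \<doteq> word (k @ Vertex w # map Ghost (rev \<beta>))"
proof (cases \<beta>)
  case Nil
  then show ?thesis using assms snoc_Vertex[of k "Vertex w" v] by (auto simp: awalk_Nil_iff)
next
  case (Cons e \<beta>')
  have "set (k @ Vertex w # map Ghost (rev \<beta>') @ [Ghost e]) \<subseteq> X"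
    using assms awalk_arcs[OF assms(1)] awalk_last_in_verts[OF assms(1)] by (auto simp: Cons)
  then show ?thesis
    using assms snoc_Vertex[of "k @ Vertex w # map Ghost (rev \<beta>')" "Ghost e" v]
    by (auto simp: Cons awalk_Cons_iff)
qed

lemma lsrc_nw: "awalk u \<alpha> w \<Longrightarrow> lsrc (hd (nw \<alpha> w \<beta>)) = u"
  by (cases \<alpha>) (auto simp: nw_def awalk_simps)

lemma ltgt_nw: "awalk v \<beta> w \<Longrightarrow> ltgt (last (nw \<alpha> w \<beta>)) = v"
  by (cases \<beta>) (auto simp: nw_def awalk_simps)

lemma mismatch_append:
  assumes "j @ [x] \<in> nonempty_words X" "y # k \<in> nonempty_words X" "ltgt x \<noteq> lsrc y"
  shows "word (j @ x # y # k) \<in> I"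
  using zero_word_context[OF mismatch[of x y], of j k] assms by (auto simp: nonempty_words_def)

text \<open>Prepend one letter to a word in normal form. If the endpoints match, a vertex is
  absorbed, an edge extends \<open>\<alpha>\<close>, and a ghost edge meets the first edge of
  \<open>\<alpha>\<close>, where CK1 cancels or annihilates. No step creates new edges, hence the
  bound \<open>word_arcs k\<close>.\<close>

lemma normal_form:
  assumes "k \<noteq> []" "set k \<subseteq> X"
  shows "word k \<in> I \<or> (\<exists>u v. \<exists>m \<in> normal_words (word_arcs k) u v. word k \<doteq> word m)"
  using assms
proof (induction k rule: list_nonempty_induct)
  case (single x)
  show ?case
  proof (cases x)
    case (Vertex v)
    then have "nw [] v [] \<in> normal_words (word_arcs [x]) v v"
      using single by (intro normal_wordsI) (auto simp: awalk_Nil_iff)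
    moreover have "word [x] \<doteq> word (nw [] v [])"
      using single Vertex by (auto simp: nw_def nonempty_words_def)
    ultimately show ?thesis by blast
  next
    case (Edge e)
    then have "nw [e] (head E e) [] \<in> normal_words (word_arcs [x]) (tail E e) (head E e)"
      using single arc_implies_awalk[of e]
      by (intro normal_wordsI) (auto simp: word_arcs_def awalk_Nil_iff)
    moreover have "word [x] \<doteq> word (nw [e] (head E e) [])"
      using ltgt_absorb[of x] single Edge by (simp add: nw_def cong_sym)
    ultimately show ?thesis by blast
  next
    case (Ghost e)
    then have "nw [] (head E e) [e] \<in> normal_words (word_arcs [x]) (head E e) (tail E e)"
      using single arc_implies_awalk[of e]
      by (intro normal_wordsI) (auto simp: word_arcs_def awalk_Nil_iff)
    moreover have "word [x] \<doteq> word (nw [] (head E e) [e])"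
      using lsrc_absorb[of x] single Ghost by (simp add: nw_def cong_sym)
    ultimately show ?thesis by blast
  qed
next
  case (cons x k)
  then consider "word k \<in> I" | u v m where "m \<in> normal_words (word_arcs k) u v" "word k \<doteq> word m"
    by auto
  then show ?case
  proof cases
    case 1
    then show ?thesis using zero_word_context[of k "[x]" "[]"] cons.prems by auto
  next
    case (2 u v m)
    then obtain \<alpha> w \<beta> where m: "m = nw \<alpha> w \<beta>" and \<alpha>: "awalk u \<alpha> w" and \<beta>: "awalk v \<beta> w"
      and sub: "set \<alpha> \<subseteq> word_arcs k" "set \<beta> \<subseteq> word_arcs k"
      by (auto simp: normal_words_def)
    have w: "w \<in> verts E" using awalk_last_in_verts[OF \<alpha>] .
    have arcs: "set \<alpha> \<subseteq> arcs E" "set \<beta> \<subseteq> arcs E" using awalk_arcs \<alpha> \<beta> by auto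
    have mX: "set m \<subseteq> X" "m \<noteq> []" using nw_X[OF \<alpha> \<beta>] by (auto simp: m nonempty_words_def)
    have xm: "word (x # k) \<doteq> word (x # m)"
      using cong_word_context[OF 2(2), of "[x]" "[]"] cons.prems by simp
    have zero: ?thesis if "ltgt x \<noteq> u"
    proof -
      have "word ([] @ x # hd m # tl m) \<in> I"
        using that mX cons.prems lsrc_nw[OF \<alpha>] by (intro mismatch_append) (auto simp: nonempty_words_def m)
      then show ?thesis using cong_in_I[OF xm] mX by simp
    qed
    have concl: ?thesis
      if "word (x # m) \<doteq> word (nw \<alpha>' w' \<beta>')" "awalk u' \<alpha>' w'" "awalk v' \<beta>' w'"
        "set \<alpha>' \<subseteq> word_arcs (x # k)" "set \<beta>' \<subseteq> word_arcs (x # k)" for \<alpha>' w' \<beta>' u' v'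
    proof -
      have "nw \<alpha>' w' \<beta>' \<in> normal_words (word_arcs (x # k)) u' v'"
        using that by (intro normal_wordsI)
      then show ?thesis using cong_trans[OF xm that(1)] by blast
    qed
    have sub': "set \<alpha> \<subseteq> word_arcs (x # k)" "set \<beta> \<subseteq> word_arcs (x # k)"
      using sub by (auto simp: word_arcs_def)
    show ?thesis
    proof (cases "ltgt x = u")
      case u: True
      show ?thesis
      proof (cases x)
        case (Vertex y)
        show ?thesis
          using Vertex_walk_absorb[OF \<alpha>, of "map Ghost (rev \<beta>)"] u Vertex arcs
          by (intro concl[OF _ \<alpha> \<beta> sub']) (simp add: m nw_def)
      next
        case (Edge e)
        have "word (x # m) \<doteq> word (nw (e # \<alpha>) w \<beta>)"
          using mX cons.prems by (intro iffD2[OF word_cong_words]) (auto simp: m nw_def Edge nonempty_words_def)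
        then show ?thesis
          using \<alpha> \<beta> u sub' cons.prems by (intro concl[of "e # \<alpha>" w \<beta> "tail E e" v])
            (auto simp: Edge awalk_Cons_iff word_arcs_def)
      next
        case (Ghost e)
        show ?thesis
        proof (cases \<alpha>)
          \<comment> \<open>There is no edge to cancel against, so the ghost edge joins the ghost
            part in front. As that part is the reversed \<open>\<beta>\<close>, this appends
            \<open>e\<close> at the end of \<open>\<beta>\<close>.\<close>
          case Nil
          then have uw: "u = w" using \<alpha> by (simp add: awalk_Nil_iff)
          have "word (x # m) \<doteq> word (Ghost e # map Ghost (rev \<beta>))"
            using cong_word_context[OF ltgt_absorb[of x], of "[]" "map Ghost (rev \<beta>)"] cons.prems arcs u
            by (simp add: m nw_def Nil Ghost uw)
          also have "\<dots> \<doteq> word (Vertex (head E e) # Ghost e # map Ghost (rev \<beta>))"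
            using Vertex_Cons[of "Ghost e" "map Ghost (rev \<beta>)" "head E e"] cons.prems arcs Ghost
            by (auto intro: cong_sym)
          finally have "word (x # m) \<doteq> word (nw [] (head E e) (\<beta> @ [e]))" by (simp add: nw_def)
          moreover have "awalk v (\<beta> @ [e]) (head E e)"
            using \<beta> u uw arc_implies_awalk[of e] cons.prems by (auto simp: Ghost intro: awalk_appendI)
          ultimately show ?thesis
            using sub' cons.prems by (intro concl[of "[]" "head E e" "\<beta> @ [e]" "head E e" v])
              (auto simp: Ghost awalk_Nil_iff word_arcs_def)
        next
          case (Cons f \<alpha>')
          have \<alpha>': "awalk (head E f) \<alpha>' w" "f \<in> arcs E" using \<alpha> by (auto simp: Cons awalk_Cons_iff)
          have rest: "set (nw \<alpha>' w \<beta>) \<subseteq> X" using mX by (auto simp: m nw_def Cons)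
          show ?thesis
          proof (cases "e = f")
            case True
            have "word (x # m) \<doteq> word (Vertex (head E e) # nw \<alpha>' w \<beta>)"
              using cong_word_context[OF CK1_same[of e], of "[]" "nw \<alpha>' w \<beta>"] rest \<alpha>'(2) True
              by (simp add: m nw_def Cons Ghost)
            also have "\<dots> \<doteq> word (nw \<alpha>' w \<beta>)"
              using Vertex_walk_absorb[OF \<alpha>'(1), of "map Ghost (rev \<beta>)"] arcs True by (simp add: nw_def)
            finally show ?thesis
              using \<alpha>' \<beta> sub' by (intro concl[of \<alpha>' w \<beta> "head E f" v]) (auto simp: Cons)
          next
            case False
            then have "word ([] @ [Ghost e, Edge f] @ nw \<alpha>' w \<beta>) \<in> I"
              using rest \<alpha>'(2) cons.prems by (intro zero_word_context CK1_diff) (auto simp: Ghost)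
            then show ?thesis using cong_in_I[OF xm] by (simp add: m nw_def Cons Ghost)
          qed
        qed
      qed
    qed (use zero in blast)
  qed
qed

text \<open>CK1 cancels \<open>\<alpha>\<close> against its ghost from the middle outwards, one edge
  at a time, and the vertex left behind is absorbed by the rest of the path.\<close>

lemma star_prefix:
  assumes "awalk u (\<alpha> @ \<gamma>) w"
  shows "word (map Ghost (rev \<alpha>) @ map Edge (\<alpha> @ \<gamma>) @ [Vertex w]) \<doteq> word (map Edge \<gamma> @ [Vertex w])"
  using assms
proof (induction \<alpha> arbitrary: u)
  case Nil
  then show ?case using nw_X[OF Nil[simplified], of w "[]"] awalk_last_in_verts
    by (auto intro!: cong_refl simp: nw_def awalk_Nil_iff)
next
  case (Cons e \<alpha>)
  have e: "e \<in> arcs E" and walk: "awalk (head E e) (\<alpha> @ \<gamma>) w" using Cons.prems unfolding append_Cons awalk_Cons_iff by auto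
  have X: "set \<alpha> \<subseteq> arcs E" "set \<gamma> \<subseteq> arcs E" "w \<in> verts E"
    using awalk_arcs[OF walk] awalk_last_in_verts[OF walk] by auto
  have "word (map Ghost (rev (e # \<alpha>)) @ map Edge ((e # \<alpha>) @ \<gamma>) @ [Vertex w]) \<doteq>
      word (map Ghost (rev \<alpha>) @ Vertex (head E e) # map Edge (\<alpha> @ \<gamma>) @ [Vertex w])"
    using cong_word_context[OF CK1_same[OF e], of "map Ghost (rev \<alpha>)" "map Edge (\<alpha> @ \<gamma>) @ [Vertex w]"] X
    by simp
  also have "\<dots> \<doteq> word (map Ghost (rev \<alpha>) @ map Edge (\<alpha> @ \<gamma>) @ [Vertex w])"
    using cong_word_context[OF Vertex_walk_absorb[OF walk, of "[]"], of "map Ghost (rev \<alpha>)" "[]"] X by simp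
  also have "\<dots> \<doteq> word (map Edge \<gamma> @ [Vertex w])" using Cons.IH walk by blast
  finally show ?case .
qed

text \<open>Cancelling from the middle reaches the first difference of the two paths, where CK1
  gives zero. The length condition excludes that \<open>\<alpha>'\<close> is a proper prefix of
  \<open>\<alpha>\<close>, when a ghost path would remain instead.\<close>

lemma star_zero:
  assumes "awalk u \<alpha>' w" "set \<alpha> \<subseteq> arcs E" "length \<alpha> \<le> length \<alpha>'" "\<not> prefix \<alpha> \<alpha>'"
  shows "word (map Ghost (rev \<alpha>) @ map Edge \<alpha>' @ [Vertex w]) \<in> I"
  using assms
proof (induction \<alpha> arbitrary: u \<alpha>')
  case (Cons e \<alpha>)
  then obtain f \<alpha>1 where \<alpha>': "\<alpha>' = f # \<alpha>1" by (cases \<alpha>') auto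
  have f: "f \<in> arcs E" and walk: "awalk (head E f) \<alpha>1 w" using Cons.prems by (auto simp: \<alpha>' awalk_Cons_iff)
  have X: "set \<alpha> \<subseteq> arcs E" "set \<alpha>1 \<subseteq> arcs E" "w \<in> verts E" "e \<in> arcs E"
    using awalk_arcs[OF walk] awalk_last_in_verts[OF walk] Cons.prems by auto
  show ?case
  proof (cases "e = f")
    case True
    have "word (map Ghost (rev (e # \<alpha>)) @ map Edge \<alpha>' @ [Vertex w]) \<doteq>
        word (map Ghost (rev \<alpha>) @ Vertex (head E e) # map Edge \<alpha>1 @ [Vertex w])"
      using cong_word_context[OF CK1_same[OF X(4)], of "map Ghost (rev \<alpha>)" "map Edge \<alpha>1 @ [Vertex w]"] X
      by (simp add: \<alpha>' True)
    also have "\<dots> \<doteq> word (map Ghost (rev \<alpha>) @ map Edge \<alpha>1 @ [Vertex w])"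
      using cong_word_context[OF Vertex_walk_absorb[OF walk, of "[]"], of "map Ghost (rev \<alpha>)" "[]"] X True
      by simp
    finally show ?thesis
      using cong_in_I Cons.IH[OF walk X(1)] Cons.prems by (simp add: \<alpha>' True)
  next
    case False
    then show ?thesis
      using zero_word_context[OF CK1_diff[OF X(4) f], of "map Ghost (rev \<alpha>)" "map Edge \<alpha>1 @ [Vertex w]"] X
      by (simp add: \<alpha>')
  qed
qed simp

lemma vertex_word [simp]: "[Vertex v] \<in> nonempty_words X \<longleftrightarrow> v \<in> verts E"
  by (simp add: nonempty_words_def)

lemma vertex_C: "v \<in> verts E \<Longrightarrow> word [Vertex v] \<in> C"
  by simp

section \<open>Reduction of an element outside the relation ideal to a vertex\<close>

lemma span_mod_rmult:
  assumes "p \<in> span_mod S" "b \<in> C" "\<And>k. k \<in> S \<Longrightarrow> word k * b \<in> span_mod T"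
  shows "p * b \<in> span_mod T"
proof -
  obtain q where q: "p \<doteq> q" "Poly_Mapping.keys q \<subseteq> S" using assms(1) by (auto simp: span_mod_def)
  have "1 * q * b \<in> span_mod T"
  proof (rule span_mod_linear)
    fix k assume "k \<in> Poly_Mapping.keys q"
    then show "1 * word k * b \<in> span_mod T" using q(2) assms(3)[of k] by auto
  qed
  then have "q * b \<in> span_mod T" by simp
  then show ?thesis by (rule span_mod_cong[OF cong_mult[OF q(1) cong_refl[OF assms(2)]]])
qed

text \<open>The finitely many vertices at the right ends of the words of \<open>p\<close> add up to
  a right local unit \<open>s\<close>, so \<open>p\<close> cannot be killed by all of them.\<close>

lemma right_vertex:
  assumes p: "p \<in> C" "p \<notin> I"
  obtains w where "w \<in> verts E" "p * word [Vertex w] \<notin> I"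
proof (rule ccontr)
  assume no: "\<not> thesis"
  note witness = that
  have zero: "p * word [Vertex w] \<in> I" if "w \<in> verts E" for w using no witness that by blast
  define tgt where "tgt k = ltgt (last k)" for k
  define W where "W = tgt ` Poly_Mapping.keys p"
  define s :: "('v, 'e) lpa_symbol list \<Rightarrow>\<^sub>0 'k" where "s = (\<Sum>w \<in> W. word [Vertex w])"
  have keys: "k \<noteq> [] \<and> set k \<subseteq> X" if "k \<in> Poly_Mapping.keys p" for k
    using p(1) that unfolding free_algebra_carrier nonempty_words_def by blast
  then have tgt: "tgt k \<in> verts E" if "k \<in> Poly_Mapping.keys p" for k
    using that unfolding tgt_def by (meson last_in_set lsrc_ltgt_verts(2) subsetD)
  then have W: "W \<subseteq> verts E" "finite W" by (auto simp: W_def)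
  \<comment> \<open>The element \<open>s - 1\<close> exists only in the ambient unital algebra. It
    expresses that \<open>p * s\<close> and \<open>p\<close> agree modulo \<open>I\<close> by a
    product that can be checked word by word.\<close>
  have "1 * p * (s - 1) \<in> I"
  proof (rule in_I_linear)
    fix k assume k: "k \<in> Poly_Mapping.keys p"
    obtain j x where jx: "k = j @ [x]" using keys[OF k] by (metis append_butlast_last_id)
    have X: "set j \<subseteq> X" "x \<in> X" using keys[OF k] by (auto simp: jx)
    have kW: "tgt k \<in> W" using k by (simp add: W_def)
    have "1 * word k * (s - 1) = (\<Sum>w \<in> W. word (k @ [Vertex w])) - word k"
      by (simp add: s_def right_diff_distrib sum_distrib_left word_mult)
    also have "\<dots> = (word (k @ [Vertex (tgt k)]) - word k) + (\<Sum>w \<in> W - {tgt k}. word (k @ [Vertex w]))"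
      using W(2) kW by (simp add: sum.remove[of W "tgt k"])
    also have "\<dots> \<in> I"
    proof (intro I_add I_sum)
      show "word (k @ [Vertex (tgt k)]) - word k \<in> I"
        using snoc_Vertex[of j x "tgt k"] X by (simp add: jx tgt_def cong_def)
      fix w assume "w \<in> W - {tgt k}"
      then show "word (k @ [Vertex w]) \<in> I"
        using zero_word_context[OF mismatch[of x "Vertex w"], of j "[]"] X W by (auto simp: jx tgt_def)
    qed
    finally show "1 * word k * (s - 1) \<in> I" .
  qed
  moreover have "p * s \<in> I" unfolding s_def sum_distrib_left using zero W by (intro I_sum) auto
  ultimately have "p * s - 1 * p * (s - 1) \<in> I" by (intro I_diff)
  then show False using p by (simp add: right_diff_distrib)
qed

text \<open>The bound on the ghost part is the induction measure of the reduction. The path part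
  stays unbounded, since right multiplication by an edge may lengthen it.\<close>

definition bounded_words :: "nat \<Rightarrow> ('v, 'e) lpa_symbol list set" where
  "bounded_words n = {nw \<alpha> w \<beta> |\<alpha> w \<beta>. (\<exists>u v. awalk u \<alpha> w \<and> awalk v \<beta> w) \<and> length \<beta> \<le> n}"

lemma bounded_wordsI:
  "awalk u \<alpha> w \<Longrightarrow> awalk v \<beta> w \<Longrightarrow> length \<beta> \<le> n \<Longrightarrow> nw \<alpha> w \<beta> \<in> bounded_words n"
  unfolding bounded_words_def by blast

definition path_words :: "'v \<Rightarrow> ('v, 'e) lpa_symbol list set" where
  "path_words w = {map Edge \<alpha> @ [Vertex w] |\<alpha>. \<exists>u. awalk u \<alpha> w}"

lemma path_words_X: "k \<in> path_words w \<Longrightarrow> k \<in> nonempty_words X"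
  using awalk_arcs awalk_last_in_verts by (fastforce simp: path_words_def nonempty_words_def)

lemma span_bounded_words:
  assumes "p \<in> C"
  obtains n where "p \<in> span_mod (bounded_words n)"
proof -
  define S where "S = (\<Union>F u v. normal_words F u v)"
  have "1 * p * 1 \<in> span_mod S"
  proof (rule span_mod_linear)
    fix k assume "k \<in> Poly_Mapping.keys p"
    then have "k \<noteq> []" "set k \<subseteq> X" using assms unfolding free_algebra_carrier nonempty_words_def by auto
    then consider "word k \<in> I" | u v m where "m \<in> normal_words (word_arcs k) u v" "word k \<doteq> word m"
      using normal_form by blast
    then show "1 * word k * 1 \<in> span_mod S"
    proof cases
      case 2
      then have "m \<in> S" "m \<in> nonempty_words X" by (auto simp: S_def word_cong_words)
      then show ?thesis using span_mod_cong[OF 2(2) span_mod_word[of m S]] by simp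
    qed (simp add: span_mod_I)
  qed
  then obtain q where q: "p \<doteq> q" "Poly_Mapping.keys q \<subseteq> S" by (auto simp: span_mod_def)
  obtain n where n: "\<And>k. k \<in> Poly_Mapping.keys q \<Longrightarrow> length k \<le> n"
    using finite_nat_set_iff_bounded_le[of "length ` Poly_Mapping.keys q"] by auto
  have "Poly_Mapping.keys q \<subseteq> bounded_words n"
  proof
    fix k assume k: "k \<in> Poly_Mapping.keys q"
    then obtain \<alpha> w \<beta> u v where "k = nw \<alpha> w \<beta>" "awalk u \<alpha> w" "awalk v \<beta> w"
      using q(2) unfolding S_def normal_words_def by blast
    moreover from this have "length \<beta> \<le> n" using n[OF k] by (simp add: nw_def)
    ultimately show "k \<in> bounded_words n" using bounded_wordsI by blast
  qed
  then show thesis using that q by (auto simp: span_mod_def)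
qed

text \<open>Right multiplication by an edge shortens the ghost parts, and CK2 keeps some product nonzero.\<close>

lemma reduce_to_paths:
  assumes "p \<in> span_mod (bounded_words n)" "p \<notin> I"
  shows "\<exists>b \<in> C. \<exists>w \<in> verts E. p * b \<notin> I \<and> p * b \<in> span_mod (path_words w)"
proof -
  \<comment> \<open>Multiplying by the vertex \<open>w\<close> ends the reduction once no ghost
    edges remain or \<open>w\<close> is a sink: a word with nonempty ghost part that ends at
    \<open>w\<close> would need an edge leaving \<open>w\<close>.\<close>
  have stop: "\<exists>b \<in> C. \<exists>w \<in> verts E. p * b \<notin> I \<and> p * b \<in> span_mod (path_words w)"
    if p: "p \<in> span_mod (bounded_words n)" and w: "w \<in> verts E" and pw: "p * word [Vertex w] \<notin> I"
      and stop: "n = 0 \<or> out_arcs E w = {}" for p n w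
  proof (intro bexI conjI)
    show "p * word [Vertex w] \<in> span_mod (path_words w)"
    proof (rule span_mod_rmult[OF p vertex_C[OF w]])
      fix k assume "k \<in> bounded_words n"
      then obtain \<alpha> x \<beta> u v where k: "k = nw \<alpha> x \<beta>" and \<alpha>: "awalk u \<alpha> x" and \<beta>: "awalk v \<beta> x"
        and len: "length \<beta> \<le> n"
        by (auto simp: bounded_words_def)
      show "word k * word [Vertex w] \<in> span_mod (path_words w)"
      proof (cases "\<beta> = [] \<and> x = w")
        case True
        have X: "set (map Edge \<alpha> @ [Vertex w]) \<subseteq> X" using awalk_arcs[OF \<alpha>] w by simp
        have "word k * word [Vertex w] \<doteq> word (map Edge \<alpha> @ [Vertex w])"
          using snoc_Vertex[OF X] True by (simp add: k nw_def word_mult)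
        moreover have mem: "map Edge \<alpha> @ [Vertex w] \<in> path_words w"
          using \<alpha> True by (auto simp: path_words_def)
        ultimately show ?thesis using span_mod_cong span_mod_word[OF mem path_words_X[OF mem]] by blast
      next
        case False
        have "v \<noteq> w"
        proof
          assume vw: "v = w"
          with False \<beta> have ne: "\<beta> \<noteq> []" by (auto simp: awalk_Nil_iff)
          then obtain f \<beta>' where "\<beta> = f # \<beta>'" by (cases \<beta>) auto
          then have "f \<in> out_arcs E w" using \<beta> vw by (auto simp: awalk_Cons_iff)
          then show False using stop len ne by auto
        qed
        have kX: "k \<in> nonempty_words X" using nw_X[OF \<alpha> \<beta>] by (simp add: k)
        then obtain j y where jy: "k = j @ [y]"
          unfolding nonempty_words_def by (cases k rule: rev_cases) auto
        have "ltgt y = v" using ltgt_nw[OF \<beta>, of \<alpha>] by (simp add: k[symmetric] jy)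
        then have "word (j @ y # Vertex w # []) \<in> I"
          using w \<open>v \<noteq> w\<close> kX by (intro mismatch_append) (auto simp: jy nonempty_words_def)
        then have "word k * word [Vertex w] \<in> I" by (simp add: jy word_mult)
        then show ?thesis by (rule span_mod_I)
      qed
    qed
  qed (use w pw in simp_all)
  show ?thesis
    using assms
  proof (induction n arbitrary: p)
    case (0 p)
    obtain w where "w \<in> verts E" "p * word [Vertex w] \<notin> I"
      by (rule right_vertex[OF span_mod_C[OF 0(1)] 0(2)])
    then show ?case using stop 0 by blast
  next
    case (Suc n p)
    have pC: "p \<in> C" using Suc.prems span_mod_C by blast
    obtain w where w: "w \<in> verts E" and pw: "p * word [Vertex w] \<notin> I"
      by (rule right_vertex[OF pC Suc.prems(2)])
    show ?case
    proof (cases "out_arcs E w = {}")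
      case True
      then show ?thesis using stop Suc.prems(1) w pw by blast
    next
      case False
      have "\<exists>e \<in> out_arcs E w. p * word [Edge e] \<notin> I"
      proof (rule ccontr)
        assume *: "\<not> ?thesis"
        have "p * word [Vertex w] \<doteq> p * (\<Sum>e \<in> out_arcs E w. word [Edge e, Ghost e])"
          by (rule cong_mult[OF cong_refl[OF pC] CK2_cong[OF w False]])
        also have "\<dots> = (\<Sum>e \<in> out_arcs E w. p * word [Edge e] * word [Ghost e])"
          by (simp add: sum_distrib_left mult.assoc word_mult)
        finally have "p * word [Vertex w] \<doteq> (\<Sum>e \<in> out_arcs E w. p * word [Edge e] * word [Ghost e])" .
        moreover have "(\<Sum>e \<in> out_arcs E w. p * word [Edge e] * word [Ghost e]) \<in> I"
        proof (rule I_sum)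
          fix e assume e: "e \<in> out_arcs E w"
          then show "p * word [Edge e] * word [Ghost e] \<in> I"
            using * by (intro I_rmult[of "p * word [Edge e]"]) (auto simp: nonempty_words_def)
        qed
        ultimately show False using pw cong_in_I by blast
      qed
      then obtain e where e: "e \<in> arcs E" "tail E e = w" and pe: "p * word [Edge e] \<notin> I" by auto
      have eC: "word [Edge e] \<in> C" using e by (simp add: nonempty_words_def)
      \<comment> \<open>A word without ghost part is extended by \<open>e\<close> or vanishes, and
        so stays within the bound; any other word loses its last ghost edge or vanishes.\<close>
      have "p * word [Edge e] \<in> span_mod (bounded_words n)"
      proof (rule span_mod_rmult[OF Suc.prems(1) eC])
        fix k assume "k \<in> bounded_words (Suc n)"
        then obtain \<alpha> x \<beta> u v where k: "k = nw \<alpha> x \<beta>" and \<alpha>: "awalk u \<alpha> x" and \<beta>: "awalk v \<beta> x"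
          and len: "length \<beta> \<le> Suc n"
          by (auto simp: bounded_words_def)
        have X: "set \<alpha> \<subseteq> arcs E" "set \<beta> \<subseteq> arcs E" "x \<in> verts E"
          using awalk_arcs \<alpha> \<beta> awalk_last_in_verts[OF \<alpha>] by auto
        show "word k * word [Edge e] \<in> span_mod (bounded_words n)"
        proof (cases \<beta>)
          case Nil
          show ?thesis
          proof (cases "x = tail E e")
            case True
            have "word k * word [Edge e] \<doteq> word (map Edge \<alpha> @ [Edge e])"
              using cong_word_context[OF lsrc_absorb[of "Edge e"], of "map Edge \<alpha>" "[]"] e X
              by (simp add: k nw_def Nil word_mult True)
            also have "\<dots> \<doteq> word (nw (\<alpha> @ [e]) (head E e) [])"
              using snoc_Vertex[of "map Edge \<alpha>" "Edge e" "head E e"] e X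
              by (auto simp: nw_def intro: cong_sym)
            finally have eq: "word k * word [Edge e] \<doteq> word (nw (\<alpha> @ [e]) (head E e) [])" .
            have walk: "awalk u (\<alpha> @ [e]) (head E e)"
              using awalk_appendI[OF \<alpha>] arc_implies_awalk[OF e(1)] by (simp add: True)
            moreover have "awalk (head E e) [] (head E e)" using e by (simp add: awalk_Nil_iff)
            ultimately have "word (nw (\<alpha> @ [e]) (head E e) []) \<in> span_mod (bounded_words n)"
              by (intro span_mod_word bounded_wordsI nw_X) simp_all
            then show ?thesis by (rule span_mod_cong[OF eq])
          next
            case False
            then have "word (map Edge \<alpha> @ Vertex x # Edge e # []) \<in> I"
              using X e by (intro mismatch_append) (auto simp: nonempty_words_def)
            then show ?thesis by (simp add: k nw_def Nil word_mult span_mod_I)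
          qed
        next
          case (Cons f \<beta>')
          have f: "f \<in> arcs E" "awalk (head E f) \<beta>' x" using \<beta> by (auto simp: Cons awalk_Cons_iff)
          have kX: "set (nw \<alpha> x \<beta>') \<subseteq> X" using X by (auto simp: nw_def Cons)
          have eq: "word k * word [Edge e] = word (nw \<alpha> x \<beta>' @ [Ghost f, Edge e] @ [])"
            by (simp add: k nw_def Cons word_mult)
          show ?thesis
          proof (cases "f = e")
            case True
            have "word k * word [Edge e] \<doteq> word (nw \<alpha> x \<beta>' @ [Vertex (head E e)])"
              using cong_word_context[OF CK1_same[OF e(1)] kX, of "[]"] unfolding eq True by simp
            also have "\<dots> \<doteq> word (nw \<alpha> x \<beta>')"
              using walk_Vertex_absorb[OF f(2), of "map Edge \<alpha>"] X by (simp add: nw_def True)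
            finally have eq: "word k * word [Edge e] \<doteq> word (nw \<alpha> x \<beta>')" .
            have "word (nw \<alpha> x \<beta>') \<in> span_mod (bounded_words n)"
              using len by (intro span_mod_word bounded_wordsI[OF \<alpha> f(2)] nw_X[OF \<alpha> f(2)]) (simp add: Cons)
            then show ?thesis by (rule span_mod_cong[OF eq])
          next
            case False
            then show ?thesis
              unfolding eq using f(1) e(1) kX
              by (intro span_mod_I zero_word_context CK1_diff) auto
          qed
        qed
      qed
      then obtain b w' where "b \<in> C" "w' \<in> verts E" "p * word [Edge e] * b \<notin> I"
        "p * word [Edge e] * b \<in> span_mod (path_words w')"
        using Suc.IH pe by blast
      then show ?thesis using eC by (intro bexI[of _ "word [Edge e] * b"] bexI[of _ w']) (auto simp: mult.assoc)
    qed
  qed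
qed

definition closed_words :: "'v \<Rightarrow> ('v, 'e) lpa_symbol list set" where
  "closed_words w = {map Edge \<gamma> @ [Vertex w] |\<gamma>. \<gamma> \<noteq> [] \<and> awalk w \<gamma> w}"

lemma closed_words_X: "k \<in> closed_words w \<Longrightarrow> k \<in> nonempty_words X"
  using path_words_X[of k w] by (auto simp: closed_words_def path_words_def)

text \<open>Divide by a shortest path occurring in \<open>q\<close>.\<close>

lemma reduce_to_closed:
  assumes keys: "Poly_Mapping.keys q \<subseteq> path_words w" and q: "q \<notin> I" and w: "w \<in> verts E"
  obtains a r where "a \<in> C" "a * q \<doteq> word [Vertex w] + r" "Poly_Mapping.keys r \<subseteq> closed_words w"
proof -
  have "q \<noteq> 0" using q I_zero by blast
  then have "Poly_Mapping.keys q \<noteq> {}" by simp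
  then obtain k where k: "k \<in> Poly_Mapping.keys q"
    and least: "\<And>k'. k' \<in> Poly_Mapping.keys q \<Longrightarrow> length k \<le> length k'"
    using arg_min_if_finite[of "Poly_Mapping.keys q" length] by (metis finite_keys linorder_not_le)
  obtain \<alpha> u where k\<alpha>: "k = map Edge \<alpha> @ [Vertex w]" and \<alpha>: "awalk u \<alpha> w"
    using keys k by (auto simp: path_words_def)
  define c where "c = Poly_Mapping.lookup q k"
  have c: "c \<noteq> 0" using k by (simp add: c_def in_keys_iff)
  define q' where "q' = q - Poly_Mapping.single k c"
  have keys': "Poly_Mapping.keys q' = Poly_Mapping.keys q - {k}"
    using c by (auto simp: q'_def in_keys_iff lookup_minus lookup_single when_def c_def split: if_splits)
  \<comment> \<open>The leading \<open>Vertex w\<close> keeps \<open>g\<close> inside the nonunital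
    algebra when \<open>\<alpha>\<close> is empty. In that case it also kills the other walks of
    \<open>q\<close> that do not start at \<open>w\<close>.\<close>
  define g where "g = (word (Vertex w # map Ghost (rev \<alpha>)) :: ('v, 'e) lpa_symbol list \<Rightarrow>\<^sub>0 'k)"
  have gX: "set (Vertex w # map Ghost (rev \<alpha>)) \<subseteq> X" using awalk_arcs[OF \<alpha>] w by simp
  have gC: "g \<in> C" using gX by (simp add: g_def nonempty_words_def)
  have gk: "g * word k \<doteq> word [Vertex w]"
  proof -
    have "g * word k \<doteq> word (Vertex w # [Vertex w])"
      using cong_word_context[OF star_prefix[of u \<alpha> "[]" w], of "[Vertex w]" "[]"] \<alpha> w
      by (simp add: g_def k\<alpha> word_mult)
    also have "\<dots> \<doteq> word [Vertex w]" using vertex_idem[OF w] .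
    finally show ?thesis .
  qed
  have "g * q' * 1 \<in> span_mod (closed_words w)"
  proof (rule span_mod_linear)
    fix k' assume k': "k' \<in> Poly_Mapping.keys q'"
    then obtain \<alpha>' u' where k\<alpha>': "k' = map Edge \<alpha>' @ [Vertex w]" and \<alpha>': "awalk u' \<alpha>' w"
      using keys keys' by (auto simp: path_words_def)
    \<comment> \<open>The choice of a shortest path provides the length condition of
      \<open>star_zero\<close>.\<close>
    have len: "length \<alpha> \<le> length \<alpha>'" using least[of k'] k' keys' by (simp add: k\<alpha> k\<alpha>')
    have ne: "\<alpha> \<noteq> \<alpha>'" using k' keys' by (auto simp: k\<alpha> k\<alpha>')
    have eq: "g * word k' = word ([Vertex w] @ (map Ghost (rev \<alpha>) @ map Edge \<alpha>' @ [Vertex w]) @ [])"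
      by (simp add: g_def k\<alpha>' word_mult)
    show "g * word k' * 1 \<in> span_mod (closed_words w)"
    proof (cases "prefix \<alpha> \<alpha>'")
      case False
      then show ?thesis
        unfolding mult_1_right eq using w awalk_arcs[OF \<alpha>] len
        by (intro span_mod_I zero_word_context star_zero[OF \<alpha>']) auto
    next
      case True
      then obtain \<gamma> where \<gamma>: "\<alpha>' = \<alpha> @ \<gamma>" by (auto simp: prefix_def)
      then obtain h \<gamma>' where h: "\<gamma> = h # \<gamma>'" using ne by (cases \<gamma>) auto
      have \<gamma>w: "awalk (tail E h) \<gamma> w" using \<alpha>' by (auto simp: \<gamma> h awalk_Cons_iff)
      have X: "set (map Edge \<gamma> @ [Vertex w]) \<subseteq> X" using awalk_arcs[OF \<gamma>w] w by simp
      have "g * word k' \<doteq> word ([Vertex w] @ (map Edge \<gamma> @ [Vertex w]) @ [])"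
        unfolding eq using w star_prefix[of u' \<alpha> \<gamma> w] \<alpha>' by (intro cong_word_context) (simp_all add: \<gamma>)
      then have eq': "g * word k' \<doteq> word (Vertex w # map Edge \<gamma> @ [Vertex w])" by simp
      show ?thesis
      proof (cases "tail E h = w")
        case True
        have "word (Vertex w # map Edge \<gamma> @ [Vertex w]) \<doteq> word (map Edge \<gamma> @ [Vertex w])"
          using Vertex_walk_absorb[of w \<gamma> w "[]"] \<gamma>w True by simp
        then have eq: "g * word k' \<doteq> word (map Edge \<gamma> @ [Vertex w])" using eq' cong_trans by blast
        have "map Edge \<gamma> @ [Vertex w] \<in> closed_words w"
          unfolding closed_words_def using \<gamma>w True h by blast
        then show ?thesis
          using span_mod_cong[OF eq span_mod_word[OF _ closed_words_X]] by simp
      next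
        case False
        then have "word ([] @ Vertex w # Edge h # map Edge \<gamma>' @ [Vertex w]) \<in> I"
          using w X by (intro mismatch_append) (auto simp: nonempty_words_def h)
        then show ?thesis using eq' cong_in_I by (auto simp: h intro: span_mod_I)
      qed
    qed
  qed
  then obtain r where r: "g * q' \<doteq> r" "Poly_Mapping.keys r \<subseteq> closed_words w"
    by (auto simp: span_mod_def)
  have "scalar (1 / c) * g * q = scalar (1 / c) * (g * (scalar c * word k)) + scalar (1 / c) * (g * q')"
    unfolding q'_def single_conv[of k c, symmetric] by (simp only: right_diff_distrib mult.assoc) simp
  also have "scalar (1 / c) * (g * (scalar c * word k)) = g * word k"
    unfolding scalar_left_commute[of g c] scalar_mult using c by simp
  finally have "scalar (1 / c) * g * q \<doteq> word [Vertex w] + scalar (1 / c) * r"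
    using cong_add[OF gk cong_scalar[OF r(1)]] by simp
  then show thesis
    using that[of "scalar (1 / c) * g" "scalar (1 / c) * r"] gC r(2) keys_scalar_mult[of "1 / c" r]
    by auto
qed

text \<open>Simplicity only needs that \<open>a * p * b\<close> stays in a two-sided ideal. Pure
  infiniteness uses both factors explicitly, to carry an infinite idempotent from the vertex back
  into the right ideal of \<open>p\<close>.\<close>

theorem reduction:
  assumes exits: "\<And>\<mu>. graph_cycle E \<mu> \<Longrightarrow> \<exists>e. is_exit E \<mu> e"
    and p: "p \<in> C" "p \<notin> I"
  obtains a b u where "a \<in> C" "b \<in> C" "u \<in> verts E" "a * p * b \<doteq> word [Vertex u]"
proof -
  obtain n where "p \<in> span_mod (bounded_words n)" using span_bounded_words p by blast
  then obtain b w where b: "b \<in> C" and w: "w \<in> verts E" and pb: "p * b \<notin> I"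
    and "p * b \<in> span_mod (path_words w)"
    using reduce_to_paths p by blast
  then obtain q where q: "p * b \<doteq> q" "Poly_Mapping.keys q \<subseteq> path_words w"
    by (auto simp: span_mod_def)
  obtain a r where a: "a \<in> C" and aq: "a * q \<doteq> word [Vertex w] + r"
    and r: "Poly_Mapping.keys r \<subseteq> closed_words w"
    using reduce_to_closed[OF q(2) _ w] pb cong_in_I[OF q(1)] by blast
  define \<Gamma> where "\<Gamma> = {\<gamma>. map Edge \<gamma> @ [Vertex w] \<in> Poly_Mapping.keys r}"
  have "\<Gamma> = (\<lambda>\<gamma>. map Edge \<gamma> @ [Vertex w]) -` Poly_Mapping.keys r" by (auto simp: \<Gamma>_def)
  then have "finite \<Gamma>" by (auto intro!: finite_vimageI injI simp: inj_map_eq_map inj_def)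
  moreover have \<Gamma>: "awalk w \<gamma> w \<and> \<gamma> \<noteq> []" if "\<gamma> \<in> \<Gamma>" for \<gamma>
    using that r by (auto simp: \<Gamma>_def closed_words_def inj_map_eq_map inj_def)
  ultimately obtain \<delta> u where \<delta>: "awalk w \<delta> u" and aper: "\<And>\<gamma>. \<gamma> \<in> \<Gamma> \<Longrightarrow> \<not> prefix \<delta> (\<gamma> @ \<delta>)"
    using aperiodic_walk[OF exits w] by blast
  have u: "u \<in> verts E" and X: "set \<delta> \<subseteq> arcs E" using \<delta> awalk_last_in_verts awalk_arcs by auto
  define D where "D = (word (map Edge \<delta> @ [Vertex u]) :: ('v, 'e) lpa_symbol list \<Rightarrow>\<^sub>0 'k)"
  define D' where "D' = (word (Vertex u # map Ghost (rev \<delta>)) :: ('v, 'e) lpa_symbol list \<Rightarrow>\<^sub>0 'k)"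
  have D: "D \<in> C" "D' \<in> C" using u X by (auto simp: D_def D'_def nonempty_words_def)
  have wD: "word [Vertex w] * D \<doteq> D"
    using Vertex_walk_absorb[OF \<delta>, of "[]"] by (simp add: D_def word_mult)
  have "D' * (word [Vertex w] * D) \<doteq> D' * D" using cong_mult[OF cong_refl[OF D(2)] wD] .
  also have "D' * D \<doteq> word (Vertex u # [Vertex u])"
    using cong_word_context[OF star_prefix[of w \<delta> "[]" u], of "[Vertex u]" "[]"] \<delta> u
    by (simp add: D_def D'_def word_mult)
  also have "\<dots> \<doteq> word [Vertex u]" using vertex_idem[OF u] .
  finally have main: "D' * (word [Vertex w] * D) \<doteq> word [Vertex u]" .
  \<comment> \<open>Each term becomes \<open>\<delta>^* \<gamma> \<delta>\<close> between vertices.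
    It vanishes because \<open>\<delta>\<close> is no longer than \<open>\<gamma> @ \<delta>\<close>
    and is not a prefix of it.\<close>
  have rest: "D' * r * D \<in> I"
  proof (rule in_I_linear)
    fix k assume k: "k \<in> Poly_Mapping.keys r"
    then obtain \<gamma> where k\<gamma>: "k = map Edge \<gamma> @ [Vertex w]" "\<gamma> \<in> \<Gamma>"
      using r by (auto simp: \<Gamma>_def closed_words_def)
    have \<gamma>: "awalk w \<gamma> w" "set \<gamma> \<subseteq> arcs E" using \<Gamma>[OF k\<gamma>(2)] awalk_arcs by auto
    have walk: "awalk w (\<gamma> @ \<delta>) u" using awalk_appendI[OF \<gamma>(1) \<delta>] .
    have "D' * word k * D = word (([Vertex u] @ map Ghost (rev \<delta>) @ map Edge \<gamma>) @ (Vertex w # map Edge \<delta> @ [Vertex u]) @ [])"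
      by (simp add: D_def D'_def k\<gamma>(1) word_mult)
    also have "\<dots> \<doteq> word (([Vertex u] @ map Ghost (rev \<delta>) @ map Edge \<gamma>) @ (map Edge \<delta> @ [Vertex u]) @ [])"
      using Vertex_walk_absorb[OF \<delta>, of "[]"] X u \<gamma> by (intro cong_word_context) auto
    finally have "D' * word k * D \<doteq> word ([Vertex u] @ (map Ghost (rev \<delta>) @ map Edge (\<gamma> @ \<delta>) @ [Vertex u]) @ [])"
      by simp
    moreover have "word ([Vertex u] @ (map Ghost (rev \<delta>) @ map Edge (\<gamma> @ \<delta>) @ [Vertex u]) @ []) \<in> I"
      using aper[OF k\<gamma>(2)] X u by (intro zero_word_context star_zero[OF walk]) auto
    ultimately show "D' * word k * D \<in> I" using cong_in_I by blast
  qed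
  have "(D' * a) * p * (b * D) = D' * (a * (p * b)) * D" by (simp add: mult.assoc)
  also have "\<dots> \<doteq> D' * (word [Vertex w] + r) * D"
    using cong_trans[OF cong_mult[OF cong_refl[OF a] q(1)] aq] D by (intro cong_mult cong_refl)
  also have "\<dots> = D' * (word [Vertex w] * D) + D' * r * D" by (simp add: algebra_simps)
  also have "\<dots> \<doteq> word [Vertex u] + 0" using cong_add[OF main] rest cong_zero_iff by blast
  finally have "(D' * a) * p * (b * D) \<doteq> word [Vertex u]" by simp
  then show thesis using that[of "D' * a" "b * D" u] a b D u by auto
qed

end

section \<open>Representations on residue classes\<close>

context leavitt
begin

text \<open>The edges leaving \<open>v\<close> in the graph with \<open>H\<close> removed. If
  \<open>H\<close> is saturated, a vertex outside \<open>H\<close> that emits edges keeps at least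
  one of them.\<close>

definition kept_arcs :: "'v set \<Rightarrow> 'v \<Rightarrow> 'e set" where
  "kept_arcs H v = {e \<in> out_arcs E v. head E e \<notin> H}"

definition arc_index :: "'v set \<Rightarrow> 'v \<Rightarrow> 'e \<Rightarrow> nat" where
  "arc_index H v = (SOME h. bij_betw h (kept_arcs H v) {0..<card (kept_arcs H v)})"

text \<open>
  The graph with \<open>H\<close> removed acts on copies of \<open>nat \<times> int\<close>, one for each vertex outside \<open>H\<close>: if \<open>v\<close> emits
  \<open>n\<close> edges, the edge with index \<open>i\<close> matches the residue class \<open>i mod n\<close> at \<open>v\<close> with all of \<open>nat\<close> at
  its range. The integer coordinate records degrees and is shifted by \<open>d\<close> along each edge.
\<close>

definition graph_act ::
    "'v set \<Rightarrow> int \<Rightarrow> ('v, 'e) lpa_symbol \<Rightarrow> 'v \<times> nat \<times> int \<Rightarrow> ('v \<times> nat \<times> int) option" where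
  "graph_act H d x = (\<lambda>(v, k, m). case x of
     Vertex u \<Rightarrow> if u = v \<and> v \<notin> H then Some (v, k, m) else None
   | Edge e \<Rightarrow>
       if v = tail E e \<and> head E e \<notin> H \<and> k mod card (kept_arcs H v) = arc_index H v e
       then Some (head E e, k div card (kept_arcs H v), m - d) else None
   | Ghost e \<Rightarrow>
       if v = head E e \<and> v \<notin> H
       then Some (tail E e, card (kept_arcs H (tail E e)) * k + arc_index H (tail E e) e, m + d)
       else None)"

lemma kept_arcs_finite: "v \<in> verts E \<Longrightarrow> finite (kept_arcs H v)"
  using row_finite by (intro finite_subset[of "kept_arcs H v" "out_arcs E v"])
    (auto simp: row_finite_def kept_arcs_def)

lemma arc_index_bij:
  assumes "v \<in> verts E"
  shows "bij_betw (arc_index H v) (kept_arcs H v) {0..<card (kept_arcs H v)}"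
  unfolding arc_index_def using ex_bij_betw_finite_nat[OF kept_arcs_finite[OF assms]] by (rule someI_ex)

lemma arc_index_less:
  assumes "e \<in> arcs E" "head E e \<notin> H"
  shows "arc_index H (tail E e) e < card (kept_arcs H (tail E e))"
  using bij_betw_apply[OF arc_index_bij[of "tail E e" H], of e] assms by (auto simp: kept_arcs_def)

lemma arc_index_inj:
  assumes "e \<in> arcs E" "f \<in> arcs E" "tail E e = tail E f" "head E e \<notin> H" "head E f \<notin> H"
    and "arc_index H (tail E f) e = arc_index H (tail E f) f"
  shows "e = f"
  using inj_onD[OF bij_betw_imp_inj_on[OF arc_index_bij[of "tail E f" H]] assms(6)] assms
  by (auto simp: kept_arcs_def)

lemma hereditary_arc:
  assumes "hereditary E H" "e \<in> arcs E" "tail E e \<in> H"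
  shows "head E e \<in> H"
proof -
  have "path_le E (tail E e) (head E e)"
    unfolding path_le_def using arc_implies_awalk[OF assms(2)] by blast
  then show ?thesis using assms by (auto simp: hereditary_def)
qed

text \<open>Heredity makes an edge with source in \<open>H\<close> act as zero, in accordance with
  its source vertex. Saturation gives CK2: a vertex outside \<open>H\<close> that emits edges keeps
  one, so the residue classes cover \<open>nat\<close>. The shift \<open>d\<close> is arbitrary
  because all relations are homogeneous.\<close>

lemma relations_annihilate:
  assumes H: "hereditary E H" "saturated E H"
  shows "I \<subseteq> annihilator X (graph_act H d)"
proof (rule gen_algebra_ideal_least[OF annihilator_algebra_ideal])
  show "lpa_relations E \<subseteq> (annihilator X (graph_act H d) :: (('v, 'e) lpa_symbol list \<Rightarrow>\<^sub>0 'k) set)"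
  proof
    fix f :: "('v, 'e) lpa_symbol list \<Rightarrow>\<^sub>0 'k"
    assume f: "f \<in> lpa_relations E"
    have "pullback (graph_act H d) f g (u, k, m) = 0" for g u k m
      using f
    proof cases
      case (vertex_vertex v w)
      then show ?thesis
        by (auto simp: gen_def word_mult pullback_diff word_pullback_def graph_act_def)
    next
      case (edge_range e)
      then show ?thesis
        by (auto simp: gen_def word_mult pullback_diff word_pullback_def graph_act_def)
    next
      case (source_edge e)
      then show ?thesis
        using hereditary_arc[OF H(1), of e]
        by (auto simp: gen_def word_mult pullback_diff word_pullback_def graph_act_def)
    next
      case (ghost_source e)
      then show ?thesis
        using hereditary_arc[OF H(1), of e]
        by (auto simp: gen_def word_mult pullback_diff word_pullback_def graph_act_def)
    next
      case (range_ghost e)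
      then show ?thesis
        by (auto simp: gen_def word_mult pullback_diff word_pullback_def graph_act_def)
    next
      case (CK1 e e')
      then show ?thesis
        using arc_index_less[of e H] arc_index_inj[of e e' H]
        by (cases "e = e'"; cases "head E e \<in> H")
          (auto simp: gen_def word_mult pullback_diff word_pullback_def graph_act_def simp del: mult_eq_0_iff)
    next
      case (CK2 v)
      \<comment> \<open>The product \<open>e e^*\<close> acts as the projection onto the residue
        class of \<open>e\<close>.\<close>
      have red: "word_pullback (graph_act H d) [Edge e, Ghost e] g (u, k, m) =
          (if u = v \<and> e \<in> kept_arcs H v \<and> k mod card (kept_arcs H v) = arc_index H v e
           then g (u, k, m) else 0)" if "e \<in> out_arcs E v" for e
      proof -
        have mem: "e \<in> kept_arcs H v \<longleftrightarrow> head E e \<notin> H" "tail E e = v" using that by (auto simp: kept_arcs_def)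
        have "card (kept_arcs H v) * (k div card (kept_arcs H v)) + arc_index H v e = k"
          if "k mod card (kept_arcs H v) = arc_index H v e"
          using mult_div_mod_eq[of "card (kept_arcs H v)" k] that by simp
        then show ?thesis by (auto simp: word_pullback_def graph_act_def mem)
      qed
      have sum: "(\<Sum>e \<in> out_arcs E v. word_pullback (graph_act H d) [Edge e, Ghost e] g (u, k, m)) =
          word_pullback (graph_act H d) [Vertex v] g (u, k, m)"
      proof (cases "u = v \<and> v \<notin> H")
        case True
        have ne: "kept_arcs H v \<noteq> {}"
          using H(2) CK2 True by (auto simp: saturated_def kept_arcs_def)
        define n where "n = card (kept_arcs H v)"
        have n: "n > 0" using ne kept_arcs_finite CK2 by (simp add: n_def card_gt_0_iff)
        have bij: "bij_betw (arc_index H v) (kept_arcs H v) {0..<n}"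
          using arc_index_bij CK2 by (simp add: n_def)
        \<comment> \<open>Exactly one kept edge has the residue of \<open>k\<close> as its index, so
          a single summand survives.\<close>
        have "k mod n \<in> arc_index H v ` kept_arcs H v" using bij n by (simp add: bij_betw_def)
        then obtain e where e: "e \<in> kept_arcs H v" "k mod n = arc_index H v e" by blast
        have uniq: "e' = e" if "e' \<in> kept_arcs H v" "k mod n = arc_index H v e'" for e'
          using inj_onD[OF bij_betw_imp_inj_on[OF bij], of e' e] e that by simp
        have "(\<Sum>e' \<in> out_arcs E v. word_pullback (graph_act H d) [Edge e', Ghost e'] g (u, k, m)) =
            (\<Sum>e' \<in> out_arcs E v. if e' = e then g (u, k, m) else 0)"
        proof (rule sum.cong[OF refl])
          fix e' assume "e' \<in> out_arcs E v"
          then show "word_pullback (graph_act H d) [Edge e', Ghost e'] g (u, k, m) =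
              (if e' = e then g (u, k, m) else 0)"
            using red[of e'] True e uniq[of e'] unfolding n_def[symmetric] by auto
        qed
        also have "\<dots> = g (u, k, m)"
          using e row_finite CK2 by (simp add: kept_arcs_def row_finite_def)
        finally show ?thesis using True by (simp add: word_pullback_def graph_act_def)
      next
        case False
        have "word_pullback (graph_act H d) [Edge e, Ghost e] g (u, k, m) = 0"
          if "e \<in> out_arcs E v" for e
          using red[OF that] False that hereditary_arc[OF H(1), of e] by (auto simp: kept_arcs_def)
        then show ?thesis using False by (auto simp: word_pullback_def graph_act_def)
      qed
      show ?thesis
        using sum unfolding CK2 by (simp add: gen_def word_mult pullback_diff pullback_sum)
    qed
    then show "f \<in> annihilator X (graph_act H d)"
      using f relations_C by (auto simp: annihilator_def)
  qed
qed

lemma vertex_annihilator: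
  "v \<in> verts E \<Longrightarrow> (word [Vertex v] :: _ \<Rightarrow>\<^sub>0 'k) \<in> annihilator X (graph_act H d) \<longleftrightarrow> v \<in> H"
proof
  assume v: "v \<in> verts E" and "(word [Vertex v] :: _ \<Rightarrow>\<^sub>0 'k) \<in> annihilator X (graph_act H d)"
  then have "pullback (graph_act H d) (word [Vertex v] :: _ \<Rightarrow>\<^sub>0 'k) (\<lambda>_. 1) (v, 0, 0) = 0"
    unfolding annihilator_def by blast
  then show "v \<in> H" by (auto simp: word_pullback_def graph_act_def split: if_splits)
qed (auto simp: annihilator_def word_pullback_def graph_act_def)

lemma hereditary_empty: "hereditary E {}" and saturated_empty: "saturated E {}"
  by (auto simp: hereditary_def saturated_def)

text \<open>The action with nothing removed is a module in which each vertex acts as a nonzero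
  projection.\<close>

lemma vertex_not_in_I: "v \<in> verts E \<Longrightarrow> word [Vertex v] \<notin> I"
  using relations_annihilate[OF hereditary_empty saturated_empty] vertex_annihilator[of v "{}" 0] by blast

text \<open>An edge that is alone at its source has index 0 among one residue class, and division by
  1 leaves the \<open>nat\<close> coordinate unchanged. Only the degree moves.\<close>

lemma graph_act_exitless:
  assumes "awalk u \<alpha> w" "\<And>e. e \<in> set \<alpha> \<Longrightarrow> out_arcs E (tail E e) = {e}"
  shows "word_act (graph_act {} d) (map Edge \<alpha>) (u, k, m) = Some (w, k, m - d * int (length \<alpha>))"
  using assms
proof (induction \<alpha> arbitrary: u m)
  case (Cons e \<alpha>)
  have e: "e \<in> arcs E" "u = tail E e" and walk: "awalk (head E e) \<alpha> w"
    using Cons.prems(1) by (auto simp: awalk_Cons_iff)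
  have out: "out_arcs E (tail E e) = {e}" using Cons.prems(2) by simp
  have "kept_arcs {} (tail E e) = {e}" unfolding kept_arcs_def out by simp
  then have "graph_act {} d (Edge e) (u, k, m) = Some (head E e, k, m - d)"
    using arc_index_less[OF e(1), of "{}"] by (simp add: graph_act_def e)
  then show ?case using Cons.IH[OF walk] Cons.prems(2) by (simp add: algebra_simps)
qed (simp add: awalk_Nil_iff)

section \<open>Simplicity forces trivial hereditary saturated sets and exits\<close>

lemma annihilator_dichotomy:
  assumes "simple_ring L" "hereditary E H" "saturated E H"
  shows "annihilator X (graph_act H d) = I \<or> annihilator X (graph_act H d) = C"
  using simple_dichotomy[OF assms(1) _ relations_annihilate[OF assms(2,3)]]
    annihilator_algebra_ideal[of X "graph_act H d"]
  unfolding algebra_ideal_def by blast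

text \<open>A hereditary saturated set can be recovered from its annihilator as the set of vertices
  contained in it, and simplicity leaves two annihilators only.\<close>

lemma simple_imp_hereditary_saturated_trivial:
  assumes "simple_ring L"
  shows "{H. hereditary E H \<and> saturated E H} = {{}, verts E}"
proof
  show "{H. hereditary E H \<and> saturated E H} \<subseteq> {{}, verts E}"
  proof
    fix H assume "H \<in> {H. hereditary E H \<and> saturated E H}"
    then have H: "hereditary E H" "saturated E H" and sub: "H \<subseteq> verts E" by (auto simp: hereditary_def)
    consider "annihilator X (graph_act H 0) = I" | "annihilator X (graph_act H 0) = C"
      using annihilator_dichotomy[OF assms H] by blast
    then show "H \<in> {{}, verts E}"
    proof cases
      case 1
      have "H = {}"
      proof (rule ccontr)
        assume "H \<noteq> {}"
        then obtain h where h: "h \<in> H" "h \<in> verts E" using sub by blast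
        then have "word [Vertex h] \<in> I" using vertex_annihilator[of h H 0] 1 by blast
        then show False using vertex_not_in_I h by blast
      qed
      then show ?thesis by simp
    next
      case 2
      have "v \<in> H" if "v \<in> verts E" for v
        using vertex_annihilator[OF that, of H 0] vertex_C[OF that] 2 by blast
      then show ?thesis using sub by blast
    qed
  qed
  show "{{}, verts E} \<subseteq> {H. hereditary E H \<and> saturated E H}"
    by (auto simp: hereditary_def saturated_def)
qed

text \<open>
  Without an exit, a cycle \<open>\<mu>\<close> at \<open>u\<close> acts as the identity in degree-blind coordinates but not when
  degrees are recorded, so \<open>u - \<mu>\<close> separates two annihilators.
\<close>

lemma simple_imp_exit:
  assumes simple: "simple_ring L" and \<mu>: "graph_cycle E \<mu>"
  shows "\<exists>e. is_exit E \<mu> e"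
proof (rule ccontr)
  assume no: "\<not> ?thesis"
  obtain u where u: "awalk u \<mu> u" and ne: "\<mu> \<noteq> []" using \<mu> by (auto simp: graph_cycle_def)
  have uv: "u \<in> verts E" using u by (rule awalk_hd_in_verts)
  have out: "out_arcs E (tail E e) = {e}" if e: "e \<in> set \<mu>" for e
  proof -
    have "e \<in> arcs E" using e awalk_arcs[OF u] by blast
    moreover have "f = e" if "f \<in> out_arcs E (tail E e)" for f
      using no that e unfolding is_exit_def in_set_conv_nth by auto
    ultimately show ?thesis by auto
  qed
  define z where "z = (word [Vertex u] - word (map Edge \<mu>) :: ('v, 'e) lpa_symbol list \<Rightarrow>\<^sub>0 'k)"
  have zC: "z \<in> C" using uv awalk_arcs[OF u] ne by (auto simp: z_def nonempty_words_def)
  \<comment> \<open>At points over other vertices both terms of \<open>z\<close> act as zero, so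
    only the points over \<open>u\<close> matter.\<close>
  have other: "word_act (graph_act {} d) (map Edge \<mu>) (v, k, m) = None" if "v \<noteq> u" for d v k m
    using that u ne by (cases \<mu>) (auto simp: graph_act_def awalk_Cons_iff)
  have "pullback (graph_act {} 0) z g (v, k, m) = 0" for g v k m
    using graph_act_exitless[OF u out, of 0 k m] other[of v 0 k m]
    by (cases "v = u") (auto simp: z_def pullback_diff word_pullback_def graph_act_def)
  then have "z \<in> annihilator X (graph_act {} 0)" using zC by (auto simp: annihilator_def)
  moreover have "annihilator X (graph_act {} 0) \<noteq> C"
    using vertex_annihilator[OF uv, of "{}" 0] vertex_C[OF uv] by blast
  ultimately have "z \<in> I"
    using annihilator_dichotomy[OF simple hereditary_empty saturated_empty, of 0] by blast
  then have "z \<in> annihilator X (graph_act {} 1)"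
    using relations_annihilate[OF hereditary_empty saturated_empty] by blast
  \<comment> \<open>The test function is the indicator of one point in degree 0. The vertex fixes
    this point, while \<open>\<mu>\<close> moves it to degree \<open>- length \<mu>\<close>, which
    is not 0.\<close>
  then have "pullback (graph_act {} 1) z (\<lambda>p. if p = (u, 0, 0) then 1 else 0) (u, 0, 0) = 0"
    unfolding annihilator_def by blast
  then show False
    using graph_act_exitless[OF u out, of 1 0 0] ne
    by (auto simp: z_def pullback_diff word_pullback_def graph_act_def)
qed

end

section \<open>Purely infinite simplicity\<close>

context leavitt
begin

section \<open>Pure infiniteness forces every vertex to connect to a cycle\<close>

lemma corner_span:
  assumes p: "p \<in> C" and F: "\<And>k. k \<in> Poly_Mapping.keys p \<Longrightarrow> word_arcs k \<subseteq> F" and v: "v \<in> verts E"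
  shows "word [Vertex v] * p * word [Vertex v] \<in> span_mod (normal_words F v v)"
proof (rule span_mod_linear)
  fix k assume k: "k \<in> Poly_Mapping.keys p"
  then have kX: "k \<noteq> []" "set k \<subseteq> X" using p unfolding free_algebra_carrier nonempty_words_def by auto
  have eq: "word [Vertex v] * word k * word [Vertex v] = word ([Vertex v] @ k @ [Vertex v])"
    by (simp add: word_mult)
  consider "word k \<in> I" | u u' m where "m \<in> normal_words (word_arcs k) u u'" "word k \<doteq> word m"
    using normal_form[OF kX] by blast
  then show "word [Vertex v] * word k * word [Vertex v] \<in> span_mod (normal_words F v v)"
  proof cases
    case 1
    then show ?thesis unfolding eq using v by (intro span_mod_I zero_word_context) auto
  next
    case (2 u u' m)
    then obtain \<alpha> w \<beta> where m: "m = nw \<alpha> w \<beta>" and \<alpha>: "awalk u \<alpha> w" and \<beta>: "awalk u' \<beta> w"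
      and sub: "set \<alpha> \<subseteq> F" "set \<beta> \<subseteq> F"
      using F[OF k] by (auto simp: normal_words_def)
    have mX: "m \<in> nonempty_words X" using nw_X[OF \<alpha> \<beta>] by (simp add: m)
    have eq': "word [Vertex v] * word k * word [Vertex v] \<doteq> word ([Vertex v] @ m @ [Vertex v])"
      unfolding eq using 2(2) v by (intro cong_word_context) auto
    show ?thesis
    proof (cases "u = v \<and> u' = v")
      case True
      have "word ([Vertex v] @ m @ [Vertex v]) \<doteq> word ([] @ m @ [Vertex v])"
        using cong_word_context[OF Vertex_walk_absorb[OF \<alpha>, of "map Ghost (rev \<beta>)"], of "[]" "[Vertex v]"]
          True awalk_arcs[OF \<beta>] v by (simp add: m nw_def)
      also have "\<dots> \<doteq> word m"
        using walk_Vertex_absorb[OF \<beta>, of "map Edge \<alpha>"] True awalk_arcs[OF \<alpha>] by (simp add: m nw_def)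
      finally have eq'': "word [Vertex v] * word k * word [Vertex v] \<doteq> word m" using eq' cong_trans by blast
      have "m \<in> normal_words F v v" using \<alpha> \<beta> sub True by (auto simp: m intro: normal_wordsI)
      then show ?thesis using span_mod_cong[OF eq'' span_mod_word] mX by blast
    next
      case False
      have "word ([Vertex v] @ m @ [Vertex v]) \<in> I"
      proof (cases "u = v")
        case False
        obtain y j where "m = y # j" using mX by (cases m) (auto simp: nonempty_words_def)
        moreover have "lsrc y = u" using lsrc_nw[OF \<alpha>, of \<beta>] calculation m by simp
        ultimately show ?thesis
          using mismatch_append[of "[]" "Vertex v" y "j @ [Vertex v]"] mX v False
          by (auto simp: nonempty_words_def)
      next
        case True
        obtain y j where "m = j @ [y]" using mX by (cases m rule: rev_cases) (auto simp: nonempty_words_def)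
        moreover have "ltgt y = u'" using ltgt_nw[OF \<beta>, of \<alpha>] calculation m by (metis last_snoc)
        ultimately show ?thesis
          using mismatch_append[of "Vertex v # j" y "Vertex v" "[]"] mX v False True
          by (auto simp: nonempty_words_def)
      qed
      then show ?thesis using eq' cong_in_I span_mod_I by blast
    qed
  qed
qed

text \<open>A path from \<open>v\<close> that repeats a source would lead to a cycle. Hence paths
  from \<open>v\<close> have distinct edges, of which there are finitely many lists over
  \<open>F\<close>, and the middle vertex is the end of \<open>\<alpha>\<close>.\<close>

lemma finite_normal_words:
  assumes "finite F" and acyclic: "\<not> connects_to_cycle E v"
  shows "finite (normal_words F v v)"
proof -
  define D where "D = {\<alpha>. set \<alpha> \<subseteq> F \<and> distinct \<alpha>}"
  have D: "\<alpha> \<in> D" if \<alpha>: "awalk v \<alpha> w" "set \<alpha> \<subseteq> F" for \<alpha> w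
  proof -
    have "distinct (map (tail E) \<alpha>)"
    proof (rule ccontr)
      assume "\<not> ?thesis"
      then obtain \<xi> \<mu> \<eta> where \<alpha>': "\<alpha> = \<xi> @ \<mu> @ \<eta>" and \<mu>: "graph_cycle E \<mu>"
        using cycle_in_nondistinct_walk \<alpha>(1) by blast
      then obtain e \<mu>' where e: "\<mu> = e # \<mu>'" by (cases \<mu>) (auto simp: graph_cycle_def)
      have "awalk v \<xi> (tail E e)" using \<alpha>(1) by (auto simp: \<alpha>' e awalk_Cons_iff)
      then have "path_le E v (tail E e)" by (cases "\<xi> = []") (auto simp: path_le_def awalk_Nil_iff)
      then show False using acyclic \<mu> unfolding connects_to_cycle_def e by auto
    qed
    then show ?thesis using \<alpha>(2) by (simp add: D_def distinct_map)
  qed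
  have "normal_words F v v \<subseteq> (\<lambda>(\<alpha>, \<beta>). nw \<alpha> (awlast v \<alpha>) \<beta>) ` (D \<times> D)"
  proof
    fix m assume "m \<in> normal_words F v v"
    then obtain \<alpha> w \<beta> where m: "m = nw \<alpha> w \<beta>" "awalk v \<alpha> w" "awalk v \<beta> w" "set \<alpha> \<subseteq> F" "set \<beta> \<subseteq> F"
      by (auto simp: normal_words_def)
    then have "(\<alpha>, \<beta>) \<in> D \<times> D" "m = (\<lambda>(\<alpha>, \<beta>). nw \<alpha> (awlast v \<alpha>) \<beta>) (\<alpha>, \<beta>)" using D by auto
    then show "m \<in> (\<lambda>(\<alpha>, \<beta>). nw \<alpha> (awlast v \<alpha>) \<beta>) ` (D \<times> D)" by blast
  qed
  moreover have "finite D" unfolding D_def using assms(1) by (rule finite_subset_distinct)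
  ultimately show ?thesis by (meson finite_SigmaI finite_imageI finite_subset)
qed

lemma word_arcs_mult:
  assumes "\<And>k. k \<in> Poly_Mapping.keys p \<Longrightarrow> word_arcs k \<subseteq> F"
    and "\<And>k. k \<in> Poly_Mapping.keys q \<Longrightarrow> word_arcs k \<subseteq> F"
    and "k \<in> Poly_Mapping.keys (p * q)"
  shows "word_arcs k \<subseteq> F"
proof -
  obtain a b where "a \<in> Poly_Mapping.keys p" "b \<in> Poly_Mapping.keys q" "k = a @ b"
    using keys_mult[of p q] assms(3) by (auto simp: plus_list_def)
  moreover have "word_arcs (a @ b) = word_arcs a \<union> word_arcs b" by (auto simp: word_arcs_def)
  ultimately show ?thesis using assms(1,2) by blast
qed

lemma finite_word_arcs: "finite (word_arcs k)"
proof -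
  have "word_arcs k = Edge -` set k \<union> Ghost -` set k" by (auto simp: word_arcs_def)
  then show ?thesis by (simp add: finite_vimageI inj_def)
qed

text \<open>The right ideal generated by \<open>v\<close> is nonzero, so it contains an infinite
  idempotent, which can be cut down to the corner of \<open>v\<close>. There
  \<open>dedekind_finite\<close> turns the one-sided inverse into a two-sided one.\<close>

lemma purely_infinite_imp_connects:
  assumes pi: "purely_infinite L" and v: "v \<in> verts E"
  shows "connects_to_cycle E v"
proof (rule ccontr)
  assume acyclic: "\<not> ?thesis"
  define V where "V = (word [Vertex v] :: ('v, 'e) lpa_symbol list \<Rightarrow>\<^sub>0 'k)"
  have VC: "V \<in> C" and VV: "V * V \<doteq> V"
    using v vertex_idem[OF v] by (simp_all add: V_def word_mult)
  have pV: "proj V \<in> carrier L" "proj V \<otimes>\<^bsub>L\<^esub> proj V = proj V"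
    using VC VV by (simp_all add: carrier_L mult_L proj_cong)
  define J where "J = (\<lambda>r. proj V \<otimes>\<^bsub>L\<^esub> r) ` carrier L"
  have "proj V \<in> J" unfolding J_def using pV by (metis image_eqI)
  moreover have "proj V \<noteq> \<zero>\<^bsub>L\<^esub>"
    using vertex_not_in_I[OF v] proj_eq_iff[of V 0] by (simp add: zero_L V_def)
  moreover have "right_ideal J L" unfolding J_def using pV by (intro L.principal_right_ideal)
  ultimately obtain e where e: "e \<in> J" "infinite_idempotent L e"
    using pi unfolding purely_infinite_def by blast
  then obtain r where "r \<in> carrier L" "e = proj V \<otimes>\<^bsub>L\<^esub> r" by (auto simp: J_def)
  then have "proj V \<otimes>\<^bsub>L\<^esub> e = e" using pV by (metis L.m_assoc)
  then obtain e' x y where car: "e' \<in> carrier L" "x \<in> carrier L" "y \<in> carrier L"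
    and eqs: "proj V \<otimes>\<^bsub>L\<^esub> e' = e'" "e' \<otimes>\<^bsub>L\<^esub> proj V = e'" "y \<otimes>\<^bsub>L\<^esub> proj V = y"
      "e' \<otimes>\<^bsub>L\<^esub> e' = e'" "e' \<otimes>\<^bsub>L\<^esub> x = x" "y \<otimes>\<^bsub>L\<^esub> e' = y" "y \<otimes>\<^bsub>L\<^esub> x = e'"
    and ne: "x \<otimes>\<^bsub>L\<^esub> y \<noteq> e'"
    by (rule L.infinite_idempotent_corner[OF e(2) pV])
  obtain \<epsilon> \<xi> \<eta> where C: "\<epsilon> \<in> C" "\<xi> \<in> C" "\<eta> \<in> C" and reps: "e' = proj \<epsilon>" "x = proj \<xi>" "y = proj \<eta>"
    using car unfolding carrier_L by blast
  have cong: "V * \<epsilon> \<doteq> \<epsilon>" "\<epsilon> * V \<doteq> \<epsilon>" "\<eta> * V \<doteq> \<eta>" "\<epsilon> * \<epsilon> \<doteq> \<epsilon>" "\<epsilon> * \<xi> \<doteq> \<xi>" "\<eta> * \<epsilon> \<doteq> \<eta>" "\<eta> * \<xi> \<doteq> \<epsilon>"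
    using eqs C VC by (simp_all add: reps mult_L proj_eq_cong)
  \<comment> \<open>The powers in question are built from \<open>\<epsilon>\<close> and
    \<open>\<eta>\<close> alone, so one finite set of edges serves all of them.\<close>
  define F where "F = (\<Union>k \<in> Poly_Mapping.keys \<epsilon> \<union> Poly_Mapping.keys \<eta>. word_arcs k)"
  have F: "finite F" by (simp add: F_def finite_word_arcs)
  have yC: "pow_from \<epsilon> \<eta> i \<in> C" for i by (induction i) (auto simp: C)
  have yF: "word_arcs k \<subseteq> F" if "k \<in> Poly_Mapping.keys (pow_from \<epsilon> \<eta> i)" for k i
    using that
  proof (induction i arbitrary: k)
    case (Suc i)
    show ?case
      by (rule word_arcs_mult[of "pow_from \<epsilon> \<eta> i" F \<eta>]) (use Suc in \<open>auto simp: F_def\<close>)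
  qed (auto simp: F_def)
  have Vy: "V * pow_from \<epsilon> \<eta> i \<doteq> pow_from \<epsilon> \<eta> i" for i
  proof (induction i)
    case (Suc i)
    then show ?case using cong_mult[OF Suc cong_refl[OF C(3)]] by (simp add: mult.assoc)
  qed (simp add: cong)
  have yV: "pow_from \<epsilon> \<eta> i * V \<doteq> pow_from \<epsilon> \<eta> i" for i
    using cong(2) cong_mult[OF cong_refl[OF yC] cong(3)] by (cases i) (simp_all add: mult.assoc)
  have "pow_from \<epsilon> \<eta> i \<in> span_mod (normal_words F v v)" for i
  proof (rule span_mod_cong)
    show "pow_from \<epsilon> \<eta> i \<doteq> V * pow_from \<epsilon> \<eta> i * V"
      using cong_trans[OF cong_mult[OF Vy cong_refl[OF VC]] yV] by (rule cong_sym)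
    show "V * pow_from \<epsilon> \<eta> i * V \<in> span_mod (normal_words F v v)"
      unfolding V_def by (rule corner_span[OF yC yF v])
  qed
  then have "\<xi> * \<eta> \<doteq> \<epsilon>"
    using dedekind_finite[OF finite_normal_words[OF F acyclic] C cong(4-7)] by blast
  then show False using ne C by (simp add: reps mult_L proj_cong)
qed

section \<open>The three graph conditions imply that the algebra is purely infinite simple\<close>

lemma path_le_walk:
  assumes "u \<in> verts E" "path_le E u v"
  shows "\<exists>\<pi>. awalk u \<pi> v"
  using assms awalk_Nil_iff[of u u] unfolding path_le_def by blast

lemma star_walk:
  assumes "awalk u \<pi> w"
  shows "word (Vertex w # map Ghost (rev \<pi>)) * word (map Edge \<pi> @ [Vertex w]) \<doteq> word [Vertex w]"
proof -
  have w: "w \<in> verts E" using awalk_last_in_verts[OF assms] .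
  have "word (Vertex w # map Ghost (rev \<pi>)) * word (map Edge \<pi> @ [Vertex w]) \<doteq> word [Vertex w, Vertex w]"
    using cong_word_context[OF star_prefix[of u \<pi> "[]" w], of "[Vertex w]" "[]"] assms w
    by (simp add: word_mult)
  also have "\<dots> \<doteq> word [Vertex w]" using w by (rule vertex_idem)
  finally show ?thesis .
qed

lemma simpleI:
  assumes ne: "verts E \<noteq> {}"
    and trivial: "{H. hereditary E H \<and> saturated E H} = {{}, verts E}"
    and exits: "\<And>\<mu>. graph_cycle E \<mu> \<Longrightarrow> \<exists>e. is_exit E \<mu> e"
  shows "simple_ring L"
  unfolding simple_ring_def
proof (intro conjI allI impI)
  show "nonunital_ring L" by (rule L_nonunital_ring)
  obtain v where v: "v \<in> verts E" using ne by blast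
  have "proj (word [Vertex v]) \<otimes>\<^bsub>L\<^esub> proj (word [Vertex v]) = proj (word [Vertex v])"
    using v vertex_idem[OF v] by (simp add: mult_L word_mult proj_cong)
  moreover have "proj (word [Vertex v]) \<noteq> \<zero>\<^bsub>L\<^esub>"
    using vertex_not_in_I[OF v] proj_eq_iff[of "word [Vertex v]" 0] by (simp add: zero_L)
  moreover have "proj (word [Vertex v]) \<in> carrier L" using v by (simp add: carrier_L)
  ultimately show "\<exists>x \<in> carrier L. \<exists>y \<in> carrier L. x \<otimes>\<^bsub>L\<^esub> y \<noteq> \<zero>\<^bsub>L\<^esub>" by metis
next
  fix J assume J: "two_sided_ideal J L"
  define P where "P = {p \<in> C. proj p \<in> J}"
  have P: "two_sided_ideal P (free_algebra X)" "I \<subseteq> P" "J = proj ` P"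
    using two_sided_ideal_preimage[OF J] by (simp_all add: P_def)
  have P_facts: "P \<subseteq> C" "0 \<in> P" "\<And>p q. p \<in> P \<Longrightarrow> q \<in> P \<Longrightarrow> p + q \<in> P"
    "\<And>p q. p \<in> P \<Longrightarrow> q \<in> C \<Longrightarrow> q * p \<in> P" "\<And>p q. p \<in> P \<Longrightarrow> q \<in> C \<Longrightarrow> p * q \<in> P"
    using P(1) unfolding two_sided_ideal_free_algebra by blast+
  have P_cong: "q \<in> P" if "p \<doteq> q" "p \<in> P" for p q
    using that proj_cong[OF that(1)] cong_C[OF that(1)] by (simp add: P_def)
  have P_sum: "(\<Sum>i \<in> A. f i) \<in> P" if "\<And>i. i \<in> A \<Longrightarrow> f i \<in> P" for A and f :: "_ \<Rightarrow> _ \<Rightarrow>\<^sub>0 'k"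
    using that by (induction A rule: infinite_finite_induct) (auto intro: P_facts)
  show "J = {\<zero>\<^bsub>L\<^esub>} \<or> J = carrier L"
  proof (cases "P \<subseteq> I")
    case True
    have "proj p = proj 0" if "p \<in> P" for p using True that by (auto simp: proj_eq_iff)
    then have "J = {\<zero>\<^bsub>L\<^esub>}" using P_facts(2) unfolding P(3) zero_L by blast
    then show ?thesis ..
  next
    case False
    then obtain p where p: "p \<in> P" "p \<notin> I" by blast
    obtain a b u where ab: "a \<in> C" "b \<in> C" and u: "u \<in> verts E" "a * p * b \<doteq> word [Vertex u]"
      using reduction[OF exits] p P_facts(1) by blast
    define H where "H = {v \<in> verts E. word [Vertex v] \<in> P}"
    have uH: "u \<in> H" using u p(1) ab P_facts P_cong by (simp add: H_def)
    have "hereditary E H"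
      unfolding hereditary_def
    proof (intro conjI ballI impI)
      fix w v assume w: "w \<in> H" and v: "v \<in> verts E" and le: "path_le E w v"
      obtain \<pi> where \<pi>: "awalk w \<pi> v" using path_le_walk[OF _ le] w by (auto simp: H_def)
      have X: "set \<pi> \<subseteq> arcs E" using awalk_arcs[OF \<pi>] .
      have D: "word (Vertex v # map Ghost (rev \<pi>)) \<in> C" "word (map Edge \<pi> @ [Vertex v]) \<in> C"
        using X v by (simp_all add: nonempty_words_def)
      \<comment> \<open>Heredity of \<open>H\<close> comes from \<open>v = \<pi>^* w \<pi>\<close>
        modulo the relations.\<close>
      have "word (Vertex v # map Ghost (rev \<pi>)) * (word [Vertex w] * word (map Edge \<pi> @ [Vertex v])) \<in> P"
        using w D P_facts by (simp add: H_def)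
      moreover have "word (Vertex v # map Ghost (rev \<pi>)) * (word [Vertex w] * word (map Edge \<pi> @ [Vertex v])) \<doteq>
          word (Vertex v # map Ghost (rev \<pi>)) * word (map Edge \<pi> @ [Vertex v])"
        using Vertex_walk_absorb[OF \<pi>, of "[]"] D by (intro cong_mult cong_refl) (simp_all add: word_mult)
      ultimately show "v \<in> H"
        using P_cong star_walk[OF \<pi>] v by (auto simp: H_def)
    qed (auto simp: H_def)
    moreover have "saturated E H"
      unfolding saturated_def
    proof (intro conjI ballI impI)
      fix v assume v: "v \<in> verts E" and out: "out_arcs E v \<noteq> {} \<and> head E ` out_arcs E v \<subseteq> H"
      \<comment> \<open>Saturation comes from CK2, with the range of \<open>e\<close> inserted
        between \<open>e\<close> and \<open>e^*\<close> in each summand.\<close>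
      have "(\<Sum>e \<in> out_arcs E v. word [Edge e, Ghost e]) \<in> P"
      proof (rule P_sum)
        fix e assume "e \<in> out_arcs E v"
        then have e: "e \<in> arcs E" "head E e \<in> H" using out by (simp, blast)
        then have "word [Edge e] * word [Vertex (head E e)] * word [Ghost e] \<in> P"
          using P_facts by (simp add: H_def nonempty_words_def)
        moreover have "word ([] @ [Edge e, Vertex (head E e)] @ [Ghost e]) \<doteq> word ([] @ [Edge e] @ [Ghost e])"
          using ltgt_absorb[of "Edge e"] e by (intro cong_word_context) auto
        ultimately show "word [Edge e, Ghost e] \<in> P" using P_cong by (simp add: word_mult)
      qed
      then show "v \<in> H" using P_cong[OF cong_sym[OF CK2_cong[OF v]]] out v by (auto simp: H_def)
    qed (auto simp: H_def)
    ultimately have "H = verts E" using trivial uH by blast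
    then have vP: "word [Vertex v] \<in> P" if "v \<in> verts E" for v using that by (auto simp: H_def)
    have "1 * p * 1 \<in> P" if p: "p \<in> C" for p
      unfolding expand_between[of 1 p 1]
    proof (rule P_sum)
      fix k assume "k \<in> Poly_Mapping.keys p"
      then have kX: "k \<in> nonempty_words X" using p unfolding free_algebra_carrier by blast
      then obtain x j where k: "k = x # j" by (cases k) (auto simp: nonempty_words_def)
      define c where "c = Poly_Mapping.lookup p k"
      \<comment> \<open>\<open>P\<close> is only known to be a ring ideal. The scalar is therefore
        made part of the factor from \<open>C\<close> rather than applied to an element of
        \<open>P\<close>.\<close>
      have "word [Vertex (lsrc x)] * (scalar c * word k) \<in> P"
        using kX by (intro P_facts vP) (auto simp: k nonempty_words_def)
      moreover have "word [Vertex (lsrc x)] * (scalar c * word k) \<doteq> scalar c * word k"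
        unfolding scalar_left_commute using Vertex_Cons[of x j] kX
        by (intro cong_scalar) (simp add: k word_mult nonempty_words_def)
      ultimately show "scalar (Poly_Mapping.lookup p k) * (1 * word k * 1) \<in> P"
        using P_cong by (simp add: c_def)
    qed
    then have "P = C" using P_facts(1) by auto
    then show ?thesis unfolding P(3) carrier_L by simp
  qed
qed

lemma purely_infiniteI:
  assumes exits: "\<And>\<mu>. graph_cycle E \<mu> \<Longrightarrow> \<exists>e. is_exit E \<mu> e"
    and connects: "\<And>v. v \<in> verts E \<Longrightarrow> connects_to_cycle E v"
  shows "purely_infinite L"
  unfolding purely_infinite_def
proof (intro conjI allI impI)
  show "nonunital_ring L" by (rule L_nonunital_ring)
  fix J assume J: "right_ideal J L \<and> J \<noteq> {\<zero>\<^bsub>L\<^esub>}"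
  then obtain x where x: "x \<in> J" "x \<noteq> \<zero>\<^bsub>L\<^esub>" using L.right_ideal_zero by blast
  have xL: "x \<in> carrier L" using J x L.right_ideal_carrier by blast
  then obtain p where p: "p \<in> C" "x = proj p" by (auto simp: carrier_L)
  have pI: "p \<notin> I" using x(2) p proj_eq_iff[of p 0] by (simp add: zero_L)
  obtain a b u where ab: "a \<in> C" "b \<in> C" and u: "u \<in> verts E" "a * p * b \<doteq> word [Vertex u]"
    using reduction[OF exits p(1) pI] by blast
  obtain \<mu> v where \<mu>: "graph_cycle E \<mu>" and v: "v \<in> tail E ` set \<mu>" and le: "path_le E u v"
    using connects[OF u(1)] by (auto simp: connects_to_cycle_def)
  obtain w where w: "awalk w \<mu> w" using \<mu> by (auto simp: graph_cycle_def)
  obtain i where i: "i < length \<mu>" "v = tail E (\<mu> ! i)" using v by (auto simp: in_set_conv_nth)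
  have wV: "w \<in> verts E" using w by (rule awalk_last_in_verts)
  obtain \<pi>1 where \<pi>1: "awalk u \<pi>1 v" using path_le_walk[OF u(1) le] by blast
  \<comment> \<open>The vertex \<open>v\<close> may lie anywhere on the cycle. Following the cycle
    from \<open>v\<close> onwards prolongs the path from \<open>u\<close> to the base point
    \<open>w\<close>.\<close>
  have "awalk w (take i \<mu> @ \<mu> ! i # drop (Suc i) \<mu>) w"
    using w i by (simp add: id_take_nth_drop[symmetric])
  then have "awalk v (\<mu> ! i # drop (Suc i) \<mu>) w" by (auto simp: i awalk_Cons_iff)
  then obtain \<pi> where \<pi>: "awalk u \<pi> w" using awalk_appendI[OF \<pi>1] by blast
  \<comment> \<open>The pair \<open>c\<close>, \<open>d\<close> is the cycle and its ghost, which
    make \<open>V\<close> infinite. The pair \<open>s\<close>, \<open>t\<close> is the path from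
    \<open>u\<close> to \<open>w\<close> and its ghost, which replace the vertex \<open>u\<close> by
    \<open>V\<close>.\<close>
  define V c d s t where "V = (word [Vertex w] :: ('v, 'e) lpa_symbol list \<Rightarrow>\<^sub>0 'k)"
    and "c = (word (map Edge \<mu> @ [Vertex w]) :: ('v, 'e) lpa_symbol list \<Rightarrow>\<^sub>0 'k)"
    and "d = (word (Vertex w # map Ghost (rev \<mu>)) :: ('v, 'e) lpa_symbol list \<Rightarrow>\<^sub>0 'k)"
    and "s = (word (map Edge \<pi> @ [Vertex w]) :: ('v, 'e) lpa_symbol list \<Rightarrow>\<^sub>0 'k)"
    and "t = (word (Vertex w # map Ghost (rev \<pi>)) :: ('v, 'e) lpa_symbol list \<Rightarrow>\<^sub>0 'k)"
  have arcs: "set \<mu> \<subseteq> arcs E" "set \<pi> \<subseteq> arcs E" using awalk_arcs w \<pi> by auto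
  have C: "V \<in> C" "c \<in> C" "d \<in> C" "s \<in> C" "t \<in> C"
    using arcs wV by (simp_all add: V_def c_def d_def s_def t_def nonempty_words_def)
  have "t * (word [Vertex u] * s) \<doteq> t * s"
    using Vertex_walk_absorb[OF \<pi>, of "[]"] C by (intro cong_mult cong_refl) (simp_all add: s_def word_mult)
  also have "t * s \<doteq> V" using star_walk[OF \<pi>] by (simp add: t_def s_def V_def)
  finally have tus: "t * (word [Vertex u] * s) \<doteq> V" .
  have "(t * a) * p * (b * s) = t * (a * p * b * s)" by (simp add: mult.assoc)
  also have "\<dots> \<doteq> t * (word [Vertex u] * s)" using u(2) C by (intro cong_mult cong_refl)
  also have "\<dots> \<doteq> V" by (rule tus)
  finally have axb: "(t * a) * p * (b * s) \<doteq> V" .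
  have VV: "V * V \<doteq> V" using vertex_idem[OF wV] by (simp add: V_def word_mult)
  have Vc: "V * c \<doteq> c" using Vertex_walk_absorb[OF w, of "[]"] by (simp add: V_def c_def word_mult)
  have cV: "c * V \<doteq> c"
    using snoc_Vertex[of "map Edge \<mu>" "Vertex w" w] arcs wV by (simp add: V_def c_def word_mult)
  have Vd: "V * d \<doteq> d"
    using Vertex_Cons[of "Vertex w" "map Ghost (rev \<mu>)" w] arcs wV by (simp add: V_def d_def word_mult)
  have dV: "d * V \<doteq> d" using walk_Vertex_absorb[OF w, of "[]"] by (simp add: V_def d_def word_mult)
  have dc: "d * c \<doteq> V" using star_walk[OF w] by (simp add: V_def c_def d_def)
  have cd: "\<not> c * d \<doteq> V"
  proof
    assume eq: "c * d \<doteq> V"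
    obtain f where "is_exit E \<mu> f" using exits \<mu> by blast
    then obtain j where f: "f \<in> arcs E" "j < length \<mu>" "tail E f = tail E (\<mu> ! j)" "f \<noteq> \<mu> ! j"
      by (auto simp: is_exit_def)
    \<comment> \<open>The path \<open>\<delta>\<close> follows the cycle up to the exit and leaves
      it there, so \<open>\<delta>^* c\<close> vanishes. If \<open>c d\<close> were
      \<open>V\<close>, then \<open>h = \<delta>^* V \<delta> = \<delta>^* c d \<delta>\<close>
      would vanish too.\<close>
    define \<delta> where "\<delta> = take j \<mu> @ [f]"
    define h where "h = head E f"
    have \<delta>: "awalk w \<delta> h"
      using awalk_appendI[OF awalk_take_nth[OF w f(2)]] arc_implies_awalk[OF f(1)] f(3)
      by (simp add: \<delta>_def h_def)
    have hV: "h \<in> verts E" using \<delta> by (rule awalk_last_in_verts)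
    have len: "length \<delta> \<le> length \<mu>" using f(2) by (simp add: \<delta>_def)
    have "\<not> prefix \<delta> \<mu>"
    proof
      assume "prefix \<delta> \<mu>"
      then obtain zs where "\<mu> = take j \<mu> @ f # zs" by (auto simp: \<delta>_def prefix_def)
      then have "\<mu> ! j = (take j \<mu> @ f # zs) ! j" by simp
      also have "\<dots> = f" using f(2) by (simp add: nth_append)
      finally show False using f(4) by simp
    qed
    then have "word ([Vertex h] @ (map Ghost (rev \<delta>) @ map Edge \<mu> @ [Vertex w]) @ []) \<in> I"
      using awalk_arcs[OF \<delta>] hV len by (intro zero_word_context star_zero[OF w]) auto
    then have zero: "word (Vertex h # map Ghost (rev \<delta>)) * c \<in> I" by (simp add: c_def word_mult)
    define D where "D = (word (map Edge \<delta> @ [Vertex h]) :: ('v, 'e) lpa_symbol list \<Rightarrow>\<^sub>0 'k)"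
    define D' where "D' = (word (Vertex h # map Ghost (rev \<delta>)) :: ('v, 'e) lpa_symbol list \<Rightarrow>\<^sub>0 'k)"
    have DC: "D \<in> C" "D' \<in> C" using awalk_arcs[OF \<delta>] hV by (simp_all add: D_def D'_def nonempty_words_def)
    have "word [Vertex h] \<doteq> D' * D" using star_walk[OF \<delta>] by (simp add: D_def D'_def cong_sym)
    also have "\<dots> \<doteq> D' * (V * D)"
      using cong_sym[OF Vertex_walk_absorb[OF \<delta>, of "[]"]] DC
      by (intro cong_mult cong_refl) (simp_all add: D_def V_def word_mult)
    also have "\<dots> \<doteq> D' * (c * d * D)" using cong_sym[OF eq] DC by (intro cong_mult cong_refl)
    also have "\<dots> = D' * c * (d * D)" by (simp add: mult.assoc)
    finally have "word [Vertex h] \<doteq> D' * c * (d * D)" .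
    moreover have "D' * c * (d * D) \<in> I" using zero C DC by (intro I_rmult[of "D' * c"]) (auto simp: D'_def)
    ultimately show False using vertex_not_in_I[OF hV] cong_in_I by blast
  qed
  have "\<exists>z \<in> carrier L. infinite_idempotent L (x \<otimes>\<^bsub>L\<^esub> z)"
  proof (rule L.infinite_idempotent_multiple[where a = "proj (t * a)" and b = "proj (b * s)"
        and v = "proj V" and c = "proj c" and d = "proj d"])
    show "proj c \<otimes>\<^bsub>L\<^esub> proj d \<noteq> proj V" using cd C by (simp add: mult_L proj_eq_cong)
  qed (use C ab p xL axb VV Vc cV Vd dV dc in \<open>simp_all add: carrier_L mult_L proj_eq_cong\<close>)
  then obtain z where "z \<in> carrier L" "infinite_idempotent L (x \<otimes>\<^bsub>L\<^esub> z)" by blast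
  then show "\<exists>e \<in> J. infinite_idempotent L e" using J x(1) L.right_ideal_m_closed by blast
qed

end

theorem theorem11:
  fixes E :: "('v, 'e) pre_digraph"
  assumes "wf_digraph E" and "countable (verts E)" and "countable (arcs E)"
    and "row_finite E" and "verts E \<noteq> {}"
  shows "(simple_ring (leavitt_path_algebra TYPE('k::field) E) \<and>
          purely_infinite (leavitt_path_algebra TYPE('k) E)) \<longleftrightarrow>
         ({H. hereditary E H \<and> saturated E H} = {{}, verts E} \<and>
          (\<forall>\<mu>. graph_cycle E \<mu> \<longrightarrow> (\<exists>e. is_exit E \<mu> e)) \<and>
          (\<forall>v \<in> verts E. connects_to_cycle E v))"
proof -
  interpret leavitt E "TYPE('k)"
    using assms(1,4) by (simp add: leavitt_def leavitt_axioms_def)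
  have "leavitt_path_algebra TYPE('k) E = L" by (simp add: leavitt_path_algebra_def)
  then show ?thesis
    using simple_imp_hereditary_saturated_trivial simple_imp_exit purely_infinite_imp_connects
      simpleI[OF assms(5)] purely_infiniteI by metis
qed

end
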